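(* Let $d\ge1$, $k\in\{0,\ldots,d-1\}$ and $k<s<k+1$. As $N\ge2$ and $\mathsf{A}\in P_d(\mathbb{R})^N$ vary, the maximum possible number of distinct ergodic $\varphi^s$-equilibrium states of $\mathsf{A}$ is $(d-k)\binom{d}{k}$ (that is, this number is an upper bound for every $N\ge2$ and every $\mathsf{A}\in P_d(\mathbb{R})^N$, and it is attained by some such $N$ and $\mathsf{A}$). Moreover, for every $N\ge2$ and every $\mathsf{A}\in P_d(\mathbb{R})^N$, every $\varphi^s$-equilibrium state of $\mathsf{A}$ is fully supported.
   Context: $P_d(\mathbb{R})\subset GL_d(\mathbb{R})$ is the group of generalised permutation matrices: matrices in which every row and every column has exactly one nonzero entry. Let $N\ge2$, $\Sigma=\{1,\ldots,N\}^{\mathbb{N}}$ with the product topology, and $\sigma\colon\Sigma\to\Sigma$, $\sigma(i_1i_2i_3\cdots)=i_2i_3\cdots$. Let $\Sigma_n=\{1,\ldots,N\}^n$ and let $\Sigma_*$ be the set of all finite words. For $\mathtt{i}\in\Sigma_*$ the cylinder $[\mathtt{i}]\subset\Sigma$ is the set of infinite words beginning with $\mathtt{i}$. $\mathcal{M}_\sigma(\Sigma)$ is the set of $\sigma$-invariant Borel probability measures on $\Sigma$; $\mu$ is fully supported if $\mu([\mathtt{i}])>0$ for all $\mathtt{i}\in\Sigma_*$; ergodic means ergodic with respect to $\sigma$. For $A\in GL_d(\mathbb{R})$ with singular values $\alpha_1(A)\ge\cdots\ge\alpha_d(A)>0$, the singular value function is $\varphi^s(A)=\alpha_1(A)\cdots\alpha_k(A)\,\alpha_{k+1}(A)^{s-k}$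 for $k\le s<k+1$. For $\mathsf{A}=(A_1,\ldots,A_N)\in GL_d(\mathbb{R})^N$ and $\mathtt{i}=i_1\cdots i_n$ write $A_{\mathtt{i}}=A_{i_1}\cdots A_{i_n}$. Define $P_{\mathsf{A}}(\varphi^s)=\lim_{n\to\infty}\frac1n\log\sum_{\mathtt{i}\in\Sigma_n}\varphi^s(A_{\mathtt{i}})$, and for $\mu\in\mathcal{M}_\sigma(\Sigma)$ define $h(\mu)=\lim_{n\to\infty}\frac1n\sum_{\mathtt{i}\in\Sigma_n}-\mu([\mathtt{i}])\log\mu([\mathtt{i}])$ and $\lambda_{\mathsf{A}}(\varphi^s,\mu)=\lim_{n\to\infty}\frac1n\sum_{\mathtt{i}\in\Sigma_n}\mu([\mathtt{i}])\log\varphi^s(A_{\mathtt{i}})$ (limits exist by subadditivity). $\mu\in\mathcal{M}_\sigma(\Sigma)$ is a $\varphi^s$-equilibrium state of $\mathsf{A}$ if $P_{\mathsf{A}}(\varphi^s)=h(\mu)+\lambda_{\mathsf{A}}(\varphi^s,\mu)$. *)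

theory Defs
  imports "HOL-Probability.Probability" "Jordan_Normal_Form.Char_Poly"
begin

section \<open>Matrices\<close>

definition gen_perm_mats :: "nat \<Rightarrow> real mat set" where
  "gen_perm_mats d = {A \<in> carrier_mat d d.
     (\<forall>i<d. \<exists>!j. j < d \<and> A $$ (i, j) \<noteq> 0) \<and>
     (\<forall>j<d. \<exists>!i. i < d \<and> A $$ (i, j) \<noteq> 0)}"

text \<open>
  The singular values of a square matrix in decreasing order, repeated according to multiplicity:
  square roots of the eigenvalues of \<open>A\<^sup>T A\<close>, i.e. of the roots of its characteristic
  polynomial. The list is indexed from 0, so \<open>\<alpha>\<^sub>j(A)\<close> is entry \<open>j - 1\<close>.
\<close>
definition singular_values :: "real mat \<Rightarrow> real list" where
  "singular_values A =
     rev (sorted_list_of_multiset (image_mset sqrt (proots (char_poly (transpose_mat A * A)))))"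

text \<open>
  Intended for \<open>0 \<le> s < d\<close> and invertible \<open>d \<times> d\<close> matrices; for \<open>s \<ge> d\<close> the entry
  \<open>singular_values A ! k\<close> is out of range.
\<close>
definition sv_function :: "real \<Rightarrow> real mat \<Rightarrow> real" where
  "sv_function s A =
     (let k = nat \<lfloor>s\<rfloor>
      in (\<Prod>j<k. singular_values A ! j) * (singular_values A ! k) powr (s - real k))"

definition word_mat :: "nat \<Rightarrow> (nat \<Rightarrow> real mat) \<Rightarrow> nat list \<Rightarrow> real mat" where
  "word_mat d A w = foldr (\<lambda>i M. A i * M) w (1\<^sub>m d)"


section \<open>Symbolic dynamics\<close>

definition words :: "nat \<Rightarrow> nat \<Rightarrow> nat list set" where
  "words N n = {w. set w \<subseteq> {1..N} \<and> length w = n}"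

text \<open>Infinite words are indexed from 0: \<open>x n\<close> is the letter \<open>i\<^sub>n\<^sub>+\<^sub>1\<close>.\<close>
definition full_shift :: "nat \<Rightarrow> (nat \<Rightarrow> nat) set" where
  "full_shift N = {x. \<forall>n. x n \<in> {1..N}}"

definition shift_map :: "(nat \<Rightarrow> nat) \<Rightarrow> (nat \<Rightarrow> nat)" where
  "shift_map x = (\<lambda>n. x (Suc n))"

definition cylinder :: "nat \<Rightarrow> nat list \<Rightarrow> (nat \<Rightarrow> nat) set" where
  "cylinder N w = {x \<in> full_shift N. \<forall>j<length w. x j = w ! j}"

text \<open>
  On \<open>nat \<Rightarrow> nat\<close> the topology underlying \<open>borel\<close> is the product of the discrete topologies, and
  restricting \<open>borel\<close> gives the Borel sets of the subspace \<open>full_shift N\<close>.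
\<close>
definition invariant_measures :: "nat \<Rightarrow> (nat \<Rightarrow> nat) measure set" where
  "invariant_measures N = {\<mu>. prob_space \<mu> \<and>
     space \<mu> = full_shift N \<and>
     sets \<mu> = sets (restrict_space borel (full_shift N)) \<and>
     (\<forall>B\<in>sets \<mu>. measure \<mu> (shift_map -` B \<inter> space \<mu>) = measure \<mu> B)}"

definition ergodic :: "(nat \<Rightarrow> nat) measure \<Rightarrow> bool" where
  "ergodic \<mu> \<longleftrightarrow>
     (\<forall>B\<in>sets \<mu>. shift_map -` B \<inter> space \<mu> = B \<longrightarrow> measure \<mu> B = 0 \<or> measure \<mu> B = 1)"

definition fully_supported :: "nat \<Rightarrow> (nat \<Rightarrow> nat) measure \<Rightarrow> bool" where
  "fully_supported N \<mu> \<longleftrightarrow> (\<forall>n. \<forall>w\<in>words N n. measure \<mu> (cylinder N w) > 0)"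


section \<open>Pressure, entropy, Lyapunov exponent and equilibrium states\<close>

definition pressure :: "nat \<Rightarrow> nat \<Rightarrow> (nat \<Rightarrow> real mat) \<Rightarrow> real \<Rightarrow> real" where
  "pressure d N A s =
     lim (\<lambda>n. 1 / real n * ln (\<Sum>w\<in>words N n. sv_function s (word_mat d A w)))"

text \<open>Cylinders of measure zero contribute 0, since \<open>0 * ln 0 = 0\<close>.\<close>
definition entropy_rate :: "nat \<Rightarrow> (nat \<Rightarrow> nat) measure \<Rightarrow> real" where
  "entropy_rate N \<mu> =
     lim (\<lambda>n. 1 / real n *
       (\<Sum>w\<in>words N n. - measure \<mu> (cylinder N w) * ln (measure \<mu> (cylinder N w))))"

definition lyapunov ::
    "nat \<Rightarrow> nat \<Rightarrow> (nat \<Rightarrow> real mat) \<Rightarrow> real \<Rightarrow> (nat \<Rightarrow> nat) measure \<Rightarrow> real" where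
  "lyapunov d N A s \<mu> =
     lim (\<lambda>n. 1 / real n *
       (\<Sum>w\<in>words N n. measure \<mu> (cylinder N w) * ln (sv_function s (word_mat d A w))))"

definition equilibrium_states ::
    "nat \<Rightarrow> nat \<Rightarrow> (nat \<Rightarrow> real mat) \<Rightarrow> real \<Rightarrow> (nat \<Rightarrow> nat) measure set" where
  "equilibrium_states d N A s =
     {\<mu> \<in> invariant_measures N. pressure d N A s = entropy_rate N \<mu> + lyapunov d N A s \<mu>}"

definition ergodic_equilibrium_states ::
    "nat \<Rightarrow> nat \<Rightarrow> (nat \<Rightarrow> real mat) \<Rightarrow> real \<Rightarrow> (nat \<Rightarrow> nat) measure set" where
  "ergodic_equilibrium_states d N A s = {\<mu> \<in> equilibrium_states d N A s. ergodic \<mu>}"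

end

theory Submission
  imports Defs
begin

text \<open>
  Suppose that \<open>A\<close> maps the basis vector \<open>e\<^sub>j\<close> to \<open>\<plusminus> c\<^sub>j\<close> times the basis vector with index \<open>\<pi> j\<close>,
  where \<open>\<pi>\<close> is a permutation. Then \<open>A\<^sup>T A\<close> is diagonal with entries \<open>c\<^sub>j\<^sup>2\<close>, so the singular
  values of \<open>A\<close> are the \<open>c\<^sub>j\<close>, and the singular value function is the maximum of
  \<open>(\<Prod>j\<in>S. c\<^sub>j) * c\<^sub>l powr (s - k)\<close> over all pairs \<open>(S, l)\<close> with \<open>card S = k\<close> and \<open>l \<notin> S\<close>
  (\<open>sv_function_monomial\<close>). There are \<open>(d - k) * (d choose k)\<close> such pairs, called flags below. A
  generalised permutation matrix permutes the flags, and the products above form a multiplicative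
  cocycle over this action. So on words the singular value function is, up to a factor at most the
  number of flags, the sum over all flags \<open>v\<close> of the weight that the word carries at \<open>v\<close>.

  On a single orbit of flags the sum of the weights is the sum of the entries of a product of
  nonnegative matrices, and the sum of these matrices over the alphabet is irreducible. Its
  Perron--Frobenius eigenvectors, with eigenvalue \<open>\<rho>\<^sub>v\<close> for the orbit of \<open>v\<close>, define a
  shift-invariant measure \<open>\<mu>\<^sub>v\<close> for which \<open>\<rho>\<^sub>v\<^sup>n \<mu>\<^sub>v[w]\<close> is comparable to the weight of the orbit on
  words \<open>w\<close> of length \<open>n\<close>. Irreducibility makes \<open>\<mu>\<^sub>v\<close> ergodic, and positivity of the weights makes it
  fully supported (\<open>gibbs_measure_properties\<close>).

  Hence the potential is comparable to \<open>\<Sum>\<^sub>v \<rho>\<^sub>v\<^sup>n \<mu>\<^sub>v[w]\<close>, and the pressure is the logarithm of the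
  largest eigenvalue \<open>\<rho>max\<close>. Every \<open>\<mu>\<^sub>v\<close> with \<open>\<rho>\<^sub>v = \<rho>max\<close> is an equilibrium state. Conversely, let
  \<open>\<nu>\<close> be an equilibrium state. Its relative entropy on cylinders of length \<open>n\<close> with respect to
  \<open>\<Sum>\<^sub>v (\<rho>\<^sub>v / \<rho>max)\<^sup>n \<mu>\<^sub>v\<close> is bounded uniformly in \<open>n\<close>. The terms with \<open>\<rho>\<^sub>v < \<rho>max\<close> die out, so \<open>\<nu>\<close>
  cannot charge a set that is null for all \<open>\<mu>\<^sub>v\<close> with \<open>\<rho>\<^sub>v = \<rho>max\<close> (\<open>equilibrium_dominated\<close>). The
  density of \<open>\<nu>\<close> with respect to the average of these ergodic measures is constant almost everywhere
  for each of them, so \<open>\<nu>\<close> is a combination of them with nonnegative coefficients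
  (\<open>decomposition\<close>). Therefore \<open>\<nu>\<close> is fully supported, and if it is ergodic it is one of
  them (\<open>ergodic_equilibrium_iff\<close>); this bounds the number of ergodic equilibrium states by the number
  of flags.

  The bound is attained by diagonal matrices, for which every flag is a fixed point of the action.
  It suffices that all flags have the same eigenvalue and that distinct flags give distinct weights to
  the letters (\<open>sharp_example\<close>).
\<close>

section \<open>Cylinder sets of the full shift\<close>

text \<open>
  Unions of cylinders of a fixed length: unlike single cylinders they form an algebra of sets, and
  they can be rewritten at every larger length.
\<close>
definition cyl :: "nat \<Rightarrow> nat \<Rightarrow> nat list set \<Rightarrow> (nat \<Rightarrow> nat) set" where
  "cyl N n U = {x \<in> full_shift N. map x [0..<n] \<in> U}"

definition cyls :: "nat \<Rightarrow> (nat \<Rightarrow> nat) set set" where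
  "cyls N = {cyl N n U | n U. True}"

lemma finite_words [simp]: "finite (words N n)"
  unfolding words_def by (rule finite_lists_length_eq) simp

lemma words_0 [simp]: "words N 0 = {[]}"
  by (auto simp: words_def)

lemma length_words: "w \<in> words N n \<Longrightarrow> length w = n"
  by (simp add: words_def)

lemma append_words: "u \<in> words N n \<Longrightarrow> w \<in> words N m \<Longrightarrow> u @ w \<in> words N (n + m)"
  by (auto simp: words_def)

lemma prefix_in_words: "x \<in> full_shift N \<Longrightarrow> map x [0..<n] \<in> words N n"
  by (auto simp: words_def full_shift_def)

lemma cylinder_eq_cyl: "w \<in> words N n \<Longrightarrow> cylinder N w = cyl N n {w}"
  by (auto simp: cylinder_def cyl_def words_def list_eq_iff_nth_eq)

lemma bij_betw_append_words:
  "bij_betw (\<lambda>(u, w). u @ w) (words N n \<times> words N m) (words N (n + m))"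
proof (rule bij_betwI[where g = "\<lambda>w. (take n w, drop n w)"])
  show "(\<lambda>(u, w). u @ w) \<in> words N n \<times> words N m \<rightarrow> words N (n + m)"
    by (auto simp: words_def simp del: atLeastAtMost_iff atLeastAtMost_singleton_iff) 
  show "(\<lambda>w. (take n w, drop n w)) \<in> words N (n + m) \<rightarrow> words N n \<times> words N m"
    using set_take_subset set_drop_subset by (fastforce simp: words_def)
qed (auto simp: words_def)

lemma sum_words_add:
  "(\<Sum>w\<in>words N (n + m). f w) = (\<Sum>u\<in>words N n. \<Sum>w\<in>words N m. f (u @ w))"
  using sum.reindex_bij_betw[OF bij_betw_append_words, of f N n m, symmetric]
  by (simp add: sum.cartesian_product split_def)

abbreviation mass :: "nat \<Rightarrow> (nat \<Rightarrow> nat) measure \<Rightarrow> nat list \<Rightarrow> real" where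
  "mass N \<mu> w \<equiv> measure \<mu> (cylinder N w)"

lemma cyl_subset: "cyl N n U \<subseteq> full_shift N"
  by (auto simp: cyl_def)

lemma cyl_Int_words: "cyl N n U = cyl N n (U \<inter> words N n)"
  using prefix_in_words by (auto simp: cyl_def)

lemma cyl_extend:
  assumes "n \<le> m"
  shows "cyl N n U = cyl N m {w. take n w \<in> U}"
proof -
  have "take n (map x [0..<m]) = map x [0..<n]" for x :: "nat \<Rightarrow> nat"
    using assms by (simp add: take_map take_upt)
  then show ?thesis by (simp add: cyl_def)
qed

lemma cyls_common_level:
  assumes "A \<in> cyls N" "B \<in> cyls N"
  obtains n U U' where "A = cyl N n U" "B = cyl N n U'"
proof -
  obtain n U m U' where "A = cyl N n U" "B = cyl N m U'"
    using assms by (auto simp: cyls_def)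
  then show ?thesis
    using cyl_extend[of n "max n m" N U] cyl_extend[of m "max n m" N U'] by (intro that) auto
qed

lemma cyls_Un: "A \<in> cyls N \<Longrightarrow> B \<in> cyls N \<Longrightarrow> A \<union> B \<in> cyls N"
proof -
  assume "A \<in> cyls N" "B \<in> cyls N"
  then obtain n U U' where "A = cyl N n U" "B = cyl N n U'" by (rule cyls_common_level)
  then have "A \<union> B = cyl N n (U \<union> U')" by (auto simp: cyl_def)
  then show ?thesis by (auto simp: cyls_def)
qed

lemma cyls_Int: "A \<in> cyls N \<Longrightarrow> B \<in> cyls N \<Longrightarrow> A \<inter> B \<in> cyls N"
proof -
  assume "A \<in> cyls N" "B \<in> cyls N"
  then obtain n U U' where "A = cyl N n U" "B = cyl N n U'" by (rule cyls_common_level)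
  then have "A \<inter> B = cyl N n (U \<inter> U')" by (auto simp: cyl_def)
  then show ?thesis by (auto simp: cyls_def)
qed

lemma cyls_Compl: "A \<in> cyls N \<Longrightarrow> full_shift N - A \<in> cyls N"
proof -
  assume "A \<in> cyls N"
  then obtain n U where "A = cyl N n U" by (auto simp: cyls_def)
  then have "full_shift N - A = cyl N n (- U)" by (auto simp: cyl_def)
  then show ?thesis by (auto simp: cyls_def)
qed

lemma empty_in_cyls: "{} \<in> cyls N" and full_shift_in_cyls: "full_shift N \<in> cyls N"
proof -
  have "{} = cyl N 0 {}" "full_shift N = cyl N 0 UNIV" by (auto simp: cyl_def)
  then show "{} \<in> cyls N" "full_shift N \<in> cyls N" unfolding cyls_def by blast+
qed

lemma cyls_subset: "cyls N \<subseteq> Pow (full_shift N)"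
  using cyl_subset by (auto simp: cyls_def)

lemma sets_full_shift:
  "sets (restrict_space borel (full_shift N)) = sigma_sets (full_shift N) (cyls N)"
proof
  have cp: "{x :: nat \<Rightarrow> nat. x i \<in> B} \<in> sets borel" for i B
  proof -
    have "(\<lambda>x :: nat \<Rightarrow> nat. x i) \<in> borel_measurable borel"
      by (intro borel_measurable_continuous_onI continuous_on_coordinatewise_then_product continuous_on_product_coordinates)
    then have "(\<lambda>x. x i) -` B \<inter> space borel \<in> sets (borel :: (nat \<Rightarrow> nat) measure)"
      by (rule measurable_sets) (intro borel_open Topological_Spaces.open_discrete)
    then show ?thesis by (simp add: vimage_def)
  qed
  have pre: "{x :: nat \<Rightarrow> nat. map x [0..<n] \<in> U} \<in> sets borel" for n U
  proof -
    have single: "{x :: nat \<Rightarrow> nat. map x [0..<n] = w} \<in> sets borel" for w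
    proof (cases "length w = n \<and> n > 0")
      case True
      then have "{x :: nat \<Rightarrow> nat. map x [0..<n] = w} = (\<Inter>i\<in>{..<n}. {x. x i \<in> {w ! i}})"
        by (auto simp: list_eq_iff_nth_eq)
      also have "\<dots> \<in> sets borel"
        using True by (intro sets.finite_INT cp) auto
      finally show ?thesis .
    next
      case False
      then have "{x :: nat \<Rightarrow> nat. map x [0..<n] = w} \<in> {{}, UNIV}"
        by auto
      then show ?thesis by auto
    qed
    have "{x :: nat \<Rightarrow> nat. map x [0..<n] \<in> U} = (\<Union>w\<in>U. {x. map x [0..<n] = w})"
      by auto
    also have "\<dots> \<in> sets borel"
      by (rule sets.countable_UN'') (auto simp: single)
    finally show ?thesis .
  qed
  show "sigma_sets (full_shift N) (cyls N) \<subseteq> sets (restrict_space borel (full_shift N))"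
  proof (rule sets.sigma_sets_subset[of _ "restrict_space borel (full_shift N)", simplified space_restrict_space space_borel Int_UNIV_right])
    have "cyl N n U = full_shift N \<inter> {x. map x [0..<n] \<in> U}" for n U by (auto simp: cyl_def)
    then show "cyls N \<subseteq> sets (restrict_space borel (full_shift N))"
      by (auto simp: cyls_def sets_restrict_space pre)
  qed
  have "sets (restrict_space borel (full_shift N)) =
      (\<inter>) (full_shift N) ` sigma_sets UNIV {{f. f i \<in> A} | i A. A \<in> sets (borel :: nat measure)}"
    unfolding sets_restrict_space sets_PiM_equal_borel[symmetric] sets_PiM_single by simp
  also have "\<dots> = sigma_sets (full_shift N)
      ((\<inter>) (full_shift N) ` {{f. f i \<in> A} | i A. A \<in> sets (borel :: nat measure)})"
  proof (rule sigma_sets_Int)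
    have "full_shift N = (\<Inter>i. {x. x i \<in> {1..N}})"
      by (auto simp: full_shift_def)
    also have "\<dots> \<in> sets borel"
      by (intro sets.countable_INT'' cp) auto
    finally show "full_shift N \<in> sigma_sets UNIV {{f. f i \<in> A} | i A. A \<in> sets (borel :: nat measure)}"
      unfolding sets_PiM_equal_borel[symmetric] sets_PiM_single by simp
  qed auto
  also have "\<dots> \<subseteq> sigma_sets (full_shift N) (cyls N)"
  proof (rule sigma_sets_mono, safe)
    fix i and A :: "nat set"
    have "full_shift N \<inter> {f. f i \<in> A} = cyl N (Suc i) {w. w ! i \<in> A}"
      by (auto simp: cyl_def nth_append)
    then show "full_shift N \<inter> {f. f i \<in> A} \<in> sigma_sets (full_shift N) (cyls N)"
      by (auto simp: cyls_def)
  qed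
  finally show "sets (restrict_space borel (full_shift N)) \<subseteq> sigma_sets (full_shift N) (cyls N)" .
qed

text \<open>
  The sets that can be approximated by unions of cylinders, simultaneously for finitely many finite
  measures, form a \<open>\<sigma>\<close>-algebra. Simultaneity is essential later, where a set that is null for some
  measures and not for another one has to be replaced by a union of cylinders.
\<close>
lemma cylinder_approximation:
  fixes F :: "(nat \<Rightarrow> nat) measure set" and e :: real
  assumes "finite F"
    and "\<And>M. M \<in> F \<Longrightarrow> finite_measure M"
    and "\<And>M. M \<in> F \<Longrightarrow> sets M = sigma_sets (full_shift N) (cyls N)"
    and "B \<in> sigma_sets (full_shift N) (cyls N)" "0 < e"
  shows "\<exists>A\<in>cyls N. \<forall>M\<in>F. measure M (sym_diff A B) < e"
  using assms(4,5)
proof (induction arbitrary: e rule: sigma_sets.induct)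
  case (Basic a)
  then show ?case by (intro bexI[of _ a]) auto
next
  case Empty
  then show ?case by (intro bexI[of _ "{}"]) (auto simp: empty_in_cyls)
next
  case (Compl a)
  then obtain A where A: "A \<in> cyls N" "\<forall>M\<in>F. measure M (sym_diff A a) < e" by blast
  have "A \<subseteq> full_shift N" using A cyls_subset by auto
  moreover have "a \<subseteq> full_shift N"
    using Compl.hyps cyls_subset by (auto dest: sigma_sets_into_sp)
  ultimately have "((full_shift N - A) - (full_shift N - a)) \<union> ((full_shift N - a) - (full_shift N - A))
      = sym_diff A a" by auto
  then show ?case using A cyls_Compl by (intro bexI[of _ "full_shift N - A"]) simp_all
next
  case (Union a)
  have a_sets: "a i \<in> sets M" if "M \<in> F" for M i using assms(3)[OF that] Union.hyps by simp
  have "\<forall>\<^sub>F n in sequentially. \<forall>M\<in>F. measure M ((\<Union>i. a i) - (\<Union>i<n. a i)) < e / 2"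
  proof (rule eventually_ball_finite[OF \<open>finite F\<close>], rule ballI)
    fix M assume M: "M \<in> F"
    interpret finite_measure M using assms(2) M by blast
    have "(\<lambda>n. measure M (\<Union>i<n. a i)) \<longlonglongrightarrow> measure M (\<Union>n. \<Union>i<n. a i)"
      using a_sets[OF M] by (intro finite_Lim_measure_incseq) (auto simp: incseq_def, force)
    also have "(\<Union>n. \<Union>i<n. a i) = (\<Union>i. a i)" by auto
    finally have "(\<lambda>n. measure M (\<Union>i. a i) - measure M (\<Union>i<n. a i)) \<longlonglongrightarrow> 0"
      by (auto intro!: tendsto_eq_intros)
    moreover have "measure M (\<Union>i. a i) - measure M (\<Union>i<n. a i)
        = measure M ((\<Union>i. a i) - (\<Union>i<n. a i))" for n
      using a_sets[OF M] by (intro finite_measure_Diff[symmetric]) auto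
    ultimately show "\<forall>\<^sub>F n in sequentially. measure M ((\<Union>i. a i) - (\<Union>i<n. a i)) < e / 2"
      using Union.prems order_tendstoD(2)[of _ 0 sequentially "e / 2"] by simp
  qed
  then obtain n where n: "measure M ((\<Union>i. a i) - (\<Union>i<n. a i)) < e / 2" if "M \<in> F" for M
    by (auto simp: eventually_sequentially)
  define \<delta> where "\<delta> = e / (2 * real (Suc n))"
  have \<delta>: "\<delta> > 0" "real n * \<delta> \<le> e / 2"
    using Union.prems by (auto simp: \<delta>_def field_simps)
  have "\<exists>A\<in>cyls N. \<forall>M\<in>F. measure M ((A - a i) \<union> (a i - A)) < \<delta>" for i
    using Union.IH \<delta>(1) by blast
  then obtain A where A: "A i \<in> cyls N" "\<And>M. M \<in> F \<Longrightarrow> measure M (sym_diff (A i) (a i)) < \<delta>" for i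
    by metis
  have "(\<Union>i<m. A i) \<in> cyls N" for m
    by (induction m) (auto simp: lessThan_Suc empty_in_cyls intro!: cyls_Un A)
  moreover have "measure M (((\<Union>i<n. A i) - (\<Union>i. a i)) \<union> ((\<Union>i. a i) - (\<Union>i<n. A i))) < e"
    if M: "M \<in> F" for M
  proof -
    interpret finite_measure M using assms(2) M by blast
    have A_sets: "A i \<in> sets M" for i using assms(3)[OF M] A(1) by auto
    have "measure M (((\<Union>i<n. A i) - (\<Union>i. a i)) \<union> ((\<Union>i. a i) - (\<Union>i<n. A i)))
        \<le> measure M ((\<Union>i<n. sym_diff (A i) (a i)) \<union> ((\<Union>i. a i) - (\<Union>i<n. a i)))"
      using a_sets[OF M] A_sets by (intro finite_measure_mono) auto
    also have "\<dots> \<le> measure M (\<Union>i<n. sym_diff (A i) (a i))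
        + measure M ((\<Union>i. a i) - (\<Union>i<n. a i))"
      using a_sets[OF M] A_sets by (intro measure_Un_le) auto
    also have "measure M (\<Union>i<n. sym_diff (A i) (a i))
        \<le> (\<Sum>i<n. measure M (sym_diff (A i) (a i)))"
      using a_sets[OF M] A_sets by (intro finite_measure_subadditive_finite) auto
    also have "\<dots> \<le> (\<Sum>i<n. \<delta>)" by (intro sum_mono less_imp_le A M)
    finally show ?thesis using n[OF M] \<delta>(2) by simp
  qed
  ultimately show ?case by blast
qed


section \<open>Shift-invariant measures\<close>

lemma shift_funpow: "(shift_map ^^ m) x = (\<lambda>n. x (n + m))"
  by (induction m) (auto simp: shift_map_def)

lemma shift_in_full_shift: "x \<in> full_shift N \<Longrightarrow> (shift_map ^^ m) x \<in> full_shift N"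
  by (simp add: shift_funpow full_shift_def)

lemma shift_vimage_cyl:
  "(shift_map ^^ m) -` cyl N n U \<inter> full_shift N = cyl N (m + n) {w. drop m w \<in> U}"
proof -
  have "drop m (map x [0..<m + n]) = map ((shift_map ^^ m) x) [0..<n]" for x
    by (auto simp: list_eq_iff_nth_eq shift_funpow add.commute)
  then show ?thesis
    by (auto simp: cyl_def shift_in_full_shift)
qed

text \<open>
  The part of the theory that does not use invariance; it applies to a measure before its
  invariance is known.
\<close>
locale full_shift_measure = prob_space \<mu> for \<mu> :: "(nat \<Rightarrow> nat) measure" +
  fixes N :: nat
  assumes sets_eq: "sets \<mu> = sigma_sets (full_shift N) (cyls N)"
begin

lemma space_eq: "space \<mu> = full_shift N"
  using sets_eq_imp_space_eq[of \<mu> "restrict_space borel (full_shift N)"]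
  by (simp add: sets_eq sets_full_shift space_restrict_space)

lemma cyl_in_sets [simp]: "cyl N n U \<in> sets \<mu>"
  by (auto simp: sets_eq cyls_def)

lemma cylinder_in_sets: "w \<in> words N n \<Longrightarrow> cylinder N w \<in> sets \<mu>"
  by (simp add: cylinder_eq_cyl)

lemma measurable_shift: "shift_map \<in> measurable \<mu> \<mu>"
proof (rule measurable_sigma_sets[OF sets_eq])
  show "cyls N \<subseteq> Pow (full_shift N)" by (rule cyls_subset)
  show "shift_map \<in> space \<mu> \<rightarrow> full_shift N"
    by (auto simp: space_eq full_shift_def shift_map_def)
  show "shift_map -` A \<inter> space \<mu> \<in> sets \<mu>" if *: "A \<in> cyls N" for A
  proof -
    obtain n U where A: "A = cyl N n U" using * by (auto simp: cyls_def)
    show ?thesis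
      using shift_vimage_cyl[of 1 N n U] cyl_in_sets[of "1 + n"] unfolding A space_eq by simp
  qed
qed

lemma measurable_shift_funpow: "shift_map ^^ m \<in> measurable \<mu> \<mu>"
proof (induction m)
  case (Suc m)
  show ?case unfolding funpow.simps by (rule measurable_comp[OF Suc measurable_shift])
qed (simp add: id_def)

lemma measure_cyl:
  "measure \<mu> (cyl N n U) = (\<Sum>w\<in>U \<inter> words N n. mass N \<mu> w)"
proof -
  have "measure \<mu> (cyl N n U) = measure \<mu> (\<Union>w\<in>U \<inter> words N n. cyl N n {w})"
    by (rule arg_cong[of _ _ "measure \<mu>"], subst cyl_Int_words) (auto simp: cyl_def)
  also have "\<dots> = (\<Sum>w\<in>U \<inter> words N n. measure \<mu> (cyl N n {w}))"
  proof (rule finite_measure_finite_Union)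
    show "disjoint_family_on (\<lambda>w. cyl N n {w}) (U \<inter> words N n)"
      by (auto simp: disjoint_family_on_def cyl_def)
  qed auto
  also have "\<dots> = (\<Sum>w\<in>U \<inter> words N n. mass N \<mu> w)"
    by (intro sum.cong refl) (auto simp: cylinder_eq_cyl)
  finally show ?thesis .
qed

lemma sum_measure_cylinder: "(\<Sum>w\<in>words N n. mass N \<mu> w) = 1"
  using measure_cyl[of n UNIV] prob_space by (simp add: cyl_def space_eq)

lemma sum_measure_cylinder_append:
  assumes "u \<in> words N n"
  shows "(\<Sum>w\<in>words N m. mass N \<mu> (u @ w)) = mass N \<mu> u"
proof -
  have "cylinder N u = cyl N (n + m) {w. take n w \<in> {u}}"
    using assms cyl_extend[of n "n + m" N "{u}"] by (simp add: cylinder_eq_cyl)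
  then have "mass N \<mu> u
      = (\<Sum>w\<in>{w. take n w = u} \<inter> words N (n + m). mass N \<mu> w)"
    using measure_cyl by simp
  also have "{w. take n w = u} \<inter> words N (n + m) = (\<lambda>w. u @ w) ` words N m"
  proof -
    have "w \<in> (\<lambda>w. u @ w) ` words N m" if "take n w = u" "w \<in> words N (n + m)" for w
    proof (rule image_eqI)
      show "w = u @ drop n w" using that(1) by (metis append_take_drop_id)
      show "drop n w \<in> words N m"
        using that(2) set_drop_subset[of n w] by (simp add: words_def) blast
    qed
    then show ?thesis using append_words[OF assms] length_words[OF assms] by auto
  qed
  finally show ?thesis by (simp add: sum.reindex inj_on_def)
qed

end

locale invariant_measure = full_shift_measure \<mu> N for \<mu> N +
  assumes measure_shift_vimage_1:
    "B \<in> sets \<mu> \<Longrightarrow> measure \<mu> (shift_map -` B \<inter> full_shift N) = measure \<mu> B"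
begin

lemma measure_shift_vimage:
  assumes "B \<in> sets \<mu>"
  shows "measure \<mu> ((shift_map ^^ m) -` B \<inter> full_shift N) = measure \<mu> B"
proof (induction m)
  case 0
  have "B \<subseteq> full_shift N" using assms sets.sets_into_space space_eq by blast
  then show ?case by (simp add: Int_absorb2)
next
  case (Suc m)
  let ?C = "(shift_map ^^ m) -` B \<inter> full_shift N"
  have "?C \<in> sets \<mu>"
    using measurable_sets[OF measurable_shift_funpow assms, of m] by (simp add: space_eq)
  then have "measure \<mu> (shift_map -` ?C \<inter> full_shift N) = measure \<mu> ?C"
    by (rule measure_shift_vimage_1)
  also have "shift_map -` ?C \<inter> full_shift N = (shift_map ^^ Suc m) -` B \<inter> full_shift N"
    using shift_in_full_shift[of _ N 1] by (auto simp: funpow_Suc_right simp del: funpow.simps)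
  finally show ?case using Suc by (simp only:)
qed

lemma sum_measure_cylinder_prepend:
  assumes "w \<in> words N m"
  shows "(\<Sum>u\<in>words N n. mass N \<mu> (u @ w)) = mass N \<mu> w"
proof -
  have "mass N \<mu> w = measure \<mu> ((shift_map ^^ n) -` cyl N m {w} \<inter> full_shift N)"
    using assms by (simp add: measure_shift_vimage cylinder_eq_cyl)
  also have "\<dots> = (\<Sum>v\<in>{v. drop n v = w} \<inter> words N (n + m). measure \<mu> (cylinder N v))"
    by (simp add: shift_vimage_cyl measure_cyl)
  also have "{v. drop n v = w} \<inter> words N (n + m) = (\<lambda>u. u @ w) ` words N n"
  proof -
    have "v \<in> (\<lambda>u. u @ w) ` words N n" if "drop n v = w" "v \<in> words N (n + m)" for v
    proof (rule image_eqI)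
      show "v = take n v @ w" using that(1) by (metis append_take_drop_id)
      show "take n v \<in> words N n"
        using that(2) set_take_subset[of n v] by (simp add: words_def) blast
    qed
    then show ?thesis using append_words[OF _ assms] length_words by fastforce
  qed
  finally show ?thesis by (simp add: sum.reindex inj_on_def)
qed

end

lemma invariant_measures_iff: "\<mu> \<in> invariant_measures N \<longleftrightarrow> invariant_measure \<mu> N"
proof
  assume "\<mu> \<in> invariant_measures N"
  then have *: "prob_space \<mu>" "sets \<mu> = sigma_sets (full_shift N) (cyls N)" "space \<mu> = full_shift N"
    "\<forall>B\<in>sets \<mu>. measure \<mu> (shift_map -` B \<inter> space \<mu>) = measure \<mu> B"
    unfolding invariant_measures_def sets_full_shift by blast+
  show "invariant_measure \<mu> N"
    by (intro invariant_measure.intro full_shift_measure.intro full_shift_measure_axioms.intro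
        invariant_measure_axioms.intro *(1,2)) (use *(3,4) in metis)
next
  assume "invariant_measure \<mu> N"
  then interpret invariant_measure \<mu> N .
  show "\<mu> \<in> invariant_measures N"
    unfolding invariant_measures_def sets_full_shift
    using prob_space_axioms space_eq sets_eq measure_shift_vimage_1 by simp
qed

text \<open>
  The unions of cylinders are an intersection-stable generator.
\<close>
lemma full_shift_measure_eqI:
  assumes "full_shift_measure \<mu> N" "full_shift_measure \<nu> N"
    and eq: "\<And>n w. w \<in> words N n \<Longrightarrow> mass N \<mu> w = mass N \<nu> w"
  shows "\<mu> = \<nu>"
proof (rule measure_eqI_generator_eq[of "cyls N" "full_shift N" _ _ "\<lambda>_. full_shift N"])
  interpret m: full_shift_measure \<mu> N by fact
  interpret n: full_shift_measure \<nu> N by fact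
  show "Int_stable (cyls N)" by (auto simp: Int_stable_def intro: cyls_Int)
  fix X assume "X \<in> cyls N"
  then obtain n U where X: "X = cyl N n U" by (auto simp: cyls_def)
  show "emeasure \<mu> X = emeasure \<nu> X"
    unfolding X m.emeasure_eq_measure n.emeasure_eq_measure m.measure_cyl n.measure_cyl
    by (intro arg_cong[of _ _ ennreal] sum.cong refl eq[of _ n]) auto
next
  show "emeasure \<mu> (full_shift N) \<noteq> \<infinity>"
    using assms(1) by (simp add: full_shift_measure_def prob_space.finite_measure finite_measure.emeasure_finite)
qed (use cyls_subset full_shift_in_cyls assms in \<open>auto simp: full_shift_measure_def full_shift_measure_axioms_def\<close>)

text \<open>
  The image measure under the shift has the same cylinder masses, hence is the same measure.
\<close>
lemma invariant_measureI:
  assumes "full_shift_measure \<mu> N"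
    and eq: "\<And>n w. w \<in> words N n \<Longrightarrow>
      (\<Sum>a\<in>{1..N}. mass N \<mu> (a # w)) = mass N \<mu> w"
  shows "\<mu> \<in> invariant_measures N"
proof -
  interpret full_shift_measure \<mu> N by fact
  interpret D: full_shift_measure "distr \<mu> \<mu> shift_map" N
    by (intro full_shift_measure.intro prob_space_distr full_shift_measure_axioms.intro measurable_shift)
       (simp add: sets_eq)
  have "measure (distr \<mu> \<mu> shift_map) (cylinder N w) = mass N \<mu> w"
    if w: "w \<in> words N n" for n w
  proof -
    have "measure (distr \<mu> \<mu> shift_map) (cylinder N w) = measure \<mu> ((shift_map ^^ 1) -` cyl N n {w} \<inter> full_shift N)"
      using cylinder_in_sets[OF w] w
      by (subst measure_distr[OF measurable_shift]) (simp_all add: space_eq cylinder_eq_cyl)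
    also have "\<dots> = (\<Sum>v\<in>{v. drop 1 v = w} \<inter> words N (1 + n). measure \<mu> (cylinder N v))"
      unfolding shift_vimage_cyl measure_cyl by simp
    also have "{v. drop 1 v = w} \<inter> words N (1 + n) = (\<lambda>a. a # w) ` {1..N}"
    proof (intro equalityI subsetI)
      fix v assume v: "v \<in> {v. drop 1 v = w} \<inter> words N (1 + n)"
      then obtain a v' where "v = a # v'" by (cases v) (auto simp: words_def)
      with v show "v \<in> (\<lambda>a. a # w) ` {1..N}" by (simp add: words_def)
    next
      fix v assume "v \<in> (\<lambda>a. a # w) ` {1..N}"
      with w show "v \<in> {v. drop 1 v = w} \<inter> words N (1 + n)" by (auto simp: words_def)
    qed
    also have "(\<Sum>v\<in>(\<lambda>a. a # w) ` {1..N}. measure \<mu> (cylinder N v))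
        = (\<Sum>a\<in>{1..N}. mass N \<mu> (a # w))"
      by (simp add: sum.reindex inj_on_def)
    finally show ?thesis using eq[OF w] by simp
  qed
  then have "distr \<mu> \<mu> shift_map = \<mu>"
    by (intro full_shift_measure_eqI[of _ N]) unfold_locales
  then have "measure \<mu> (shift_map -` B \<inter> space \<mu>) = measure \<mu> B" if "B \<in> sets \<mu>" for B
    using measure_distr[OF measurable_shift that] by simp
  then show ?thesis
    unfolding invariant_measures_def sets_full_shift using prob_space_axioms space_eq sets_eq by blast
qed

section \<open>Measures with prescribed cylinder masses\<close>

text \<open>
  The Ionescu-Tulcea theorem, applied to the conditional probabilities \<open>m (w @ [a]) / m w\<close> of the
  next letter \<open>a\<close> after the word \<open>w\<close>. Positivity of \<open>m\<close> makes these quotients meaningful everywhere.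
\<close>
lemma exists_full_shift_measure:
  fixes m :: "nat list \<Rightarrow> real"
  assumes pos: "\<And>n w. w \<in> words N n \<Longrightarrow> 0 < m w"
    and one: "m [] = 1"
    and snoc: "\<And>n w. w \<in> words N n \<Longrightarrow> (\<Sum>a\<in>{1..N}. m (w @ [a])) = m w"
  shows "\<exists>\<mu>. full_shift_measure \<mu> N \<and> (\<forall>n. \<forall>w\<in>words N n. mass N \<mu> w = m w)"
proof -
  define M :: "nat \<Rightarrow> nat measure" where "M = (\<lambda>_. count_space {1..N})"
  define P :: "nat \<Rightarrow> (nat \<Rightarrow> nat) \<Rightarrow> nat measure"
    where "P n x = point_measure {1..N} (\<lambda>a. ennreal (m (map x [0..<n] @ [a]) / m (map x [0..<n])))" for n x
  have space_M: "space (M i) = {1..N}" for i by (simp add: M_def)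
  have PiM_M: "PiM {0..<n} M = count_space (PiE {0..<n} (\<lambda>_. {1..N}))" for n
    unfolding M_def by (rule count_space_PiM_finite) auto
  have wordI: "map x [0..<n] \<in> words N n" if "x \<in> PiE {0..<n} (\<lambda>_. {1..N})" for x n
  proof -
    have "x j \<in> {1..N}" if "j < n" for j
      using \<open>x \<in> _\<close> that by (auto simp del: atLeastAtMost_iff)
    then show ?thesis by (auto simp: words_def simp del: atLeastAtMost_iff)
  qed
  have prob_P: "prob_space (P n x)" if x: "x \<in> PiE {0..<n} (\<lambda>_. {1..N})" for n x
  proof
    let ?w = "map x [0..<n]"
    have w: "?w \<in> words N n" using wordI x by simp
    have w': "?w @ [a] \<in> words N (Suc n)" if "a \<in> {1..N}" for a
      using w that by (simp add: words_def)
    have "emeasure (P n x) (space (P n x)) = (\<Sum>a\<in>{1..N}. ennreal (m (?w @ [a]) / m ?w))"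
      by (simp add: P_def space_point_measure emeasure_point_measure_finite)
    also have "\<dots> = ennreal (\<Sum>a\<in>{1..N}. m (?w @ [a]) / m ?w)"
      by (intro sum_ennreal divide_nonneg_nonneg less_imp_le pos[OF w] pos[OF w'])
    also have "(\<Sum>a\<in>{1..N}. m (?w @ [a]) / m ?w) = 1"
      using snoc[OF w] pos[OF w] by (simp add: sum_divide_distrib[symmetric])
    finally show "emeasure (P n x) (space (P n x)) = 1" by simp
  qed
  have P_meas: "P i \<in> measurable (PiM {0..<i} M) (subprob_algebra (M i))" for i
    unfolding PiM_M measurable_count_space_eq1
    using prob_P by (auto simp: space_subprob_algebra prob_space_imp_subprob_space P_def M_def sets_point_measure)
  interpret IT: Ionescu_Tulcea P M
  proof (rule Ionescu_Tulcea.intro)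
    show "P i \<in> measurable (PiM {0..<i} M) (subprob_algebra (M i))" for i by (rule P_meas)
    fix i x assume "x \<in> space (PiM {0..<i} M)"
    then show "prob_space (P i x)" using prob_P by (simp add: PiM_M)
  qed
  let ?C = "\<lambda>n. IT.C 0 n (\<lambda>_. undefined)"
  define r :: "nat list \<Rightarrow> nat \<Rightarrow> nat" where "r w = restrict (\<lambda>j. w ! j) {0..<length w}" for w
  have r_in: "r w \<in> PiE {0..<n} (\<lambda>_. {1..N})" if "w \<in> words N n" for w n
  proof (rule PiE_I)
    have len: "length w = n" and set: "set w \<subseteq> {1..N}" using that by (simp_all add: words_def)
    fix j assume "j \<in> {0..<n}"
    then have "r w j = w ! j" "w ! j \<in> set w" using len by (simp_all add: r_def)
    then show "r w j \<in> {1..N}" using set by (simp only: subset_iff)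
  next
    fix j assume "j \<notin> {0..<n}"
    then show "r w j = undefined" using length_words[OF that] by (simp add: r_def)
  qed
  have C: "emeasure (?C n) {r w} = ennreal (m w)" if "w \<in> words N n" for n w
    using that
  proof (induction n arbitrary: w)
    case 0
    then show ?case by (simp add: r_def one sets_PiM_empty restrict_def)
  next
    case (Suc n)
    have undef: "(\<lambda>_. undefined) \<in> space (PiM {0..<0} M)" by (simp add: space_PiM)
    obtain v a where w: "w = v @ [a]" "v \<in> words N n" "a \<in> {1..N}"
      using Suc.prems by (cases w rule: rev_cases) (auto simp: words_def)
    have len: "length v = n" using w(2) by (rule length_words)
    have spC: "space (?C n) = PiE {0..<n} (\<lambda>_. {1..N})"
      using IT.space_C[OF undef, of n] by (simp add: PiM_M)
    have rw: "{r w} \<in> sets (PiM {0..<Suc n} M)"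
      using r_in[OF Suc.prems] by (simp add: PiM_M)
    have step: "emeasure (IT.eP n x) {r w} = ennreal (m w / m v) * indicator {r v} x"
      if x: "x \<in> PiE {0..<n} (\<lambda>_. {1..N})" for x
    proof -
      have "emeasure (IT.eP n x) {r w} = emeasure (P n x) ((\<lambda>a. x(n := a)) -` {r w} \<inter> {1..N})"
        using x IT.emeasure_eP[OF _ rw, of x] by (simp add: PiM_M) (simp add: M_def)
      also have "(\<lambda>a. x(n := a)) -` {r w} \<inter> {1..N} = (if x = r v then {a} else {})"
      proof (cases "x = r v")
        case True
        have "x(n := b) = r w \<longleftrightarrow> b = a" for b
          using True len by (auto simp: r_def w(1) fun_eq_iff nth_append restrict_def)
        then show ?thesis using True w(3) by auto
      next
        case False
        have "x(n := b) \<noteq> r w" for b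
        proof
          assume eq: "x(n := b) = r w"
          have "x j = r v j" for j
          proof (cases "j < n")
            case True
            then show ?thesis using fun_cong[OF eq, of j] len by (simp add: r_def w(1) nth_append)
          next
            case False
            then show ?thesis using x len by (simp add: r_def PiE_iff extensional_def)
          qed
          then show False using \<open>x \<noteq> r v\<close> by blast
        qed
        then show ?thesis using False by auto
      qed
      also have "emeasure (P n x) (if x = r v then {a} else {}) = ennreal (m w / m v) * indicator {r v} x"
      proof (cases "x = r v")
        case True
        then have "map x [0..<n] = v"
          using len by (auto simp: r_def list_eq_iff_nth_eq)
        then show ?thesis using True w
          by (simp add: P_def emeasure_point_measure_finite)
      qed simp
      finally show ?thesis .
    qed
    have "emeasure (?C (Suc n)) {r w}
        = (\<integral>\<^sup>+x. emeasure (IT.eP n x) {r w} \<partial>?C n)"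
    proof -
      have eq: "sets (?C n) = sets (PiM {0..<n} M)"
        using IT.sets_C[OF undef, of n] by simp
      have "IT.eP n \<in> measurable (?C n) (subprob_algebra (PiM {0..<Suc n} M))"
        unfolding measurable_cong_sets[OF eq refl] by (rule IT.measurable_eP)
      moreover have "space (?C n) \<noteq> {}" using spC r_in[OF w(2)] by auto
      ultimately show ?thesis using emeasure_bind rw by simp
    qed
    also have "\<dots> = (\<integral>\<^sup>+x. ennreal (m w / m v) * indicator {r v} x \<partial>?C n)"
      using step spC by (intro nn_integral_cong) simp
    also have "\<dots> = ennreal (m w / m v) * emeasure (?C n) {r v}"
      using r_in[OF w(2)] IT.sets_C[OF undef, of n]
      by (subst nn_integral_cmult_indicator) (simp_all add: PiM_M)
    also have "\<dots> = ennreal (m w)"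
      using Suc.IH[OF w(2)] pos[OF w(2)] pos[OF Suc.prems]
      by (simp add: ennreal_mult[symmetric] less_imp_le)
    finally show ?case .
  qed
  define \<mu> where "\<mu> = distr IT.PF.lim (restrict_space borel (full_shift N)) (\<lambda>x. x)"
  have space_lim: "space IT.PF.lim = full_shift N"
    unfolding IT.PF.space_lim space_PiM space_M by (auto simp: full_shift_def PiE_iff)
  have id_meas: "(\<lambda>x. x) \<in> measurable IT.PF.lim (restrict_space borel (full_shift N))"
  proof (rule measurable_restrict_space2)
    show "(\<lambda>x. x) \<in> space IT.PF.lim \<rightarrow> full_shift N" by (simp only: space_lim) simp
    have "(\<lambda>x. x i) \<in> measurable (PiM UNIV M) borel" for i
    proof (rule measurable_compose)
      show "(\<lambda>x. x i) \<in> measurable (PiM UNIV M) (M i)" by (rule measurable_component_singleton) simp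
    qed (simp add: M_def)
    then have "(\<lambda>x. x) \<in> measurable (PiM UNIV M) (PiM UNIV (\<lambda>_. borel :: nat measure))"
      by (intro measurable_PiM_single') (auto simp: space_PiM)
    then show "(\<lambda>x. x) \<in> measurable IT.PF.lim (borel :: (nat \<Rightarrow> nat) measure)"
      unfolding measurable_cong_sets[OF IT.PF.sets_lim sets_PiM_equal_borel[symmetric]] .
  qed
  have "prob_space IT.PF.lim"
  proof
    have "emeasure IT.PF.lim (space IT.PF.lim) = emeasure IT.PF.lim (prod_emb UNIV M {0..<0} {\<lambda>_. undefined})"
      by (simp add: prod_emb_def space_PiM restrict_def)
    also have "\<dots> = emeasure (IT.CI {0..<0}) {\<lambda>_. undefined}"
      by (rule IT.lim) (simp_all add: sets_PiM_empty)
    also have "\<dots> = emeasure (?C 0) (prod_emb {0..<0} M {0..<0} {\<lambda>_. undefined})"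
      by (rule IT.emeasure_CI) (simp_all add: sets_PiM_empty)
    also have "\<dots> = 1" by (simp add: sets_PiM_empty prod_emb_def restrict_def)
    finally show "emeasure IT.PF.lim (space IT.PF.lim) = 1" .
  qed
  then have \<mu>: "full_shift_measure \<mu> N"
    unfolding \<mu>_def
    by (intro full_shift_measure.intro prob_space.prob_space_distr id_meas full_shift_measure_axioms.intro)
       (simp_all add: sets_full_shift)
  interpret full_shift_measure \<mu> N by fact
  have "mass N \<mu> w = m w" if w: "w \<in> words N n" for n w
  proof -
    have len: "length w = n" using w by (rule length_words)
    have emb: "prod_emb UNIV M {0..<n} {r w} = cylinder N w"
    proof -
      have "(\<forall>j<n. x j = w ! j) \<longleftrightarrow> restrict x {0..<n} = r w" for x
        using len by (auto simp: r_def restrict_def fun_eq_iff)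
      then show ?thesis
        using len by (auto simp: cylinder_def prod_emb_def space_M full_shift_def PiE_iff)
    qed
    have "emeasure \<mu> (cylinder N w) = emeasure IT.PF.lim ((\<lambda>x. x) -` cylinder N w \<inter> space IT.PF.lim)"
      using cylinder_in_sets[OF w] unfolding \<mu>_def by (intro emeasure_distr[OF id_meas]) simp
    also have "(\<lambda>x. x) -` cylinder N w \<inter> space IT.PF.lim = prod_emb UNIV M {0..<n} {r w}"
      unfolding space_lim emb by (auto simp: cylinder_def)
    also have "emeasure IT.PF.lim (prod_emb UNIV M {0..<n} {r w}) = emeasure (IT.CI {0..<n}) {r w}"
      using r_in[OF w] by (intro IT.lim) (simp_all add: PiM_M)
    also have "\<dots> = emeasure (?C n) (prod_emb {0..<n} M {0..<n} {r w})"
      using r_in[OF w] by (intro IT.emeasure_CI) (simp_all add: PiM_M)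
    also have "prod_emb {0..<n} M {0..<n} {r w} = {r w}"
      using r_in[OF w] by (intro prod_emb_id) (simp add: space_M)
    finally show ?thesis
      using C[OF w] pos[OF w] by (simp add: measure_def)
  qed
  with \<mu> show ?thesis by blast
qed

section \<open>A mixing criterion for ergodicity\<close>

text \<open>
  Let \<open>B\<close> be invariant with mass strictly between 0 and 1. Approximate its complement by \<open>A\<close> and \<open>B\<close>
  itself by \<open>A'\<close>, both unions of cylinders of length \<open>n\<close>. Since \<open>B\<close> is invariant, \<open>A\<close> and every shifted copy of \<open>A'\<close> are almost
  disjoint, whereas the hypothesis bounds the sum of the masses of the intersections of \<open>A\<close> with
  boundedly many shifted copies of \<open>A'\<close> below by a multiple of the product of the masses of \<open>A\<close> and
  \<open>A'\<close>. Boundedly many, because the inserted words have length less than \<open>l\<close>.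
\<close>
lemma (in invariant_measure) ergodic_if_quasi_mixing:
  assumes c: "0 < c"
    and mix: "\<And>n m u w. u \<in> words N n \<Longrightarrow> w \<in> words N m \<Longrightarrow> \<exists>j<l. \<exists>k\<in>words N j.
      c * (mass N \<mu> u * mass N \<mu> w) \<le> mass N \<mu> (u @ k @ w)"
  shows "ergodic \<mu>"
  unfolding ergodic_def
proof (intro ballI impI)
  fix B assume B: "B \<in> sets \<mu>" and "shift_map -` B \<inter> space \<mu> = B"
  then have inv1: "shift_map -` B \<inter> full_shift N = B" by (simp add: space_eq)
  have inv: "(shift_map ^^ m) -` B \<inter> full_shift N = B" for m
  proof (induction m)
    case 0
    then show ?case using sets.sets_into_space[OF B] by (auto simp: space_eq)
  next
    case (Suc m)
    have "(shift_map ^^ Suc m) -` B \<inter> full_shift N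
        = (shift_map ^^ m) -` (shift_map -` B \<inter> full_shift N) \<inter> full_shift N"
      using shift_in_full_shift[of _ N m] by auto
    then show ?case unfolding inv1 Suc .
  qed
  show "measure \<mu> B = 0 \<or> measure \<mu> B = 1"
  proof (rule ccontr)
    assume "\<not> (measure \<mu> B = 0 \<or> measure \<mu> B = 1)"
    define a where "a = measure \<mu> B"
    define b where "b = measure \<mu> (full_shift N - B)"
    \<comment> \<open>The intersections below have total mass at most \<open>2 * l * e\<close> but at least \<open>c * a * b / 4\<close>.\<close>
    have ab: "b = 1 - a" using prob_compl[OF B] by (simp add: a_def b_def space_eq)
    then have a: "0 < a" and b: "0 < b"
      using \<open>\<not> _\<close> prob_le_1[of B] measure_nonneg[of \<mu> B] by (auto simp: a_def less_le)
    define e where "e = min (min (a / 2) (b / 2)) (c * (a * b) / (16 * (real l + 1)))"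
    have "0 < e" using a b c by (simp add: e_def add_nonneg_pos)
    moreover have "e \<le> min (a / 2) (b / 2)" unfolding e_def by (rule min.cobounded1)
    ultimately have e: "0 < e" "e \<le> a / 2" "e \<le> b / 2" by (simp_all only: min.bounded_iff)
    have "e \<le> c * (a * b) / (16 * (real l + 1))" by (simp add: e_def)
    then have e4: "e * (16 * (real l + 1)) \<le> c * (a * b)"
      by (subst (asm) pos_le_divide_eq) auto
    have "full_shift N - B \<in> sets \<mu>" using sets.compl_sets[OF B] by (simp add: space_eq)
    then have "\<exists>A\<in>cyls N. \<forall>M\<in>{\<mu>}. measure M (sym_diff A (full_shift N - B)) < e"
      using e(1) finite_measure_axioms by (intro cylinder_approximation) (auto simp: sets_eq)
    moreover have "\<exists>A\<in>cyls N. \<forall>M\<in>{\<mu>}. measure M (sym_diff A B) < e"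
      using e(1) finite_measure_axioms B by (intro cylinder_approximation) (auto simp: sets_eq)
    ultimately obtain A A' where A: "A \<in> cyls N" "measure \<mu> (sym_diff A (full_shift N - B)) < e"
      and A': "A' \<in> cyls N" "measure \<mu> (sym_diff A' B) < e"
      by auto
    obtain n U U' where AU: "A = cyl N n U" and AU': "A' = cyl N n U'"
      using cyls_common_level[OF A(1) A'(1)] by blast
    have CB: "full_shift N - B \<in> sets \<mu>" by fact
    have AA': "A \<in> sets \<mu>" "A' \<in> sets \<mu>" by (simp_all add: AU AU')
    have S: "sym_diff A (full_shift N - B) \<in> sets \<mu>"
      by (rule sets.Un[OF sets.Diff[OF AA'(1) CB] sets.Diff[OF CB AA'(1)]])
    have S': "sym_diff A' B \<in> sets \<mu>"
      by (rule sets.Un[OF sets.Diff[OF AA'(2) B] sets.Diff[OF B AA'(2)]])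
    have TS': "(shift_map ^^ m) -` (sym_diff A' B) \<inter> full_shift N \<in> sets \<mu>" for m
      using measurable_sets[OF measurable_shift_funpow S'] unfolding space_eq .
    have "b \<le> measure \<mu> (A \<union> (sym_diff A (full_shift N - B)))"
      unfolding b_def by (intro finite_measure_mono sets.Un[OF AA'(1) S]) blast
    also have "\<dots> \<le> measure \<mu> A + measure \<mu> (sym_diff A (full_shift N - B))"
      by (rule measure_Un_le[OF AA'(1) S])
    finally have bA: "b / 2 \<le> measure \<mu> A" using A(2) e(3) by linarith
    have "a \<le> measure \<mu> (A' \<union> (sym_diff A' B))"
      unfolding a_def by (intro finite_measure_mono sets.Un[OF AA'(2) S']) blast
    also have "\<dots> \<le> measure \<mu> A' + measure \<mu> (sym_diff A' B)"
      by (rule measure_Un_le[OF AA'(2) S'])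
    finally have aA: "a / 2 \<le> measure \<mu> A'" using A'(2) e(2) by linarith
    define I where "I = (U \<inter> words N n) \<times> (U' \<inter> words N n)"
    have [simp]: "finite I" by (simp add: I_def)
    define D where "D j = (\<lambda>(u, w). cyl N n {u} \<inter> ((shift_map ^^ (n + j)) -` cyl N n {w} \<inter> full_shift N))" for j
    have D_sets: "D j q \<in> sets \<mu>" for j q
      by (auto simp: D_def shift_vimage_cyl split: prod.split)
    have disj: "disjoint_family_on (D j) I" for j
      by (auto simp: disjoint_family_on_def D_def I_def cyl_def)
    have D_le: "(\<Sum>q\<in>I. measure \<mu> (D j q)) \<le> 2 * e" for j
    proof -
      have "(\<Sum>q\<in>I. measure \<mu> (D j q)) = measure \<mu> (\<Union>q\<in>I. D j q)"
        using D_sets disj by (intro finite_measure_finite_Union[symmetric]) auto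
      also have "\<dots> \<le> measure \<mu> ((sym_diff A (full_shift N - B))
          \<union> ((shift_map ^^ (n + j)) -` (sym_diff A' B) \<inter> full_shift N))"
      proof (rule finite_measure_mono)
        show "(\<Union>q\<in>I. D j q) \<subseteq> (sym_diff A (full_shift N - B))
          \<union> ((shift_map ^^ (n + j)) -` (sym_diff A' B) \<inter> full_shift N)"
        proof
          fix x assume "x \<in> (\<Union>q\<in>I. D j q)"
          then have x: "x \<in> full_shift N" "x \<in> A" "(shift_map ^^ (n + j)) x \<in> A'"
            by (auto simp: D_def I_def cyl_def AU AU')
          have "x \<in> B \<longleftrightarrow> (shift_map ^^ (n + j)) x \<in> B"
            using inv[of "n + j"] x(1) by blast
          then show "x \<in> (sym_diff A (full_shift N - B))
            \<union> ((shift_map ^^ (n + j)) -` (sym_diff A' B) \<inter> full_shift N)"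
            using x by blast
        qed
      qed (rule sets.Un[OF S TS'])
      also have "\<dots> \<le> measure \<mu> (sym_diff A (full_shift N - B))
          + measure \<mu> ((shift_map ^^ (n + j)) -` (sym_diff A' B) \<inter> full_shift N)"
        by (rule measure_Un_le[OF S TS'])
      also have "measure \<mu> ((shift_map ^^ (n + j)) -` (sym_diff A' B) \<inter> full_shift N)
          = measure \<mu> (sym_diff A' B)"
        by (rule measure_shift_vimage[OF S'])
      finally show ?thesis using A(2) A'(2) by linarith
    qed
    have pair: "c * (mass N \<mu> u * mass N \<mu> w) \<le> (\<Sum>j<l. measure \<mu> (D j (u, w)))"
      if uw: "(u, w) \<in> I" for u w
    proof -
      have words: "u \<in> words N n" "w \<in> words N n" using uw by (auto simp: I_def)
      then obtain j k where jk: "j < l" "k \<in> words N j"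
        "c * (mass N \<mu> u * mass N \<mu> w) \<le> mass N \<mu> (u @ k @ w)"
        using mix by blast
      have len: "length u = n" "length w = n" "length k = j" using words jk(2) by (auto dest: length_words)
      have "cylinder N (u @ k @ w) \<subseteq> D j (u, w)"
      proof
        fix x assume "x \<in> cylinder N (u @ k @ w)"
        then have x: "x \<in> full_shift N" "\<And>i. i < n + j + n \<Longrightarrow> x i = (u @ k @ w) ! i"
          using len by (auto simp: cylinder_def)
        have "map x [0..<n] = u"
          using x(2) len by (auto simp: list_eq_iff_nth_eq nth_append)
        moreover have "map ((shift_map ^^ (n + j)) x) [0..<n] = w"
          using x(2) len by (auto simp: list_eq_iff_nth_eq nth_append shift_funpow)
        ultimately show "x \<in> D j (u, w)"
          using x(1) shift_in_full_shift[of x N "n + j"] by (simp add: D_def cyl_def)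
      qed
      then have "mass N \<mu> (u @ k @ w) \<le> measure \<mu> (D j (u, w))"
        using D_sets by (intro finite_measure_mono) auto
      also have "\<dots> \<le> (\<Sum>j<l. measure \<mu> (D j (u, w)))"
        using jk(1) by (intro member_le_sum) auto
      finally show ?thesis using jk(3) by linarith
    qed
    have "c * (a * b) / 4 = c * ((b / 2) * (a / 2))" by simp
    also have "\<dots> \<le> c * (measure \<mu> A * measure \<mu> A')"
      using bA aA c a b by (intro mult_left_mono mult_mono) auto
    also have "\<dots> = (\<Sum>(u, w)\<in>I. c * (mass N \<mu> u * mass N \<mu> w))"
      unfolding I_def AU AU' measure_cyl sum_product
      unfolding sum_distrib_left sum.cartesian_product by (simp add: split_def)
    also have "\<dots> \<le> (\<Sum>q\<in>I. \<Sum>j<l. measure \<mu> (D j q))"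
      using pair by (intro sum_mono) auto
    also have "\<dots> = (\<Sum>j<l. \<Sum>q\<in>I. measure \<mu> (D j q))" by (rule sum.swap)
    also have "\<dots> \<le> (\<Sum>j<l. 2 * e)" by (intro sum_mono D_le)
    finally have "c * (a * b) \<le> 8 * (real l * e)" by simp
    moreover have "e * (16 * (real l + 1)) = 16 * (real l * e) + 16 * e" by (simp add: algebra_simps)
    moreover have "0 \<le> real l * e" using e(1) by simp
    ultimately show False using e(1) e4 by linarith
  qed
qed

section \<open>Perron--Frobenius eigenvectors\<close>

lemma compact_simplex:
  fixes V :: "'v set"
  assumes "finite V"
  shows "compact {x :: 'v \<Rightarrow> real. (\<forall>i\<in>V. 0 \<le> x i) \<and> (\<forall>i. i \<notin> V \<longrightarrow> x i = 0) \<and> (\<Sum>i\<in>V. x i) = 1}"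
    (is "compact ?K")
proof -
  define B :: "'v \<Rightarrow> real set" where "B i = (if i \<in> V then {0..1} else {0})" for i
  have "compactin (product_topology (\<lambda>_. euclidean) UNIV) (PiE UNIV B)"
    unfolding compactin_PiE by (auto simp: B_def)
  then have "compact (PiE UNIV B)"
    by (simp add: euclidean_product_topology)
  moreover have "closed ?K"
  proof -
    have "?K = (\<Inter>i\<in>V. {x. 0 \<le> x i}) \<inter> (\<Inter>i\<in>-V. {x. x i = 0}) \<inter> {x. (\<Sum>i\<in>V. x i) = 1}"
      by auto
    also have "closed \<dots>"
      by (intro closed_Int closed_INT ballI closed_Collect_le closed_Collect_eq continuous_intros
          continuous_on_product_coordinates)
    finally show ?thesis .
  qed
  moreover have "?K \<subseteq> PiE UNIV B"
  proof
    fix x assume x: "x \<in> ?K"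
    have "x i \<le> 1" if "i \<in> V" for i
      using x assms that member_le_sum[of i V x] by auto
    then show "x \<in> PiE UNIV B" using x by (auto simp: B_def)
  qed
  ultimately show ?thesis
    using compact_Int_closed[of "PiE UNIV B" ?K] by (simp only: Int_absorb1)
qed

locale irreducible_matrix =
  fixes V :: "'v set" and M :: "'v \<Rightarrow> 'v \<Rightarrow> real"
  assumes finite_V: "finite V" and V_nonempty: "V \<noteq> {}"
    and M_nonneg: "i \<in> V \<Longrightarrow> j \<in> V \<Longrightarrow> 0 \<le> M i j"
    and irreducible: "i \<in> V \<Longrightarrow> j \<in> V \<Longrightarrow> (i, j) \<in> {(i, j). i \<in> V \<and> j \<in> V \<and> 0 < M i j}\<^sup>*"
begin

definition T :: "('v \<Rightarrow> real) \<Rightarrow> 'v \<Rightarrow> real" where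
  "T x i = (if i \<in> V then \<Sum>j\<in>V. M i j * x j else 0)"

text \<open>
  On nonnegative vectors the powers of \<open>I + T\<close> increase with the exponent, so positive coordinates stay
  positive; powers of \<open>T\<close> alone may move them around periodically.
\<close>
definition L :: "('v \<Rightarrow> real) \<Rightarrow> 'v \<Rightarrow> real" where
  "L x i = x i + T x i"

lemma T_nonneg: "(\<And>i. 0 \<le> x i) \<Longrightarrow> 0 \<le> T x i"
  by (auto simp: T_def intro!: sum_nonneg mult_nonneg_nonneg M_nonneg)

lemma L_Suc: "(L ^^ Suc p) x i = (L ^^ p) x i + T ((L ^^ p) x) i"
  unfolding funpow.simps o_apply by (rule L_def)

lemma L_nonneg:
  assumes "\<And>i. 0 \<le> x i"
  shows "0 \<le> (L ^^ p) x i"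
proof (induction p arbitrary: i)
  case (Suc p)
  then show ?case unfolding L_Suc by (intro add_nonneg_nonneg T_nonneg)
qed (simp add: assms)

lemma L_mono:
  assumes "\<And>i. 0 \<le> x i" and "p \<le> q"
  shows "(L ^^ p) x i \<le> (L ^^ q) x i"
  using assms(2)
proof (induction rule: dec_induct)
  case (step q)
  have "0 \<le> T ((L ^^ q) x) i" by (intro T_nonneg L_nonneg assms(1))
  then show ?case using step.IH unfolding L_Suc by linarith
qed simp

lemma L_eventually_positive:
  assumes x: "\<And>i. 0 \<le> x i" and j: "j \<in> V" "0 < x j"
  shows "\<exists>p. \<forall>i\<in>V. 0 < (L ^^ p) x i"
proof -
  have "\<exists>p. 0 < (L ^^ p) x i" if "i \<in> V" for i
    using irreducible[OF that j(1)]
  proof (induction rule: converse_rtrancl_induct)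
    case base
    then show ?case using j by (intro exI[of _ 0]) simp
  next
    case (step i k)
    then obtain p where p: "0 < (L ^^ p) x k" and ik: "i \<in> V" "k \<in> V" "0 < M i k" by auto
    have "0 < M i k * (L ^^ p) x k" using p ik by simp
    also have "\<dots> \<le> (\<Sum>j\<in>V. M i j * (L ^^ p) x j)"
      using ik L_nonneg[OF x] M_nonneg finite_V by (intro member_le_sum) auto
    also have "\<dots> = T ((L ^^ p) x) i" using ik by (simp add: T_def)
    also have "\<dots> \<le> (L ^^ Suc p) x i"
      unfolding L_Suc using L_nonneg[of x, OF x, where p = p] by simp
    finally show ?case by blast
  qed
  then obtain p where p: "\<And>i. i \<in> V \<Longrightarrow> 0 < (L ^^ p i) x i" by metis
  have "0 < (L ^^ Max (p ` V)) x i" if "i \<in> V" for i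
  proof -
    have "p i \<le> Max (p ` V)" using that finite_V by simp
    then have "(L ^^ p i) x i \<le> (L ^^ Max (p ` V)) x i" by (rule L_mono[OF x])
    then show ?thesis using p[OF that] by simp
  qed
  then show ?thesis by blast
qed

text \<open>
  A defect \<open>T x - r x\<close> is transported by the powers of \<open>L\<close>, because \<open>L\<close> is linear and commutes with
  \<open>T\<close>. So a nonzero nonnegative defect can be made strictly positive everywhere.
\<close>
lemma L_commute:
  "(L ^^ p) (\<lambda>i. T x i - r * x i) = (\<lambda>i. T ((L ^^ p) x) i - r * (L ^^ p) x i)"
proof (induction p)
  case (Suc p)
  have "L (\<lambda>i. T y i - r * y i) = (\<lambda>i. T (L y) i - r * L y i)" for y
    by (auto simp: L_def T_def fun_eq_iff algebra_simps sum.distrib sum_distrib_left sum_subtractf)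
  then show ?case using Suc by simp
qed simp

text \<open>
  The Collatz-Wielandt argument: choose \<open>\<rho>\<close> maximal such that \<open>\<rho> x \<le> T x\<close> for some \<open>x\<close> in the simplex.
  If \<open>T x - \<rho> x\<close> did not vanish, a power of \<open>L\<close> would make it strictly positive in every coordinate,
  and \<open>\<rho>\<close> could be increased.
\<close>
lemma positive_eigenvector:
  "\<exists>\<rho> x. 0 \<le> \<rho> \<and> (\<forall>i\<in>V. 0 < x i \<and> (\<Sum>j\<in>V. M i j * x j) = \<rho> * x i)"
proof -
  define K where "K = {x :: 'v \<Rightarrow> real. (\<forall>i\<in>V. 0 \<le> x i) \<and> (\<forall>i. i \<notin> V \<longrightarrow> x i = 0) \<and> (\<Sum>i\<in>V. x i) = 1}"
  define b where "b = (\<Sum>i\<in>V. \<Sum>j\<in>V. M i j)"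
  define Q where "Q = {(t, x). t \<in> {0..b} \<and> x \<in> K \<and> (\<forall>i\<in>V. t * x i \<le> (\<Sum>j\<in>V. M i j * x j))}"
  have K_nonneg: "0 \<le> x i" if "x \<in> K" for x i using that by (cases "i \<in> V") (auto simp: K_def)
  have bound: "t \<le> b" if "x \<in> K" "\<forall>i\<in>V. t * x i \<le> (\<Sum>j\<in>V. M i j * x j)" for t x
  proof -
    have x1: "x j \<le> 1" if "j \<in> V" for j
      using \<open>x \<in> K\<close> member_le_sum[of j V x] that finite_V by (auto simp: K_def)
    have "t = (\<Sum>i\<in>V. t * x i)" using \<open>x \<in> K\<close> by (simp add: K_def sum_distrib_left[symmetric])
    also have "\<dots> \<le> (\<Sum>i\<in>V. \<Sum>j\<in>V. M i j * x j)" using that by (intro sum_mono) auto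
    also have "\<dots> \<le> (\<Sum>i\<in>V. \<Sum>j\<in>V. M i j * 1)"
      using x1 M_nonneg by (intro sum_mono mult_left_mono) auto
    finally show ?thesis by (simp add: b_def)
  qed
  have "compact ({0..b} \<times> K)"
    unfolding K_def by (intro compact_Times compact_Icc compact_simplex finite_V)
  moreover have "closed {p :: real \<times> ('v \<Rightarrow> real). \<forall>i\<in>V. fst p * snd p i \<le> (\<Sum>j\<in>V. M i j * snd p j)}"
  proof -
    have *: "continuous_on UNIV (\<lambda>p :: real \<times> ('v \<Rightarrow> real). snd p i)" for i
      by (rule continuous_on_compose2[OF continuous_on_product_coordinates continuous_on_snd]) (auto intro: continuous_intros)
    have "{p :: real \<times> ('v \<Rightarrow> real). \<forall>i\<in>V. fst p * snd p i \<le> (\<Sum>j\<in>V. M i j * snd p j)}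
        = (\<Inter>i\<in>V. {p. fst p * snd p i \<le> (\<Sum>j\<in>V. M i j * snd p j)})" by auto
    also have "closed \<dots>"
      by (intro closed_INT ballI closed_Collect_le continuous_intros *)
    finally show ?thesis .
  qed
  ultimately have "compact (({0..b} \<times> K) \<inter> {p. \<forall>i\<in>V. fst p * snd p i \<le> (\<Sum>j\<in>V. M i j * snd p j)})"
    by (rule compact_Int_closed)
  also have "({0..b} \<times> K) \<inter> {p. \<forall>i\<in>V. fst p * snd p i \<le> (\<Sum>j\<in>V. M i j * snd p j)} = Q"
    by (auto simp: Q_def)
  finally have "compact Q" .
  moreover have "Q \<noteq> {}"
  proof -
    obtain i where i: "i \<in> V" using V_nonempty by blast
    have "(0, indicator {i}) \<in> Q"
      using i finite_V M_nonneg
      by (auto simp: Q_def K_def b_def indicator_def intro!: sum_nonneg)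
    then show ?thesis by blast
  qed
  ultimately obtain p where "p \<in> Q" and max: "\<forall>q\<in>Q. fst q \<le> fst p"
    using continuous_attains_sup[of Q fst] continuous_on_fst[OF continuous_on_id] by metis
  then obtain \<rho> x where \<rho>x: "(\<rho>, x) \<in> Q" and max: "\<And>t y. (t, y) \<in> Q \<Longrightarrow> t \<le> \<rho>"
    by (cases p) fastforce
  have xK: "x \<in> K" and \<rho>0: "0 \<le> \<rho>" using \<rho>x by (auto simp: Q_def)
  have x0: "0 \<le> x i" for i using K_nonneg[OF xK] .
  obtain j where j: "j \<in> V" "0 < x j"
  proof -
    have "\<exists>j\<in>V. x j \<noteq> 0"
    proof (rule ccontr)
      assume "\<not> (\<exists>j\<in>V. x j \<noteq> 0)"
      then have "(\<Sum>j\<in>V. x j) = 0" by simp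
      then show False using xK by (simp add: K_def)
    qed
    then show ?thesis using x0 that by (metis less_eq_real_def)
  qed
  define z where "z = (\<lambda>i. T x i - \<rho> * x i)"
  have z0: "0 \<le> z i" for i
    using \<rho>x xK by (auto simp: z_def T_def Q_def K_def)
  have z: "z i = 0" if "i \<in> V" for i
  proof (rule ccontr)
    assume "z i \<noteq> 0"
    then have "0 < z i" using z0[of i] by simp
    then obtain p where p: "\<forall>i\<in>V. 0 < (L ^^ p) z i"
      using L_eventually_positive[of z i] z0 \<open>i \<in> V\<close> by blast
    define y where "y = (L ^^ p) x"
    have y0: "0 \<le> y i" for i unfolding y_def by (rule L_nonneg) (rule x0)
    have yV: "y i = 0" if "i \<notin> V" for i
    proof -
      have "(L ^^ p) x i = 0" for p
        using that xK by (induction p) (auto simp: L_Suc T_def K_def simp del: funpow.simps)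
      then show ?thesis by (simp add: y_def)
    qed
    have "(L ^^ 0) x j \<le> y j" unfolding y_def by (rule L_mono) (auto intro: x0)
    then have yj: "0 < y j" using j by simp
    have Ty: "T y i - \<rho> * y i > 0" if "i \<in> V" for i
      using p that L_commute[of p x \<rho>] by (simp add: z_def y_def)
    define c where "c = (\<Sum>i\<in>V. y i)"
    have c: "0 < c" using yj j y0 finite_V unfolding c_def by (intro sum_pos2[of _ j]) auto
    have yc: "y i \<le> c" if "i \<in> V" for i
      using that y0 finite_V unfolding c_def by (intro member_le_sum) auto
    \<comment> \<open>The normalised vector \<open>y / c\<close> admits the larger value \<open>\<rho> + e / c\<close>, since every \<open>y i\<close> is at most \<open>c\<close>.\<close>
    define e where "e = Min ((\<lambda>i. T y i - \<rho> * y i) ` V)"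
    have e: "0 < e" "\<And>i. i \<in> V \<Longrightarrow> e \<le> T y i - \<rho> * y i"
      using Ty finite_V V_nonempty by (auto simp: e_def)
    have ineq: "(\<rho> + e / c) * (y i / c) \<le> (\<Sum>j\<in>V. M i j * (y j / c))" if "i \<in> V" for i
    proof -
      have "e / c * y i \<le> e" using yc[OF that] e c y0[of i] by (simp add: field_simps mult_left_mono)
      then have "(\<rho> + e / c) * y i \<le> T y i" using e(2)[OF that] by (simp add: algebra_simps)
      then have "(\<rho> + e / c) * y i / c \<le> (\<Sum>j\<in>V. M i j * y j) / c"
        using c that by (simp add: T_def divide_right_mono)
      then show ?thesis by (simp add: sum_divide_distrib)
    qed
    have yK: "(\<lambda>i. y i / c) \<in> K"
      using y0 yV c by (auto simp: K_def sum_divide_distrib[symmetric] c_def[symmetric])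
    have "(\<rho> + e / c, \<lambda>i. y i / c) \<in> Q"
      using bound[OF yK] ineq yK \<rho>0 e c unfolding Q_def by auto
    then have "\<rho> + e / c \<le> \<rho>" by (rule max)
    moreover have "0 < e / c" using e(1) c by simp
    ultimately show False by linarith
  qed
  have ev: "(\<Sum>j\<in>V. M i j * x j) = \<rho> * x i" if "i \<in> V" for i
    using z[OF that] that by (simp add: z_def T_def)
  have "0 < x i" if "i \<in> V" for i
  proof -
    obtain p where p: "\<forall>i\<in>V. 0 < (L ^^ p) x i" using L_eventually_positive[of x j] x0 j by blast
    have "\<forall>i\<in>V. (L ^^ p) x i = (1 + \<rho>) ^ p * x i" for p
    proof (induction p)
      case (Suc p)
      have "T ((L ^^ p) x) i = (1 + \<rho>) ^ p * (\<rho> * x i)" if "i \<in> V" for i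
      proof -
        have "T ((L ^^ p) x) i = (\<Sum>j\<in>V. M i j * ((1 + \<rho>) ^ p * x j))"
          using Suc that by (simp add: T_def)
        also have "\<dots> = (1 + \<rho>) ^ p * (\<Sum>j\<in>V. M i j * x j)"
          by (simp add: sum_distrib_left mult.left_commute)
        finally show ?thesis using ev[OF that] by simp
      qed
      then show ?case using Suc by (simp add: L_Suc algebra_simps del: funpow.simps)
    qed simp
    then show ?thesis using p that \<rho>0 by (force simp: zero_less_mult_iff)
  qed
  then show ?thesis using ev \<rho>0 by blast
qed

end

text \<open>
  The matrix and its transpose have positive eigenvectors \<open>x\<close> and \<open>y\<close>; evaluating the bilinear form
  \<open>y M x\<close> in both ways shows that the eigenvalues agree.
\<close>
lemma (in irreducible_matrix) perron_frobenius:
  assumes "\<And>i. i \<in> V \<Longrightarrow> \<exists>j\<in>V. 0 < M i j"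
  obtains \<rho> x y where "0 < \<rho>" "\<And>i. i \<in> V \<Longrightarrow> 0 < x i" "\<And>i. i \<in> V \<Longrightarrow> 0 < y i"
    "\<And>i. i \<in> V \<Longrightarrow> (\<Sum>j\<in>V. M i j * x j) = \<rho> * x i"
    "\<And>j. j \<in> V \<Longrightarrow> (\<Sum>i\<in>V. M i j * y i) = \<rho> * y j"
proof -
  interpret tr: irreducible_matrix V "\<lambda>i j. M j i"
  proof
    fix i j assume "i \<in> V" "j \<in> V"
    then have "(i, j) \<in> ({(i, j). i \<in> V \<and> j \<in> V \<and> 0 < M i j}\<inverse>)\<^sup>*"
      using irreducible by (simp add: rtrancl_converse)
    also have "{(i, j). i \<in> V \<and> j \<in> V \<and> 0 < M i j}\<inverse> = {(i, j). i \<in> V \<and> j \<in> V \<and> 0 < M j i}" by auto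
    finally show "(i, j) \<in> {(i, j). i \<in> V \<and> j \<in> V \<and> 0 < M j i}\<^sup>*" .
  qed (use finite_V V_nonempty M_nonneg in auto)
  obtain \<rho> x where x: "0 \<le> \<rho>" "\<And>i. i \<in> V \<Longrightarrow> 0 < x i" "\<And>i. i \<in> V \<Longrightarrow> (\<Sum>j\<in>V. M i j * x j) = \<rho> * x i"
    using positive_eigenvector by blast
  obtain \<rho>' y where y: "0 \<le> \<rho>'" "\<And>i. i \<in> V \<Longrightarrow> 0 < y i" "\<And>j. j \<in> V \<Longrightarrow> (\<Sum>i\<in>V. M i j * y i) = \<rho>' * y j"
    using tr.positive_eigenvector by blast
  have "\<rho> * (\<Sum>i\<in>V. y i * x i) = (\<Sum>i\<in>V. y i * (\<Sum>j\<in>V. M i j * x j))"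
    using x(3) by (simp add: sum_distrib_left mult.left_commute)
  also have "\<dots> = (\<Sum>j\<in>V. \<Sum>i\<in>V. y i * (M i j * x j))"
    unfolding sum_distrib_left by (rule sum.swap)
  also have "\<dots> = (\<Sum>j\<in>V. x j * (\<Sum>i\<in>V. M i j * y i))"
    by (simp add: sum_distrib_left mult_ac)
  also have "\<dots> = \<rho>' * (\<Sum>i\<in>V. y i * x i)"
    using y(3) by (simp add: sum_distrib_left mult_ac)
  finally have "\<rho> * (\<Sum>i\<in>V. y i * x i) = \<rho>' * (\<Sum>i\<in>V. y i * x i)" .
  moreover have "0 < (\<Sum>i\<in>V. y i * x i)"
    using x(2) y(2) finite_V V_nonempty by (intro sum_pos) auto
  ultimately have eq: "\<rho>' = \<rho>" by simp
  obtain i where i: "i \<in> V" using V_nonempty by blast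
  then obtain j where j: "j \<in> V" "0 < M i j" using assms by blast
  have "0 < M i j * x j" using j x(2) by simp
  also have "\<dots> \<le> (\<Sum>j\<in>V. M i j * x j)"
    using i j(1) M_nonneg finite_V by (intro member_le_sum mult_nonneg_nonneg less_imp_le[OF x(2)]) auto
  finally have "0 < \<rho>" using x(1,2,3) i by (simp add: zero_less_mult_iff)
  then show ?thesis using that x(2,3) y(2,3) eq by blast
qed

section \<open>Weighted actions of words on a finite set\<close>

text \<open>
  As for products of matrices acting on vectors, the last letter of the word acts first.
\<close>
definition act :: "(nat \<Rightarrow> 'v \<Rightarrow> 'v) \<Rightarrow> nat list \<Rightarrow> 'v \<Rightarrow> 'v" where
  "act p w v = foldr p w v"

fun cocycle :: "(nat \<Rightarrow> 'v \<Rightarrow> 'v) \<Rightarrow> (nat \<Rightarrow> 'v \<Rightarrow> real) \<Rightarrow> nat list \<Rightarrow> 'v \<Rightarrow> real" where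
  "cocycle p W [] v = 1"
| "cocycle p W (a # w) v = W a (act p w v) * cocycle p W w v"

lemma act_simps [simp]: "act p [] v = v" "act p (a # w) v = p a (act p w v)"
  by (simp_all add: act_def)

lemma act_append: "act p (u @ w) v = act p u (act p w v)"
  by (simp add: act_def)

lemma cocycle_append: "cocycle p W (u @ w) v = cocycle p W u (act p w v) * cocycle p W w v"
  by (induction u) (simp_all add: act_append)

lemma words_induct [consumes 1, case_names Nil Cons]:
  assumes "w \<in> words N n" and "P []"
    and "\<And>a w n. a \<in> {1..N} \<Longrightarrow> w \<in> words N n \<Longrightarrow> P w \<Longrightarrow> P (a # w)"
  shows "P w"
  using assms(1)
proof (induction w arbitrary: n)
  case (Cons a w)
  then have "a \<in> {1..N}" "w \<in> words N (length w)" by (simp_all add: words_def)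
  then show ?case using Cons.IH assms(3) by blast
qed (rule assms(2))

locale letter_system =
  fixes N :: nat and V :: "'v set" and p :: "nat \<Rightarrow> 'v \<Rightarrow> 'v" and W :: "nat \<Rightarrow> 'v \<Rightarrow> real"
  assumes letters: "1 \<le> N" and finite_V: "finite V" and V_nonempty: "V \<noteq> {}"
    and bij: "a \<in> {1..N} \<Longrightarrow> bij_betw (p a) V V"
    and W_pos: "a \<in> {1..N} \<Longrightarrow> v \<in> V \<Longrightarrow> 0 < W a v"
begin

lemma p_in: "a \<in> {1..N} \<Longrightarrow> v \<in> V \<Longrightarrow> p a v \<in> V"
  using bij bij_betwE by blast

lemma act_in: "w \<in> words N n \<Longrightarrow> v \<in> V \<Longrightarrow> act p w v \<in> V"
  by (induction w rule: words_induct) (use p_in in \<open>simp_all del: atLeastAtMost_iff\<close>)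

lemma inj_act: "w \<in> words N n \<Longrightarrow> inj_on (act p w) V"
proof (induction w rule: words_induct)
  case (Cons a w n)
  have p: "inj_on (p a) V" using bij[OF Cons(1)] by (rule bij_betw_imp_inj_on)
  show ?case
  proof (rule inj_onI)
    fix u v assume uv: "u \<in> V" "v \<in> V" "act p (a # w) u = act p (a # w) v"
    then have "act p w u = act p w v"
      using inj_onD[OF p, of "act p w u" "act p w v"] act_in[OF Cons(2)] by simp
    then show "u = v" using inj_onD[OF Cons.IH] uv by blast
  qed
qed (simp add: inj_on_def)

lemma cocycle_pos: "w \<in> words N n \<Longrightarrow> v \<in> V \<Longrightarrow> 0 < cocycle p W w v"
proof (induction w rule: words_induct)
  case (Cons a w n)
  then show ?case using W_pos[OF Cons(1) act_in[OF Cons(2)]] by simp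
qed simp

definition orbit :: "'v \<Rightarrow> 'v set" where
  "orbit v = {act p w v | w n. w \<in> words N n}"

lemma self_in_orbit: "v \<in> orbit v"
  unfolding orbit_def by (rule CollectI, intro exI[of _ "[]"] exI[of _ 0]) simp

lemma orbit_subset: "v \<in> V \<Longrightarrow> orbit v \<subseteq> V"
  using act_in by (auto simp: orbit_def)

lemma act_orbit:
  assumes "u \<in> orbit v" and w: "w \<in> words N n"
  shows "act p w u \<in> orbit v"
proof -
  obtain w' m where "u = act p w' v" "w' \<in> words N m" using assms(1) by (auto simp: orbit_def)
  then have "act p w u = act p (w @ w') v" "w @ w' \<in> words N (n + m)"
    using append_words[OF w] by (simp_all add: act_append)
  then show ?thesis unfolding orbit_def by blast
qed

text \<open>
  Orbits are defined with words only, without inverses. A word that leads from \<open>v\<close> to \<open>u\<close> maps the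
  finite set \<open>orbit u\<close> injectively into itself, hence onto itself; so \<open>u\<close> has a preimage in \<open>orbit u\<close>,
  which is \<open>v\<close> by injectivity.
\<close>
lemma orbit_sym:
  assumes v: "v \<in> V" and u: "u \<in> orbit v"
  shows "v \<in> orbit u"
proof -
  obtain w n where w: "w \<in> words N n" "u = act p w v" using u by (auto simp: orbit_def)
  have uV: "u \<in> V" using u v orbit_subset by blast
  have "act p w ` orbit u \<subseteq> orbit u" using act_orbit w(1) by blast
  moreover have "inj_on (act p w) (orbit u)"
    using inj_act[OF w(1)] orbit_subset[OF uV] by (rule inj_on_subset)
  moreover have "finite (orbit u)" using orbit_subset[OF uV] finite_V by (rule finite_subset)
  ultimately have "act p w ` orbit u = orbit u" by (simp add: endo_inj_surj)
  then have "u \<in> act p w ` orbit u" using self_in_orbit[of u] by simp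
  then obtain v' where v': "u = act p w v'" "v' \<in> orbit u" by (rule imageE)
  have "v' = v"
    using inj_onD[OF inj_act[OF w(1)], of v' v] v'(1) w(2) v subsetD[OF orbit_subset[OF uV] v'(2)] by simp
  then show ?thesis using v'(2) by simp
qed

end

locale transitive_letter_system = letter_system +
  assumes transitive: "u \<in> V \<Longrightarrow> v \<in> V \<Longrightarrow> \<exists>n. \<exists>w\<in>words N n. act p w u = v"

lemma (in letter_system) transitive_orbit:
  assumes v: "v \<in> V"
  shows "transitive_letter_system N (orbit v) p W"
proof
  show "1 \<le> N" by (rule letters)
  show fin: "finite (orbit v)" using orbit_subset[OF v] finite_V by (rule finite_subset)
  show "orbit v \<noteq> {}" using self_in_orbit by blast
  show "bij_betw (p a) (orbit v) (orbit v)" if a: "a \<in> {1..N}" for a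
  proof -
    have "[a] \<in> words N 1" using a by (simp add: words_def)
    then have "p a ` orbit v \<subseteq> orbit v" using act_orbit[of _ v "[a]"] by auto
    moreover have "inj_on (p a) (orbit v)"
      using bij_betw_imp_inj_on[OF bij[OF a]] orbit_subset[OF v] by (rule inj_on_subset)
    ultimately show ?thesis using endo_inj_surj[OF fin] by (simp add: bij_betw_def)
  qed
  show "0 < W a u" if "a \<in> {1..N}" "u \<in> orbit v" for a u
    using that W_pos orbit_subset[OF v] by blast
  show "\<exists>n. \<exists>w\<in>words N n. act p w x = y" if x: "x \<in> orbit v" and y: "y \<in> orbit v" for x y
  proof -
    have "v \<in> orbit x" using orbit_sym[OF v x] .
    moreover obtain w n where "w \<in> words N n" "y = act p w v" using y by (auto simp: orbit_def)
    ultimately have "y \<in> orbit x" using act_orbit by blast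
    then show ?thesis by (auto simp: orbit_def)
  qed
qed

context transitive_letter_system
begin

text \<open>
  The matrix whose entry at \<open>(i, j)\<close> is the total weight of the letters that take \<open>i\<close> to \<open>j\<close> is
  irreducible. The eigenvector equation for \<open>y\<close> is stated in weak form, tested against a function \<open>f\<close>,
  because this is how a sum over the first letter applied to \<open>v\<close> is evaluated.
\<close>
lemma eigenfunctions:
  obtains \<rho> x y where "0 < \<rho>" "\<And>v. v \<in> V \<Longrightarrow> 0 < x v" "\<And>v. v \<in> V \<Longrightarrow> 0 < y v"
    "\<And>v. v \<in> V \<Longrightarrow> (\<Sum>a\<in>{1..N}. W a v * x (p a v)) = \<rho> * x v"
    "\<And>f. (\<Sum>v\<in>V. \<Sum>a\<in>{1..N}. f (p a v) * W a v * y v) = \<rho> * (\<Sum>v\<in>V. f v * y v)"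
    "(\<Sum>v\<in>V. x v * y v) = 1"
proof -
  define M where "M i j = (\<Sum>a\<in>{1..N}. of_bool (p a i = j) * W a i)" for i j
  have M_p: "0 < M i (p a i)" if "a \<in> {1..N}" "i \<in> V" for a i
  proof -
    have "0 < of_bool (p a i = p a i) * W a i" using W_pos that by simp
    also have "\<dots> \<le> M i (p a i)"
      unfolding M_def using that W_pos by (intro member_le_sum) (auto intro: less_imp_le)
    finally show ?thesis .
  qed
  interpret irreducible_matrix V M
  proof
    show "0 \<le> M i j" if "i \<in> V" "j \<in> V" for i j
      unfolding M_def using W_pos that by (intro sum_nonneg mult_nonneg_nonneg) (auto intro: less_imp_le)
    show "(i, j) \<in> {(i, j). i \<in> V \<and> j \<in> V \<and> 0 < M i j}\<^sup>*" if i: "i \<in> V" and j: "j \<in> V" for i j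
    proof -
      have "(i, act p w i) \<in> {(i, j). i \<in> V \<and> j \<in> V \<and> 0 < M i j}\<^sup>*" if "w \<in> words N n" for w n
        using that
      proof (induction w rule: words_induct)
        case (Cons a w n)
        have *: "act p w i \<in> V" using act_in[OF Cons(2) i] .
        have "(act p w i, act p (a # w) i) \<in> {(i, j). i \<in> V \<and> j \<in> V \<and> 0 < M i j}"
          using M_p[OF Cons(1) *] p_in[OF Cons(1) *] * by simp
        with Cons.IH show ?case by (rule rtrancl_into_rtrancl)
      qed simp
      then show ?thesis using transitive[OF i j] by blast
    qed
  qed (rule finite_V V_nonempty)+
  have "\<exists>j\<in>V. 0 < M i j" if "i \<in> V" for i
    using M_p[of 1 i] p_in[of 1 i] letters that by auto
  then obtain \<rho> x y where \<rho>: "0 < \<rho>" and x: "\<And>i. i \<in> V \<Longrightarrow> 0 < x i" and y: "\<And>i. i \<in> V \<Longrightarrow> 0 < y i"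
    and ex: "\<And>i. i \<in> V \<Longrightarrow> (\<Sum>j\<in>V. M i j * x j) = \<rho> * x i"
    and ey: "\<And>j. j \<in> V \<Longrightarrow> (\<Sum>i\<in>V. M i j * y i) = \<rho> * y j"
    using perron_frobenius by blast
  have M_sum: "(\<Sum>j\<in>V. M i j * f j) = (\<Sum>a\<in>{1..N}. W a i * f (p a i))" if "i \<in> V" for i f
  proof -
    have "(\<Sum>j\<in>V. M i j * f j) = (\<Sum>a\<in>{1..N}. \<Sum>j\<in>V. of_bool (p a i = j) * W a i * f j)"
      unfolding M_def sum_distrib_right by (rule sum.swap)
    also have "\<dots> = (\<Sum>a\<in>{1..N}. W a i * f (p a i))"
    proof (rule sum.cong[OF refl])
      fix a assume a: "a \<in> {1..N}"
      have "(\<Sum>j\<in>V. of_bool (p a i = j) * W a i * f j) = (\<Sum>j\<in>V. if p a i = j then W a i * f j else 0)"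
        by (intro sum.cong) auto
      also have "\<dots> = W a i * f (p a i)" using p_in[OF a that] finite_V by simp
      finally show "(\<Sum>j\<in>V. of_bool (p a i = j) * W a i * f j) = W a i * f (p a i)" .
    qed
    finally show ?thesis .
  qed
  define c where "c = (\<Sum>v\<in>V. x v * y v)"
  have c: "0 < c" unfolding c_def using x y finite_V V_nonempty by (intro sum_pos) auto
  show ?thesis
  proof (rule that[of \<rho> x "\<lambda>v. y v / c"])
    show "(\<Sum>v\<in>V. \<Sum>a\<in>{1..N}. f (p a v) * W a v * (y v / c)) = \<rho> * (\<Sum>v\<in>V. f v * (y v / c))" for f
    proof -
      have "(\<Sum>v\<in>V. \<Sum>a\<in>{1..N}. f (p a v) * W a v * (y v / c))
          = (\<Sum>v\<in>V. (\<Sum>a\<in>{1..N}. W a v * f (p a v)) * (y v / c))"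
        unfolding sum_distrib_right by (intro sum.cong refl) (simp add: mult_ac)
      also have "\<dots> = (\<Sum>v\<in>V. (\<Sum>j\<in>V. M v j * f j) * (y v / c))"
        by (intro sum.cong refl) (simp add: M_sum)
      also have "\<dots> = (\<Sum>j\<in>V. (\<Sum>v\<in>V. M v j * y v) * (f j / c))"
        unfolding sum_distrib_right by (subst sum.swap) (simp add: mult_ac)
      also have "\<dots> = (\<Sum>j\<in>V. \<rho> * y j * (f j / c))" by (intro sum.cong refl) (simp add: ey)
      also have "\<dots> = \<rho> * (\<Sum>v\<in>V. f v * (y v / c))" by (simp add: sum_distrib_left mult_ac)
      finally show ?thesis .
    qed
    show "(\<Sum>v\<in>V. x v * (y v / c)) = 1"
      using c by (simp add: sum_divide_distrib[symmetric] c_def[symmetric])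
  qed (use \<rho> x y c ex M_sum in simp_all)
qed

end

text \<open>
  The equation for \<open>y\<close> gives consistency of the cylinder masses when a letter is appended, the one
  for \<open>x\<close> gives shift invariance, where a letter is prepended.
\<close>
lemma (in transitive_letter_system) gibbs_measure:
  obtains \<rho> x y \<mu> where "0 < \<rho>" "\<And>v. v \<in> V \<Longrightarrow> 0 < x v" "\<And>v. v \<in> V \<Longrightarrow> 0 < y v"
    "\<And>v. v \<in> V \<Longrightarrow> (\<Sum>a\<in>{1..N}. W a v * x (p a v)) = \<rho> * x v"
    "(\<Sum>v\<in>V. x v * y v) = 1" "invariant_measure \<mu> N"
    "\<And>n w. w \<in> words N n \<Longrightarrow>
      mass N \<mu> w = (\<Sum>v\<in>V. x (act p w v) * cocycle p W w v * y v) / \<rho> ^ n"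
proof -
  obtain \<rho> x y where \<rho>: "0 < \<rho>" and x: "\<And>v. v \<in> V \<Longrightarrow> 0 < x v" and y: "\<And>v. v \<in> V \<Longrightarrow> 0 < y v"
    and ex: "\<And>v. v \<in> V \<Longrightarrow> (\<Sum>a\<in>{1..N}. W a v * x (p a v)) = \<rho> * x v"
    and ey: "\<And>f. (\<Sum>v\<in>V. \<Sum>a\<in>{1..N}. f (p a v) * W a v * y v) = \<rho> * (\<Sum>v\<in>V. f v * y v)"
    and xy: "(\<Sum>v\<in>V. x v * y v) = 1"
    by (rule eigenfunctions) blast
  define m where "m w = (\<Sum>v\<in>V. x (act p w v) * cocycle p W w v * y v) / \<rho> ^ length w" for w
  have m_pos: "0 < m w" if "w \<in> words N n" for w n
    unfolding m_def using that \<rho> x y act_in cocycle_pos finite_V V_nonempty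
    by (intro divide_pos_pos sum_pos mult_pos_pos) auto
  have m_snoc: "(\<Sum>a\<in>{1..N}. m (w @ [a])) = m w" for w
  proof -
    have "(\<Sum>a\<in>{1..N}. m (w @ [a]))
        = (\<Sum>a\<in>{1..N}. \<Sum>v\<in>V. (x (act p w (p a v)) * cocycle p W w (p a v)) * W a v * y v) / \<rho> ^ Suc (length w)"
      by (simp add: m_def sum_divide_distrib[symmetric] act_append cocycle_append mult_ac)
    also have "(\<Sum>a\<in>{1..N}. \<Sum>v\<in>V. (x (act p w (p a v)) * cocycle p W w (p a v)) * W a v * y v)
        = \<rho> * (\<Sum>v\<in>V. x (act p w v) * cocycle p W w v * y v)"
      using ey[of "\<lambda>v. x (act p w v) * cocycle p W w v"] by (subst sum.swap)
    finally show ?thesis using \<rho> by (simp add: m_def)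
  qed
  have m_Cons: "(\<Sum>a\<in>{1..N}. m (a # w)) = m w" if "w \<in> words N n" for w n
  proof -
    have "(\<Sum>a\<in>{1..N}. m (a # w))
        = (\<Sum>a\<in>{1..N}. \<Sum>v\<in>V. W a (act p w v) * x (p a (act p w v)) * (cocycle p W w v * y v)) / \<rho> ^ Suc (length w)"
      by (simp add: m_def sum_divide_distrib[symmetric] mult_ac)
    also have "(\<Sum>a\<in>{1..N}. \<Sum>v\<in>V. W a (act p w v) * x (p a (act p w v)) * (cocycle p W w v * y v))
        = (\<Sum>v\<in>V. (\<Sum>a\<in>{1..N}. W a (act p w v) * x (p a (act p w v))) * (cocycle p W w v * y v))"
      unfolding sum_distrib_right by (rule sum.swap)
    also have "\<dots> = (\<Sum>v\<in>V. \<rho> * x (act p w v) * (cocycle p W w v * y v))"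
      using ex act_in[OF that] by (intro sum.cong refl) simp
    also have "\<dots> = \<rho> * (\<Sum>v\<in>V. x (act p w v) * cocycle p W w v * y v)"
      by (simp add: sum_distrib_left mult_ac)
    finally show ?thesis using \<rho> by (simp add: m_def)
  qed
  have "m [] = 1" using xy by (simp add: m_def)
  with m_pos m_snoc obtain \<mu> where \<mu>: "full_shift_measure \<mu> N"
    and cyl: "\<And>n w. w \<in> words N n \<Longrightarrow> mass N \<mu> w = m w"
    using exists_full_shift_measure[of N m] by blast
  have Cons_word: "a # w \<in> words N (Suc n)" if "a \<in> {1..N}" "w \<in> words N n" for a w n
    using that by (simp add: words_def)
  have "\<mu> \<in> invariant_measures N"
  proof (rule invariant_measureI[OF \<mu>])
    fix n w assume w: "w \<in> words N n"
    have "(\<Sum>a\<in>{1..N}. mass N \<mu> (a # w)) = (\<Sum>a\<in>{1..N}. m (a # w))"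
      by (intro sum.cong refl cyl[OF Cons_word[OF _ w]])
    then show "(\<Sum>a\<in>{1..N}. mass N \<mu> (a # w)) = mass N \<mu> w"
      using m_Cons[OF w] cyl[OF w] by simp
  qed
  then have "invariant_measure \<mu> N" by (simp add: invariant_measures_iff)
  moreover have "mass N \<mu> w = (\<Sum>v\<in>V. x (act p w v) * cocycle p W w v * y v) / \<rho> ^ n"
    if "w \<in> words N n" for w n
    using cyl[OF that] length_words[OF that] by (simp add: m_def)
  ultimately show ?thesis using that \<rho> x y ex xy by blast
qed

lemma finite_bounds:
  fixes f :: "'v \<Rightarrow> real"
  assumes "finite V" "V \<noteq> {}" "\<And>v. v \<in> V \<Longrightarrow> 0 < f v"
  obtains a b where "0 < a" "0 < b" "\<And>v. v \<in> V \<Longrightarrow> a \<le> f v" "\<And>v. v \<in> V \<Longrightarrow> f v \<le> b"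
proof (rule that[of "Min (f ` V)" "Max (f ` V)"])
  obtain v where v: "v \<in> V" using assms(2) by blast
  have "0 < f v" "f v \<le> Max (f ` V)" using assms v by auto
  then show "0 < Max (f ` V)" by linarith
qed (use assms in auto)

text \<open>
  The comparison with the cocycle holds because \<open>x\<close> and \<open>y\<close> are bounded above and below. For
  ergodicity, the masses of two cylinders are dominated by the weights at single points \<open>v\<close> and \<open>v'\<close>;
  by transitivity, one of finitely many connecting words can be inserted so that the concatenated
  word passes through both points. The last property is for a fixed point, where the
  eigenvalue and the measure are explicit.
\<close>
lemma (in transitive_letter_system) gibbs_measure_properties:
  obtains \<rho> \<mu> C where "0 < \<rho>" "0 < C" "invariant_measure \<mu> N" "ergodic \<mu>"
    "\<And>n w v. w \<in> words N n \<Longrightarrow> v \<in> V \<Longrightarrow> cocycle p W w v \<le> C * (\<rho> ^ n * mass N \<mu> w)"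
    "\<And>n w. w \<in> words N n \<Longrightarrow> \<rho> ^ n * mass N \<mu> w \<le> C * (\<Sum>v\<in>V. cocycle p W w v)"
    "\<And>v a. V = {v} \<Longrightarrow> a \<in> {1..N} \<Longrightarrow>
      \<rho> = (\<Sum>a\<in>{1..N}. W a v) \<and> mass N \<mu> [a] = W a v / \<rho>"
proof -
  obtain \<rho> x y \<mu> where \<rho>: "0 < \<rho>" and x: "\<And>v. v \<in> V \<Longrightarrow> 0 < x v" and y: "\<And>v. v \<in> V \<Longrightarrow> 0 < y v"
    and ex: "\<And>v. v \<in> V \<Longrightarrow> (\<Sum>a\<in>{1..N}. W a v * x (p a v)) = \<rho> * x v"
    and xy: "(\<Sum>v\<in>V. x v * y v) = 1" and \<mu>: "invariant_measure \<mu> N"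
    and cyl: "\<And>n w. w \<in> words N n \<Longrightarrow>
      mass N \<mu> w = (\<Sum>v\<in>V. x (act p w v) * cocycle p W w v * y v) / \<rho> ^ n"
    by (rule gibbs_measure) blast
  obtain x0 x1 where x01: "0 < x0" "0 < x1" "\<And>v. v \<in> V \<Longrightarrow> x0 \<le> x v" "\<And>v. v \<in> V \<Longrightarrow> x v \<le> x1"
    using finite_bounds[of V x] finite_V V_nonempty x by blast
  obtain y0 y1 where y01: "0 < y0" "0 < y1" "\<And>v. v \<in> V \<Longrightarrow> y0 \<le> y v" "\<And>v. v \<in> V \<Longrightarrow> y v \<le> y1"
    using finite_bounds[of V y] finite_V V_nonempty y by blast
  have lower: "x0 * y0 * cocycle p W w v \<le> \<rho> ^ n * mass N \<mu> w"
    if w: "w \<in> words N n" and v: "v \<in> V" for n w v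
  proof -
    have "x0 * y0 * cocycle p W w v = x0 * cocycle p W w v * y0" by simp
    also have "\<dots> \<le> x (act p w v) * cocycle p W w v * y v"
      using x01 y01 cocycle_pos[OF w] act_in[OF w] v x y
      by (intro mult_mono) (auto intro: less_imp_le mult_nonneg_nonneg)
    also have "\<dots> \<le> (\<Sum>v\<in>V. x (act p w v) * cocycle p W w v * y v)"
      using cocycle_pos[OF w] act_in[OF w] v x y finite_V
      by (intro member_le_sum mult_nonneg_nonneg) (auto intro: less_imp_le)
    also have "\<dots> = \<rho> ^ n * mass N \<mu> w" using \<rho> cyl[OF w] by simp
    finally show ?thesis .
  qed
  have upper: "\<rho> ^ n * mass N \<mu> w \<le> x1 * y1 * (\<Sum>v\<in>V. cocycle p W w v)"
    if w: "w \<in> words N n" for n w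
  proof -
    have "\<rho> ^ n * mass N \<mu> w = (\<Sum>v\<in>V. x (act p w v) * cocycle p W w v * y v)"
      using \<rho> cyl[OF w] by simp
    also have "\<dots> \<le> (\<Sum>v\<in>V. x1 * cocycle p W w v * y1)"
      using x01 y01 cocycle_pos[OF w] act_in[OF w] x y
      by (intro sum_mono mult_mono) (auto intro: less_imp_le mult_nonneg_nonneg)
    also have "\<dots> = x1 * y1 * (\<Sum>v\<in>V. cocycle p W w v)" by (simp add: sum_distrib_left mult_ac)
    finally show ?thesis .
  qed
  define C where "C = max (1 / (x0 * y0)) (x1 * y1)"
  have C: "0 < C" using x01 y01 by (simp add: C_def max_def)
  interpret \<mu>: invariant_measure \<mu> N by fact
  have "\<exists>n. \<exists>k\<in>words N n. act p k z = v" if "z \<in> V" "v \<in> V" for z v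
    using transitive that by blast
  then obtain len k where k: "\<And>z v. z \<in> V \<Longrightarrow> v \<in> V \<Longrightarrow> k z v \<in> words N (len z v) \<and> act p (k z v) z = v"
    by metis
  define g where "g = (\<lambda>(z, v). cocycle p W (k z v) z / \<rho> ^ len z v)"
  have g_pos: "0 < g q" if qV: "q \<in> V \<times> V" for q
  proof -
    obtain z v where q: "q = (z, v)" "z \<in> V" "v \<in> V" using qV by blast
    then have "0 < cocycle p W (k z v) z" using cocycle_pos[of "k z v" "len z v" z] k by blast
    then show ?thesis using \<rho> by (simp add: q(1) g_def)
  qed
  \<comment> \<open>The least normalised weight of the finitely many connecting words.\<close>
  define \<delta> where "\<delta> = Min (g ` (V \<times> V))"
  have fin: "finite (g ` (V \<times> V))" using finite_V by simp
  have "0 < \<delta>" unfolding \<delta>_def using V_nonempty g_pos by (subst Min_gr_iff[OF fin]) blast+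
  moreover have "\<delta> \<le> g q" if "q \<in> V \<times> V" for q
    unfolding \<delta>_def by (intro Min_le[OF fin] imageI that)
  ultimately have \<delta>: "0 < \<delta>" "\<And>q. q \<in> V \<times> V \<Longrightarrow> \<delta> \<le> g q" by blast+
  define l where "l = Suc (Max ((\<lambda>(z, v). len z v) ` (V \<times> V)))"
  have len_less: "len z v < l" if "z \<in> V" "v \<in> V" for z v
    unfolding l_def less_Suc_eq_le using that finite_V by (intro Max_ge) auto
  define B where "B = x1 * y1 * real (card V)"
  have B: "0 < B" using x01 y01 finite_V V_nonempty by (simp add: B_def card_gt_0_iff)
  have dominant: "\<exists>v\<in>V. mass N \<mu> w \<le> B * (cocycle p W w v / \<rho> ^ n)" if w: "w \<in> words N n" for n w
  proof -
    let ?f = "cocycle p W w"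
    have fin: "finite (?f ` V)" using finite_V by simp
    have "Max (?f ` V) \<in> ?f ` V" using fin V_nonempty by (intro Max_in) simp_all
    then obtain v where v_max: "Max (?f ` V) = ?f v" and "v \<in> V" by (rule imageE)
    have "?f u \<le> ?f v" if "u \<in> V" for u
      unfolding v_max[symmetric] by (intro Max_ge[OF fin] imageI that)
    with \<open>v \<in> V\<close> have v: "v \<in> V" "\<And>u. u \<in> V \<Longrightarrow> ?f u \<le> ?f v" by blast+
    have "\<rho> ^ n * mass N \<mu> w \<le> x1 * y1 * (\<Sum>u\<in>V. cocycle p W w u)" by (rule upper[OF w])
    also have "\<dots> \<le> x1 * y1 * (\<Sum>u\<in>V. cocycle p W w v)"
      using x01 y01 v(2) by (intro mult_left_mono sum_mono) auto
    finally have "\<rho> ^ n * mass N \<mu> w \<le> B * cocycle p W w v" by (simp add: B_def mult_ac)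
    then show ?thesis using v(1) \<rho> by (intro bexI[of _ v]) (simp_all add: field_simps)
  qed
  have "ergodic \<mu>"
  proof (rule \<mu>.ergodic_if_quasi_mixing)
    show "0 < x0 * y0 * \<delta> / (B * B)" using x01 y01 \<delta> B by simp
    fix n m u w assume u: "u \<in> words N n" and w: "w \<in> words N m"
    obtain v where v: "v \<in> V" "mass N \<mu> u \<le> B * (cocycle p W u v / \<rho> ^ n)" using dominant[OF u] by blast
    obtain v' where v': "v' \<in> V" "mass N \<mu> w \<le> B * (cocycle p W w v' / \<rho> ^ m)" using dominant[OF w] by blast
    define z where "z = act p w v'"
    have z: "z \<in> V" unfolding z_def by (rule act_in[OF w v'(1)])
    have kw: "k z v \<in> words N (len z v)" "act p (k z v) z = v" using k[OF z v(1)] by auto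
    have ukw: "u @ k z v @ w \<in> words N (n + (len z v + m))"
      by (intro append_words u w kw(1))
    have "mass N \<mu> u * mass N \<mu> w
        \<le> (B * (cocycle p W u v / \<rho> ^ n)) * (B * (cocycle p W w v' / \<rho> ^ m))"
      using v(2) v'(2) by (intro mult_mono) (auto intro: order_trans[OF measure_nonneg])
    then have "x0 * y0 * \<delta> / (B * B) * (mass N \<mu> u * mass N \<mu> w)
        \<le> x0 * y0 * \<delta> / (B * B) * ((B * (cocycle p W u v / \<rho> ^ n)) * (B * (cocycle p W w v' / \<rho> ^ m)))"
      using x01 y01 \<delta> B by (intro mult_left_mono) auto
    also have "\<dots> = x0 * y0 * (cocycle p W u v / \<rho> ^ n) * (cocycle p W w v' / \<rho> ^ m) * \<delta>"
      using B by (simp add: field_simps)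
    also have "\<dots> \<le> x0 * y0 * (cocycle p W u v / \<rho> ^ n) * (cocycle p W w v' / \<rho> ^ m) * g (z, v)"
      using x01 y01 \<delta>(2)[of "(z, v)"] z v(1) v'(1) \<rho> cocycle_pos[OF u v(1)] cocycle_pos[OF w v'(1)]
      by (intro mult_left_mono) auto
    also have "\<dots> = x0 * y0 * cocycle p W (u @ k z v @ w) v' / \<rho> ^ (n + (len z v + m))"
      using kw(2) by (simp add: g_def cocycle_append act_append z_def[symmetric] power_add mult_ac)
    also have "\<dots> \<le> mass N \<mu> (u @ k z v @ w)"
      using lower[OF ukw v'(1)] \<rho> by (simp add: divide_le_eq mult.commute)
    finally show "\<exists>j<l. \<exists>k\<in>words N j. x0 * y0 * \<delta> / (B * B) * (mass N \<mu> u * mass N \<mu> w)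
        \<le> mass N \<mu> (u @ k @ w)"
      using len_less[OF z v(1)] kw(1) by blast
  qed
  show ?thesis
  proof (rule that[OF \<rho> C \<mu> \<open>ergodic \<mu>\<close>])
    fix n w assume w: "w \<in> words N n"
    have M0: "0 \<le> \<rho> ^ n * mass N \<mu> w" using \<rho> by simp
    show "cocycle p W w v \<le> C * (\<rho> ^ n * mass N \<mu> w)" if "v \<in> V" for v
    proof -
      have "cocycle p W w v \<le> 1 / (x0 * y0) * (\<rho> ^ n * mass N \<mu> w)"
        using lower[OF w that] x01 y01 by (simp add: field_simps)
      also have "\<dots> \<le> C * (\<rho> ^ n * mass N \<mu> w)"
        using M0 by (intro mult_right_mono) (simp_all add: C_def)
      finally show ?thesis .
    qed
    have "0 \<le> (\<Sum>v\<in>V. cocycle p W w v)" using cocycle_pos[OF w] by (intro sum_nonneg) (auto intro: less_imp_le)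
    then have "x1 * y1 * (\<Sum>v\<in>V. cocycle p W w v) \<le> C * (\<Sum>v\<in>V. cocycle p W w v)"
      by (intro mult_right_mono) (simp_all add: C_def)
    then show "\<rho> ^ n * mass N \<mu> w \<le> C * (\<Sum>v\<in>V. cocycle p W w v)"
      using upper[OF w] by linarith
  next
    fix v a assume V: "V = {v}" and a: "a \<in> {1..N}"
    have pv: "p b v = v" if "b \<in> {1..N}" for b using p_in[OF that, of v] V by simp
    have "(\<Sum>b\<in>{1..N}. W b v) * x v = (\<Sum>b\<in>{1..N}. W b v * x (p b v))"
      unfolding sum_distrib_right by (intro sum.cong refl) (simp add: pv)
    also have "\<dots> = \<rho> * x v" using ex V by simp
    finally have "\<rho> = (\<Sum>a\<in>{1..N}. W a v)" using x[of v] V by simp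
    moreover have "mass N \<mu> [a] = W a v / \<rho>"
    proof -
      have "[a] \<in> words N 1" using a by (simp add: words_def)
      then have "mass N \<mu> [a] = x v * W a v * y v / \<rho>"
        using cyl[of "[a]" 1] V pv[OF a] by simp
      moreover have "x v * y v = 1" using xy V by simp
      then have "x v * W a v * y v = W a v" by (simp add: mult.commute mult.left_commute)
      ultimately show ?thesis by simp
    qed
    ultimately show "\<rho> = (\<Sum>a\<in>{1..N}. W a v) \<and> mass N \<mu> [a] = W a v / \<rho>" by blast
  qed
qed

section \<open>Invariant measures dominated by ergodic ones\<close>

text \<open>
  Ergodicity is defined through strictly invariant sets. The set of points that visit \<open>B\<close> infinitely
  often is strictly invariant, and it differs from \<open>B\<close> by a null set if \<open>B\<close> is almost invariant.
\<close>
lemma (in invariant_measure) ergodic_almost_invariant: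
  assumes "ergodic \<mu>" and B: "B \<in> sets \<mu>"
    and null: "measure \<mu> (B - (shift_map -` B \<inter> full_shift N)) = 0"
      "measure \<mu> ((shift_map -` B \<inter> full_shift N) - B) = 0"
  shows "measure \<mu> B = 0 \<or> measure \<mu> B = 1"
proof -
  have TB: "(shift_map ^^ m) -` B \<inter> full_shift N \<in> sets \<mu>" for m
    using measurable_sets[OF measurable_shift_funpow B] unfolding space_eq .
  have TB1: "shift_map -` B \<inter> full_shift N \<in> sets \<mu>" using TB[of 1] by simp
  define E where "E = (B - (shift_map -` B \<inter> full_shift N)) \<union> ((shift_map -` B \<inter> full_shift N) - B)"
  have E: "E \<in> sets \<mu>" unfolding E_def by (rule sets.Un[OF sets.Diff[OF B TB1] sets.Diff[OF TB1 B]])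
  have "measure \<mu> E = 0"
    using measure_Un_le[OF sets.Diff[OF B TB1] sets.Diff[OF TB1 B]] null measure_nonneg[of \<mu> E]
    unfolding E_def by linarith
  then have "measure \<mu> ((shift_map ^^ m) -` E \<inter> full_shift N) = 0" for m
    using measure_shift_vimage[OF E] by simp
  moreover have TE: "(shift_map ^^ m) -` E \<inter> full_shift N \<in> sets \<mu>" for m
    using measurable_sets[OF measurable_shift_funpow E] unfolding space_eq .
  ultimately have "AE x in \<mu>. x \<notin> (shift_map ^^ m) -` E \<inter> full_shift N" for m
    by (intro AE_not_in) (simp add: null_sets_def emeasure_eq_measure)
  then have "AE x in \<mu>. \<forall>m. x \<notin> (shift_map ^^ m) -` E \<inter> full_shift N"
    by (simp only: AE_all_countable) blast
  then have AE_const: "AE x in \<mu>. \<forall>m. (shift_map ^^ m) x \<in> B \<longleftrightarrow> x \<in> B"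
  proof (rule AE_mp, intro AE_I2 impI allI)
    fix x m assume x: "x \<in> space \<mu>" "\<forall>m. x \<notin> (shift_map ^^ m) -` E \<inter> full_shift N"
    show "(shift_map ^^ m) x \<in> B \<longleftrightarrow> x \<in> B"
    proof (induction m)
      case (Suc m)
      have "(shift_map ^^ m) x \<notin> E" using x by (auto simp: space_eq)
      moreover have "(shift_map ^^ m) x \<in> full_shift N" using x by (simp add: space_eq shift_in_full_shift)
      ultimately have "(shift_map ^^ Suc m) x \<in> B \<longleftrightarrow> (shift_map ^^ m) x \<in> B" by (auto simp: E_def)
      then show ?case using Suc by simp
    qed simp
  qed
  define B' where "B' = (\<Inter>n. \<Union>m\<in>{n..}. (shift_map ^^ m) -` B \<inter> full_shift N)"
  have "(\<Union>m\<in>{n..}. (shift_map ^^ m) -` B \<inter> full_shift N) \<in> sets \<mu>" for n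
    by (intro sets.countable_UN'' TB) auto
  then have B': "B' \<in> sets \<mu>"
    unfolding B'_def by (intro sets.countable_INT') blast+
  have B'_iff: "x \<in> B' \<longleftrightarrow> x \<in> full_shift N \<and> (\<forall>n. \<exists>m\<ge>n. (shift_map ^^ m) x \<in> B)" for x
    by (auto simp: B'_def)
  have "shift_map x \<in> B' \<longleftrightarrow> x \<in> B'" if x: "x \<in> full_shift N" for x
  proof -
    have "(\<forall>n. \<exists>m\<ge>n. (shift_map ^^ m) (shift_map x) \<in> B) \<longleftrightarrow> (\<forall>n. \<exists>m\<ge>n. (shift_map ^^ Suc m) x \<in> B)"
      by (simp add: funpow_swap1)
    also have "\<dots> \<longleftrightarrow> (\<forall>n. \<exists>m\<ge>n. (shift_map ^^ m) x \<in> B)"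
    proof (intro iffI allI)
      fix n assume "\<forall>n. \<exists>m\<ge>n. (shift_map ^^ Suc m) x \<in> B"
      then obtain m where "m \<ge> n" "(shift_map ^^ Suc m) x \<in> B" by blast
      then show "\<exists>m\<ge>n. (shift_map ^^ m) x \<in> B" by (intro exI[of _ "Suc m"]) simp
    next
      fix n assume "\<forall>n. \<exists>m\<ge>n. (shift_map ^^ m) x \<in> B"
      then obtain m where "m \<ge> Suc n" "(shift_map ^^ m) x \<in> B" by blast
      then show "\<exists>m\<ge>n. (shift_map ^^ Suc m) x \<in> B" by (cases m) auto
    qed
    finally show ?thesis
      using x shift_in_full_shift[of x N 1] by (simp add: B'_iff)
  qed
  then have "shift_map -` B' \<inter> space \<mu> = B'" by (auto simp: space_eq B'_iff)
  then have "measure \<mu> B' = 0 \<or> measure \<mu> B' = 1" using assms(1) B' by (simp add: ergodic_def)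
  moreover have "measure \<mu> B' = measure \<mu> B"
  proof (rule measure_eq_AE[OF _ B' B])
    show "AE x in \<mu>. x \<in> B' \<longleftrightarrow> x \<in> B"
      using AE_const AE_space by eventually_elim (auto simp: B'_iff space_eq)
  qed
  ultimately show ?thesis by simp
qed

locale dominated_measure =
  fixes N :: nat and V :: "'v set" and \<mu> :: "'v \<Rightarrow> (nat \<Rightarrow> nat) measure" and \<nu> :: "(nat \<Rightarrow> nat) measure"
  assumes finite_V: "finite V" and V_nonempty: "V \<noteq> {}"
    and inv_\<mu>: "v \<in> V \<Longrightarrow> invariant_measure (\<mu> v) N"
    and inv_\<nu>: "invariant_measure \<nu> N"
    and dominated: "B \<in> sigma_sets (full_shift N) (cyls N) \<Longrightarrow>
      (\<And>v. v \<in> V \<Longrightarrow> measure (\<mu> v) B = 0) \<Longrightarrow> measure \<nu> B = 0"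
begin

sublocale nu: invariant_measure \<nu> N by (rule inv_\<nu>)

lemma sets_\<mu>: "v \<in> V \<Longrightarrow> sets (\<mu> v) = sets \<nu>"
  using full_shift_measure.sets_eq[OF invariant_measure.axioms(1)[OF inv_\<mu>]] nu.sets_eq by simp

lemma space_\<mu>: "v \<in> V \<Longrightarrow> space (\<mu> v) = space \<nu>"
  using sets_\<mu> by (rule sets_eq_imp_space_eq)

text \<open>
  The average of the measures \<open>\<mu> v\<close>, formed as a mixture. The value \<open>\<nu>\<close> outside \<open>V\<close> is only there
  to make the kernel well-defined on the whole type.
\<close>
definition avg :: "(nat \<Rightarrow> nat) measure" where
  "avg = measure_pmf (pmf_of_set V) \<bind> (\<lambda>v. if v \<in> V then \<mu> v else \<nu>)"

lemma kernel: "(\<lambda>v. if v \<in> V then \<mu> v else \<nu>) \<in> measurable (measure_pmf (pmf_of_set V)) (subprob_algebra \<nu>)"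
  using sets_\<mu> full_shift_measure.axioms(1)[OF invariant_measure.axioms(1)[OF inv_\<mu>]]
    nu.prob_space_axioms
  by (auto simp: space_subprob_algebra prob_space_imp_subprob_space)

lemma sets_avg: "sets avg = sets \<nu>"
  unfolding avg_def by (rule sets_bind) (auto simp: sets_\<mu>)

lemma nn_integral_avg:
  assumes "f \<in> borel_measurable \<nu>"
  shows "(\<integral>\<^sup>+x. f x \<partial>avg) = (\<Sum>v\<in>V. \<integral>\<^sup>+x. f x \<partial>\<mu> v) / of_nat (card V)"
proof -
  have "(\<integral>\<^sup>+x. f x \<partial>avg) = (\<integral>\<^sup>+v. \<integral>\<^sup>+x. f x \<partial>(if v \<in> V then \<mu> v else \<nu>) \<partial>measure_pmf (pmf_of_set V))"
    unfolding avg_def by (rule nn_integral_bind[OF assms kernel])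
  also have "\<dots> = (\<Sum>v\<in>V. \<integral>\<^sup>+x. f x \<partial>(if v \<in> V then \<mu> v else \<nu>)) / of_nat (card V)"
    using finite_V V_nonempty by (subst nn_integral_pmf_of_set) auto
  also have "(\<Sum>v\<in>V. \<integral>\<^sup>+x. f x \<partial>(if v \<in> V then \<mu> v else \<nu>)) = (\<Sum>v\<in>V. \<integral>\<^sup>+x. f x \<partial>\<mu> v)"
    by (intro sum.cong) auto
  finally show ?thesis .
qed

lemma card_V: "0 < card V"
  using finite_V V_nonempty by (simp add: card_gt_0_iff)

lemma emeasure_avg:
  assumes "B \<in> sets \<nu>"
  shows "emeasure avg B = (\<Sum>v\<in>V. emeasure (\<mu> v) B) / of_nat (card V)"
proof -
  have "(\<integral>\<^sup>+x. indicator B x \<partial>avg) = (\<Sum>v\<in>V. \<integral>\<^sup>+x. indicator B x \<partial>\<mu> v) / of_nat (card V)"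
    using assms by (intro nn_integral_avg) simp
  then show ?thesis using assms sets_avg sets_\<mu> by simp
qed

lemma prob_\<mu>: "v \<in> V \<Longrightarrow> prob_space (\<mu> v)"
  by (rule full_shift_measure.axioms(1)[OF invariant_measure.axioms(1)[OF inv_\<mu>]])

sublocale avg: prob_space avg
proof
  have "space avg = space \<nu>" using sets_avg by (rule sets_eq_imp_space_eq)
  then have "emeasure avg (space avg) = (\<Sum>v\<in>V. emeasure (\<mu> v) (space (\<mu> v))) / of_nat (card V)"
    using emeasure_avg[of "space \<nu>"] space_\<mu> by simp
  also have "\<dots> = (\<Sum>v\<in>V. 1) / of_nat (card V)"
    using prob_\<mu> by (intro arg_cong2[of _ _ _ _ "(/)"] sum.cong refl prob_space.emeasure_space_1) auto
  also have "\<dots> = 1" using card_V by (simp add: ennreal_of_nat_eq_real_of_nat ennreal_divide_self)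
  finally show "emeasure avg (space avg) = 1" .
qed

lemma measure_avg:
  assumes "B \<in> sets \<nu>"
  shows "measure avg B = (\<Sum>v\<in>V. measure (\<mu> v) B) / real (card V)"
proof -
  have "ennreal (measure avg B) = (\<Sum>v\<in>V. ennreal (measure (\<mu> v) B)) / of_nat (card V)"
    using emeasure_avg[OF assms] prob_\<mu> avg.emeasure_eq_measure
    by (simp add: finite_measure.emeasure_eq_measure prob_space.finite_measure cong: sum.cong)
  also have "\<dots> = ennreal ((\<Sum>v\<in>V. measure (\<mu> v) B) / real (card V))"
    using card_V by (simp add: sum_ennreal sum_nonneg ennreal_of_nat_eq_real_of_nat divide_ennreal)
  finally show ?thesis by (simp add: sum_nonneg)
qed

sublocale avg: invariant_measure avg N
proof
  show "sets avg = sigma_sets (full_shift N) (cyls N)" using sets_avg nu.sets_eq by simp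
next
  fix B assume "B \<in> sets avg"
  then have B: "B \<in> sets \<nu>" by (simp add: sets_avg)
  have "measure (\<mu> v) (shift_map -` B \<inter> full_shift N) = measure (\<mu> v) B" if "v \<in> V" for v
    using invariant_measure.measure_shift_vimage_1[OF inv_\<mu>[OF that]] B sets_\<mu>[OF that] by simp
  moreover have "shift_map -` B \<inter> full_shift N \<in> sets \<nu>"
    using measurable_sets[OF nu.measurable_shift B] unfolding nu.space_eq .
  ultimately show "measure avg (shift_map -` B \<inter> full_shift N) = measure avg B"
    using B by (simp add: measure_avg)
qed

lemma null_avg:
  assumes "B \<in> sets \<nu>" "measure avg B = 0" "v \<in> V"
  shows "measure (\<mu> v) B = 0"
proof -
  have "(\<Sum>v\<in>V. measure (\<mu> v) B) = 0" using measure_avg[OF assms(1)] assms(2) card_V by simp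
  then show ?thesis using assms(3) finite_V by (simp add: sum_nonneg_eq_0_iff)
qed

lemma obtain_density:
  obtains D :: "(nat \<Rightarrow> nat) \<Rightarrow> real" where "D \<in> borel_measurable avg" "\<And>x. 0 \<le> D x"
    "\<nu> = density avg (\<lambda>x. ennreal (D x))"
proof -
  have ac: "absolutely_continuous avg \<nu>"
    unfolding absolutely_continuous_def
  proof
    fix B assume "B \<in> null_sets avg"
    then have B: "B \<in> sets \<nu>" "measure avg B = 0" by (auto simp: null_sets_def sets_avg measure_def)
    then have "measure \<nu> B = 0" using null_avg by (intro dominated) (auto simp: nu.sets_eq)
    then show "B \<in> null_sets \<nu>" using B by (simp add: null_sets_def nu.emeasure_eq_measure)
  qed
  obtain D where D: "D \<in> borel_measurable avg" "AE x in avg. RN_deriv avg \<nu> x = ennreal (D x)" "\<And>x. 0 \<le> D x"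
    using avg.real_RN_deriv[OF nu.finite_measure_axioms ac sets_avg[symmetric]] by metis
  have "\<nu> = density avg (RN_deriv avg \<nu>)"
    using avg.density_RN_deriv[OF ac sets_avg[symmetric]] by simp
  also have "\<dots> = density avg (\<lambda>x. ennreal (D x))"
    using D by (intro density_cong) auto
  finally show ?thesis using that D by blast
qed

text \<open>
  Let \<open>D\<close> be the density of \<open>\<nu>\<close> with respect to the average. A superlevel set \<open>B\<close> of \<open>D\<close> is almost
  invariant: the part of \<open>B\<close> that leaves \<open>B\<close> and the part of the complement that enters it have equal
  mass for \<open>\<nu>\<close> and also for the average, while \<open>D\<close> is larger on the first part than on the second.
  Ergodicity of \<open>\<mu> v\<close>, applied to the superlevel set at the mean value of \<open>D\<close>, then forces \<open>D\<close> to
  equal this mean value almost everywhere.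
\<close>
lemma decomposition:
  assumes erg: "\<And>v. v \<in> V \<Longrightarrow> ergodic (\<mu> v)"
  obtains c where "\<And>v. v \<in> V \<Longrightarrow> 0 \<le> c v"
    "\<And>B. B \<in> sets \<nu> \<Longrightarrow> measure \<nu> B = (\<Sum>v\<in>V. c v * measure (\<mu> v) B)"
proof -
  obtain D :: "(nat \<Rightarrow> nat) \<Rightarrow> real" where D: "D \<in> borel_measurable avg" "\<And>x. 0 \<le> D x"
    and \<nu>: "\<nu> = density avg (\<lambda>x. ennreal (D x))"
    by (rule obtain_density) blast
  have D_nu [measurable]: "D \<in> borel_measurable \<nu>"
    using D(1) measurable_cong_sets[OF sets_avg refl] by blast
  have D_mu: "D \<in> borel_measurable (\<mu> v)" if "v \<in> V" for v
    using D_nu measurable_cong_sets[OF sets_\<mu>[OF that] refl] by blast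
  have nn_nu: "emeasure \<nu> B = (\<integral>\<^sup>+x. ennreal (D x) * indicator B x \<partial>avg)" if "B \<in> sets \<nu>" for B
    using that D(1) sets_avg by (subst \<nu>, subst emeasure_density) auto
  have int_avg: "integrable avg D"
  proof (rule integrableI_nonneg[OF D(1)])
    have "(\<integral>\<^sup>+x. ennreal (D x) \<partial>avg) = (\<integral>\<^sup>+x. ennreal (D x) * indicator (space \<nu>) x \<partial>avg)"
      using sets_eq_imp_space_eq[OF sets_avg] by (intro nn_integral_cong) simp
    also have "\<dots> = 1" using nn_nu[of "space \<nu>"] nu.emeasure_space_1 by simp
    finally show "(\<integral>\<^sup>+x. ennreal (D x) \<partial>avg) < \<infinity>" by simp
  qed (use D(2) in simp)
  have measure_nu: "measure \<nu> B = (\<integral>x. D x * indicator B x \<partial>avg)" if "B \<in> sets \<nu>" for B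
  proof -
    have "measure \<nu> B = (\<integral>x. indicator B x \<partial>\<nu>)" using that by simp
    also have "\<dots> = (\<integral>x. D x * indicator B x \<partial>avg)"
      using that D sets_avg by (subst \<nu>, subst integral_real_density) auto
    finally show ?thesis .
  qed
  have almost_invariant: "measure avg (B - (shift_map -` B \<inter> full_shift N)) = 0"
      "measure avg ((shift_map -` B \<inter> full_shift N) - B) = 0"
    if B_def: "B = {x \<in> space \<nu>. c < D x}" for B c
  proof -
    have B: "B \<in> sets \<nu>" unfolding B_def by measurable
    define TB where "TB = shift_map -` B \<inter> full_shift N"
    have TB: "TB \<in> sets \<nu>" unfolding TB_def
      using measurable_sets[OF nu.measurable_shift B] unfolding nu.space_eq .
    have diff: "measure M (B - TB) = measure M (TB - B)" if M: "invariant_measure M N" for M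
    proof -
      interpret M: invariant_measure M N by fact
      have sets: "B \<in> sets M" "TB \<in> sets M" using B TB M.sets_eq nu.sets_eq by auto
      have "measure M TB = measure M B" unfolding TB_def by (rule M.measure_shift_vimage_1[OF sets(1)])
      then show ?thesis using M.finite_measure_Diff'[OF sets] M.finite_measure_Diff'[OF sets(2,1)]
        by (simp add: Int_commute)
    qed
    have E: "B - TB \<in> sets \<nu>" "TB - B \<in> sets \<nu>" using B TB by auto
    have ind: "integrable avg (\<lambda>x. (D x - c) * indicator A x)" if "A \<in> sets \<nu>" for A
      using int_avg that sets_avg by (intro integrable_real_mult_indicator) auto
    have val: "(\<integral>x. (D x - c) * indicator A x \<partial>avg) = measure \<nu> A - c * measure avg A" if A: "A \<in> sets \<nu>" for A
    proof -
      have "(\<integral>x. (D x - c) * indicator A x \<partial>avg) = (\<integral>x. D x * indicator A x - c * indicator A x \<partial>avg)"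
        by (simp add: algebra_simps)
      also have "\<dots> = (\<integral>x. D x * indicator A x \<partial>avg) - (\<integral>x. c * indicator A x \<partial>avg)"
        using int_avg A sets_avg by (intro Bochner_Integration.integral_diff integrable_real_mult_indicator) auto
      also have "\<dots> = measure \<nu> A - c * measure avg A"
        using A sets_avg measure_nu by simp
      finally show ?thesis .
    qed
    have "(\<integral>x. (D x - c) * indicator (B - TB) x \<partial>avg) = (\<integral>x. (D x - c) * indicator (TB - B) x \<partial>avg)"
      using val E diff[OF inv_\<nu>] diff[OF avg.invariant_measure_axioms] by simp
    also have "\<dots> \<le> (\<integral>x. 0 \<partial>avg)"
    proof (rule integral_mono)
      fix x assume "x \<in> space avg"
      then show "(D x - c) * indicator (TB - B) x \<le> 0"
        using sets_eq_imp_space_eq[OF sets_avg] by (auto simp: B_def indicator_def)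
    qed (use ind E in auto)
    finally have le: "(\<integral>x. (D x - c) * indicator (B - TB) x \<partial>avg) \<le> 0" by simp
    have nonneg: "AE x in avg. 0 \<le> (D x - c) * indicator (B - TB) x"
      by (rule AE_I2) (auto simp: B_def indicator_def)
    have "(\<integral>x. (D x - c) * indicator (B - TB) x \<partial>avg) = 0"
      using le integral_nonneg_AE[OF nonneg] by linarith
    then have "AE x in avg. (D x - c) * indicator (B - TB) x = 0"
      using integral_nonneg_eq_0_iff_AE[OF ind[OF E(1)] nonneg] by simp
    then have "AE x in avg. x \<notin> B - TB"
      by eventually_elim (auto simp: B_def indicator_def split: if_splits)
    then show "measure avg (B - (shift_map -` B \<inter> full_shift N)) = 0"
      unfolding TB_def[symmetric] using E(1) sets_avg avg.prob_eq_0 by blast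
    then show "measure avg ((shift_map -` B \<inter> full_shift N) - B) = 0"
      using diff[OF avg.invariant_measure_axioms] unfolding TB_def by simp
  qed
  define c where "c v = (\<integral>x. D x \<partial>\<mu> v)" for v
  have c0: "0 \<le> c v" for v unfolding c_def using D(2) by (intro Bochner_Integration.integral_nonneg) auto
  have const: "AE x in \<mu> v. D x = c v" if v: "v \<in> V" for v
  proof -
    interpret M: invariant_measure "\<mu> v" N by (rule inv_\<mu>[OF v])
    have int: "integrable (\<mu> v) D"
    proof (rule integrableI_nonneg[OF D_mu[OF v]])
      have "(\<integral>\<^sup>+x. ennreal (D x) \<partial>\<mu> v) \<le> (\<Sum>v\<in>V. \<integral>\<^sup>+x. ennreal (D x) \<partial>\<mu> v)"
        using v finite_V by (intro member_le_sum) auto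
      also have "\<dots> < \<infinity>"
      proof (rule ccontr)
        assume "\<not> (\<Sum>v\<in>V. \<integral>\<^sup>+x. ennreal (D x) \<partial>\<mu> v) < \<infinity>"
        then have "(\<integral>\<^sup>+x. ennreal (D x) \<partial>avg) = \<infinity>"
          using nn_integral_avg[of "\<lambda>x. ennreal (D x)"] D_nu
          by (simp add: less_top[symmetric] ennreal_top_divide of_nat_less_top)
        then show False using integrableD(2)[OF int_avg] D(2) by simp
      qed
      finally show "(\<integral>\<^sup>+x. ennreal (D x) \<partial>\<mu> v) < \<infinity>" .
    qed (use D(2) in simp)
    define B where "B = {x \<in> space \<nu>. c v < D x}"
    have B\<nu>: "B \<in> sets \<nu>" unfolding B_def by measurable
    then have B: "B \<in> sets (\<mu> v)" using sets_\<mu>[OF v] by simp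
    have TB: "shift_map -` B \<inter> full_shift N \<in> sets \<nu>"
      using measurable_sets[OF nu.measurable_shift B\<nu>] unfolding nu.space_eq .
    have "measure (\<mu> v) B = 0 \<or> measure (\<mu> v) B = 1"
      using almost_invariant[OF B_def] null_avg[OF _ _ v] B\<nu> TB
      by (intro M.ergodic_almost_invariant erg[OF v] B) auto
    then show ?thesis
    proof
      assume "measure (\<mu> v) B = 0"
      then have "AE x in \<mu> v. x \<notin> B" using M.prob_eq_0[OF B] by simp
      then have le: "AE x in \<mu> v. 0 \<le> c v - D x"
        using AE_space by eventually_elim (auto simp: B_def space_\<mu>[OF v])
      have "(\<integral>x. c v - D x \<partial>\<mu> v) = 0"
        using int M.prob_space by (subst Bochner_Integration.integral_diff) (auto simp: c_def[symmetric])
      then have "AE x in \<mu> v. c v - D x = 0"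
        using integral_nonneg_eq_0_iff_AE[OF _ le] int by simp
      then show ?thesis by eventually_elim simp
    next
      assume "measure (\<mu> v) B = 1"
      then have "AE x in \<mu> v. x \<in> B" using M.prob_eq_1[OF B] by simp
      then have le: "AE x in \<mu> v. 0 \<le> D x - c v" by eventually_elim (auto simp: B_def)
      have "(\<integral>x. D x - c v \<partial>\<mu> v) = 0"
        using int M.prob_space by (subst Bochner_Integration.integral_diff) (auto simp: c_def[symmetric])
      then have "AE x in \<mu> v. D x - c v = 0"
        using integral_nonneg_eq_0_iff_AE[OF _ le] int by simp
      then show ?thesis by eventually_elim simp
    qed
  qed
  show ?thesis
  proof (rule that[of "\<lambda>v. c v / real (card V)"])
    fix B assume B: "B \<in> sets \<nu>"
    have "emeasure \<nu> B = (\<Sum>v\<in>V. \<integral>\<^sup>+x. ennreal (D x) * indicator B x \<partial>\<mu> v) / of_nat (card V)"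
    proof -
      have [measurable]: "B \<in> sets \<nu>" by (rule B)
      show ?thesis unfolding nn_nu[OF B] by (intro nn_integral_avg) measurable
    qed
    also have "(\<Sum>v\<in>V. \<integral>\<^sup>+x. ennreal (D x) * indicator B x \<partial>\<mu> v) = (\<Sum>v\<in>V. ennreal (c v * measure (\<mu> v) B))"
    proof (rule sum.cong[OF refl])
      fix v assume v: "v \<in> V"
      interpret M: prob_space "\<mu> v" by (rule prob_\<mu>[OF v])
      have "(\<integral>\<^sup>+x. ennreal (D x) * indicator B x \<partial>\<mu> v) = (\<integral>\<^sup>+x. ennreal (c v) * indicator B x \<partial>\<mu> v)"
      proof (rule nn_integral_cong_AE)
        show "AE x in \<mu> v. ennreal (D x) * indicator B x = ennreal (c v) * indicator B x"
          using const[OF v] by eventually_elim simp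
      qed
      also have "\<dots> = ennreal (c v) * emeasure (\<mu> v) B"
        using B sets_\<mu>[OF v] by (simp add: nn_integral_cmult_indicator)
      finally show "(\<integral>\<^sup>+x. ennreal (D x) * indicator B x \<partial>\<mu> v) = ennreal (c v * measure (\<mu> v) B)"
        using c0 by (simp add: M.emeasure_eq_measure ennreal_mult)
    qed
    also have "(\<Sum>v\<in>V. ennreal (c v * measure (\<mu> v) B)) / of_nat (card V)
        = ennreal ((\<Sum>v\<in>V. c v * measure (\<mu> v) B) / real (card V))"
      using card_V c0 by (simp add: sum_ennreal sum_nonneg ennreal_of_nat_eq_real_of_nat divide_ennreal)
    finally have "measure \<nu> B = (\<Sum>v\<in>V. c v * measure (\<mu> v) B) / real (card V)"
      using c0 by (simp add: nu.emeasure_eq_measure sum_nonneg)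
    then show "measure \<nu> B = (\<Sum>v\<in>V. c v / real (card V) * measure (\<mu> v) B)"
      by (simp add: sum_divide_distrib)
  qed (use c0 in simp)
qed

end

section \<open>Subadditive sequences and entropy\<close>

text \<open>
  Fekete's lemma. Dividing \<open>n\<close> by \<open>m\<close> with remainder shows that \<open>a n\<close> is at most \<open>n * (a m / m)\<close> up to a
  constant that depends on \<open>m\<close>; choose \<open>m\<close> such that \<open>a m / m\<close> is close to the infimum.
\<close>
lemma fekete:
  fixes a :: "nat \<Rightarrow> real"
  assumes sub: "\<And>m n. a (m + n) \<le> a m + a n" and low: "\<And>n. real n * B \<le> a n"
  obtains L where "(\<lambda>n. 1 / real n * a n) \<longlonglongrightarrow> L" "\<And>n. real n * L \<le> a n"
proof -
  define S where "S = (\<lambda>n. a n / real n) ` {1..}"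
  define L where "L = Inf S"
  have bdd: "bdd_below S"
    unfolding S_def using low by (intro bdd_belowI2[of _ B]) (simp add: field_simps)
  have Lle: "real n * L \<le> a n" for n
  proof (cases "n = 0")
    case True
    then show ?thesis using low[of 0] by simp
  next
    case False
    then have "L \<le> a n / real n" unfolding L_def S_def[symmetric] using bdd
      by (intro cInf_lower) (auto simp: S_def)
    then show ?thesis using False by (simp add: field_simps)
  qed
  have mult: "a (q * m + r) \<le> real q * a m + a r" for q m r
  proof (induction q)
    case (Suc q)
    have "a (Suc q * m + r) \<le> a m + a (q * m + r)" using sub[of m "q * m + r"] by (simp add: add.assoc)
    then show ?case using Suc by (simp add: algebra_simps)
  qed simp
  have "(\<lambda>n. 1 / real n * a n) \<longlonglongrightarrow> L"
  proof (rule LIMSEQ_I)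
    fix e :: real assume e: "0 < e"
    have "S \<noteq> {}" by (auto simp: S_def)
    moreover have "Inf S < L + e / 2" using e by (simp add: L_def)
    ultimately obtain s where "s \<in> S" "s < L + e / 2" using cInf_lessD by blast
    then obtain m where m: "m \<ge> 1" "a m / real m < L + e / 2" by (auto simp: S_def)
    define M where "M = Max ((\<lambda>r. \<bar>a r\<bar>) ` {..<m}) + \<bar>a m\<bar>"
    have M: "\<bar>a r\<bar> + \<bar>a m\<bar> \<le> M" if "r < m" for r using that by (simp add: M_def)
    have upper: "a n \<le> real n * (a m / real m) + M" for n
    proof -
      define q r where "q = n div m" and "r = n mod m"
      have n: "n = q * m + r" "r < m" using m(1) by (simp_all add: q_def r_def)
      have "real n * (a m / real m) = real q * a m + real r / real m * a m"
        using m(1) by (simp add: n(1) field_simps)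
      moreover have "\<bar>real r / real m * a m\<bar> \<le> 1 * \<bar>a m\<bar>"
        unfolding abs_mult using n(2) by (intro mult_right_mono) auto
      moreover have "a n \<le> real q * a m + a r" using mult n(1) by simp
      ultimately show ?thesis using M[OF n(2)] by linarith
    qed
    obtain n0 where n0: "2 * M / e < real n0" using reals_Archimedean2 by blast
    show "\<exists>no. \<forall>n\<ge>no. norm (1 / real n * a n - L) < e"
    proof (intro exI allI impI)
      fix n assume n: "max 1 n0 \<le> n"
      then have "2 * M / e < real n" using n0 by simp
      then have "M < real n * (e / 2)" using e by (simp add: field_simps)
      moreover have "real n * (a m / real m) \<le> real n * (L + e / 2)"
        using m(2) by (intro mult_left_mono) auto
      ultimately have "a n < real n * (L + e)" using upper[of n] by (simp add: algebra_simps)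
      then have "1 / real n * a n < L + e" using n by (simp add: field_simps)
      moreover have "L \<le> 1 / real n * a n" using Lle[of n] n by (simp add: field_simps)
      ultimately show "norm (1 / real n * a n - L) < e" using e by simp
    qed
  qed
  then show ?thesis using that Lle by blast
qed

lemma lim_div_bounded_diff:
  fixes f g :: "nat \<Rightarrow> real"
  assumes "(\<lambda>n. 1 / real n * g n) \<longlonglongrightarrow> L" and "\<And>n. \<bar>f n - g n\<bar> \<le> D"
  shows "(\<lambda>n. 1 / real n * f n) \<longlonglongrightarrow> L"
proof -
  have "(\<lambda>n. 1 / real n * (f n - g n)) \<longlonglongrightarrow> 0"
  proof (rule tendsto_0_le[of "\<lambda>n. D * (1 / real n)" sequentially _ 1])
    show "(\<lambda>n. D * (1 / real n)) \<longlonglongrightarrow> 0"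
      using tendsto_mult[OF tendsto_const lim_1_over_n, of D] by simp
    show "\<forall>\<^sub>F n in sequentially. norm (1 / real n * (f n - g n)) \<le> norm (D * (1 / real n)) * 1"
    proof (intro always_eventually allI)
      fix n
      have "\<bar>f n - g n\<bar> \<le> \<bar>D\<bar>" using assms(2)[of n] by linarith
      then have "\<bar>f n - g n\<bar> * \<bar>1 / real n\<bar> \<le> \<bar>D\<bar> * \<bar>1 / real n\<bar>" by (rule mult_right_mono) simp
      then show "norm (1 / real n * (f n - g n)) \<le> norm (D * (1 / real n)) * 1"
        by (simp add: abs_mult mult.commute)
    qed
  qed
  from tendsto_add[OF assms(1) this] show ?thesis by (simp add: algebra_simps)
qed

lemma lim_div_linear: "(\<lambda>n. 1 / real n * (real n * L)) \<longlonglongrightarrow> L"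
proof (rule tendsto_eventually, rule eventually_sequentiallyI)
  show "1 / real n * (real n * L) = L" if "1 \<le> n" for n using that by simp
qed

text \<open>
  This is \<open>ln u \<le> u - 1\<close> at \<open>u = y / x\<close>. Summed over words, it gives the nonnegativity of relative
  entropies, on which the estimates below rest.
\<close>
lemma gibbs_inequality_pointwise:
  fixes x y :: real
  assumes "0 \<le> x" "0 \<le> y" "y = 0 \<Longrightarrow> x = 0"
  shows "x * (ln y - ln x) \<le> y - x"
proof (cases "x = 0")
  case False
  then have x: "0 < x" and y: "0 < y" using assms by (auto simp: less_le)
  have "ln y - ln x = ln (y / x)" using x y by (simp add: ln_div)
  also have "\<dots> \<le> y / x - 1" using x y by (intro ln_le_minus_one) simp
  finally have "x * (ln y - ln x) \<le> x * (y / x - 1)" using x by (intro mult_left_mono) auto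
  then show ?thesis using x by (simp add: algebra_simps)
qed (use assms in simp)

context invariant_measure
begin

abbreviation block_entropy :: "nat \<Rightarrow> real" where
  "block_entropy n \<equiv> (\<Sum>w\<in>words N n. - mass N \<mu> w * ln (mass N \<mu> w))"

lemma measure_cylinder_append_le:
  assumes "u \<in> words N n" "w \<in> words N m"
  shows "mass N \<mu> (u @ w) \<le> mass N \<mu> u"
    "mass N \<mu> (u @ w) \<le> mass N \<mu> w"
proof -
  show "mass N \<mu> (u @ w) \<le> mass N \<mu> u"
    unfolding sum_measure_cylinder_append[OF assms(1), of m, symmetric]
    using assms(2) by (intro member_le_sum) auto
  show "mass N \<mu> (u @ w) \<le> mass N \<mu> w"
    unfolding sum_measure_cylinder_prepend[OF assms(2), of n, symmetric]
    using assms(1) by (intro member_le_sum[of u "words N n" "\<lambda>u. mass N \<mu> (u @ w)"]) auto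
qed

text \<open>
  The entropy of a joint distribution is at most the sum of the entropies of its marginals; both
  marginals are distributions of the same measure by invariance.
\<close>
lemma block_entropy_subadditive: "block_entropy (n + m) \<le> block_entropy n + block_entropy m"
proof -
  define p where "p w = mass N \<mu> w" for w
  have p0: "0 \<le> p w" for w by (simp add: p_def)
  have "(\<Sum>u\<in>words N n. \<Sum>w\<in>words N m. p (u @ w) * (ln (p u) + ln (p w) - ln (p (u @ w))))
      \<le> (\<Sum>u\<in>words N n. \<Sum>w\<in>words N m. p u * p w - p (u @ w))"
  proof (intro sum_mono)
    fix u w assume uw: "u \<in> words N n" "w \<in> words N m"
    show "p (u @ w) * (ln (p u) + ln (p w) - ln (p (u @ w))) \<le> p u * p w - p (u @ w)"
    proof (cases "p (u @ w) = 0")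
      case False
      then have "0 < p u" "0 < p w"
        using measure_cylinder_append_le[OF uw] p0[of "u @ w"] unfolding p_def by linarith+
      then show ?thesis
        using gibbs_inequality_pointwise[of "p (u @ w)" "p u * p w"] p0 by (simp add: ln_mult)
    qed (use p0 in simp)
  qed
  also have "\<dots> = (\<Sum>u\<in>words N n. p u) * (\<Sum>w\<in>words N m. p w) - (\<Sum>v\<in>words N (n + m). p v)"
    by (simp add: sum_product sum_subtractf sum_words_add)
  also have "\<dots> = 0" unfolding p_def sum_measure_cylinder by simp
  finally have "(\<Sum>u\<in>words N n. \<Sum>w\<in>words N m. p (u @ w) * ln (p u))
      + (\<Sum>u\<in>words N n. \<Sum>w\<in>words N m. p (u @ w) * ln (p w))
      - (\<Sum>v\<in>words N (n + m). p v * ln (p v)) \<le> 0"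
    by (simp add: sum_words_add sum.distrib sum_subtractf right_diff_distrib distrib_left)
  moreover have "(\<Sum>u\<in>words N n. \<Sum>w\<in>words N m. p (u @ w) * ln (p u)) = (\<Sum>u\<in>words N n. p u * ln (p u))"
    unfolding sum_distrib_right[symmetric]
    by (intro sum.cong refl) (simp add: p_def sum_measure_cylinder_append)
  moreover have "(\<Sum>u\<in>words N n. \<Sum>w\<in>words N m. p (u @ w) * ln (p w)) = (\<Sum>w\<in>words N m. p w * ln (p w))"
    by (subst sum.swap, unfold sum_distrib_right[symmetric], intro sum.cong refl)
       (simp add: p_def sum_measure_cylinder_prepend)
  ultimately show ?thesis by (simp add: sum_negf p_def[symmetric])
qed

lemma entropy_rate_limit:
  "(\<lambda>n. 1 / real n * block_entropy n) \<longlonglongrightarrow> entropy_rate N \<mu>" "real n * entropy_rate N \<mu> \<le> block_entropy n"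
proof -
  have nonneg: "real n * 0 \<le> block_entropy n" for n
  proof -
    have "0 \<le> - measure \<mu> A * ln (measure \<mu> A)" for A
      using prob_le_1[of A] by (cases "measure \<mu> A = 0")
        (auto simp: mult_nonneg_nonpos measure_nonneg less_le intro!: mult_nonneg_nonpos)
    then show ?thesis by (simp only: mult_zero_right) (intro sum_nonneg, blast)
  qed
  obtain L where L: "(\<lambda>n. 1 / real n * block_entropy n) \<longlonglongrightarrow> L" "\<And>n. real n * L \<le> block_entropy n"
    using fekete[of block_entropy 0, OF block_entropy_subadditive nonneg] by blast
  then have "entropy_rate N \<mu> = L" unfolding entropy_rate_def by (intro limI)
  then show "(\<lambda>n. 1 / real n * block_entropy n) \<longlonglongrightarrow> entropy_rate N \<mu>" "real n * entropy_rate N \<mu> \<le> block_entropy n"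
    using L by simp_all
qed

end


section \<open>Potentials comparable to a finite family of ergodic measures\<close>

text \<open>
  The properties of the singular value function that determine its equilibrium states. The exponential
  lower bound by \<open>b\<close> keeps the Lyapunov exponent finite, and quasi-submultiplicativity makes
  it an infimum.
\<close>
locale gibbs_family =
  fixes N :: nat and V :: "'v set" and \<rho> :: "'v \<Rightarrow> real" and \<mu> :: "'v \<Rightarrow> (nat \<Rightarrow> nat) measure"
    and \<phi> :: "nat list \<Rightarrow> real" and b C K :: real
  assumes finite_V: "finite V" and V_nonempty: "V \<noteq> {}"
    and rho_pos: "v \<in> V \<Longrightarrow> 0 < \<rho> v"
    and inv_mu: "v \<in> V \<Longrightarrow> invariant_measure (\<mu> v) N"
    and erg_mu: "v \<in> V \<Longrightarrow> ergodic (\<mu> v)"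
    and C_pos: "0 < C" and b_pos: "0 < b" and K_ge: "1 \<le> K"
    and phi_ge: "w \<in> words N n \<Longrightarrow> b ^ n \<le> \<phi> w"
    and phi_submult: "u \<in> words N n \<Longrightarrow> w \<in> words N m \<Longrightarrow> \<phi> (u @ w) \<le> K * (\<phi> u * \<phi> w)"
    and mu_le_phi: "w \<in> words N n \<Longrightarrow> v \<in> V \<Longrightarrow> \<rho> v ^ n * mass N (\<mu> v) w \<le> C * \<phi> w"
    and phi_le_mu: "w \<in> words N n \<Longrightarrow> \<phi> w \<le> C * (\<Sum>v\<in>V. \<rho> v ^ n * mass N (\<mu> v) w)"
begin

definition \<rho>max :: real where "\<rho>max = Max (\<rho> ` V)"

definition Vmax :: "'v set" where "Vmax = {v \<in> V. \<rho> v = \<rho>max}"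

definition lyap :: "(nat \<Rightarrow> nat) measure \<Rightarrow> real" where
  "lyap \<nu> = lim (\<lambda>n. 1 / real n * (\<Sum>w\<in>words N n. mass N \<nu> w * ln (\<phi> w)))"

definition is_equilibrium :: "(nat \<Rightarrow> nat) measure \<Rightarrow> bool" where
  "is_equilibrium \<nu> \<longleftrightarrow> invariant_measure \<nu> N \<and>
    lim (\<lambda>n. 1 / real n * ln (\<Sum>w\<in>words N n. \<phi> w)) = entropy_rate N \<nu> + lyap \<nu>"

lemma phi_pos: "w \<in> words N n \<Longrightarrow> 0 < \<phi> w"
  using phi_ge[of w n] b_pos zero_less_power[of b n] by linarith

lemma rho_le: "v \<in> V \<Longrightarrow> \<rho> v \<le> \<rho>max"
  unfolding \<rho>max_def using finite_V by (intro Max_ge) auto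

lemma Vmax_nonempty: "Vmax \<noteq> {}"
proof -
  have "\<rho>max \<in> \<rho> ` V" unfolding \<rho>max_def using finite_V V_nonempty by (intro Max_in) auto
  then show ?thesis by (auto simp: Vmax_def)
qed

lemma rhomax_pos: "0 < \<rho>max"
proof -
  obtain v where "v \<in> V" "\<rho> v = \<rho>max" using Vmax_nonempty by (auto simp: Vmax_def)
  then show ?thesis using rho_pos[of v] by simp
qed

lemma card_V: "0 < card V"
  using finite_V V_nonempty by (simp add: card_gt_0_iff)

lemma sum_mu: "v \<in> V \<Longrightarrow> (\<Sum>w\<in>words N n. mass N (\<mu> v) w) = 1"
  by (rule full_shift_measure.sum_measure_cylinder[OF invariant_measure.axioms(1)[OF inv_mu]])

lemma partition_bounds:
  "\<rho>max ^ n \<le> C * (\<Sum>w\<in>words N n. \<phi> w)" "(\<Sum>w\<in>words N n. \<phi> w) \<le> C * real (card V) * \<rho>max ^ n"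
proof -
  obtain v where v: "v \<in> V" "\<rho> v = \<rho>max" using Vmax_nonempty by (auto simp: Vmax_def)
  have "\<rho>max ^ n = (\<Sum>w\<in>words N n. \<rho> v ^ n * mass N (\<mu> v) w)"
    using sum_mu[OF v(1)] v(2) by (simp add: sum_distrib_left[symmetric])
  also have "\<dots> \<le> (\<Sum>w\<in>words N n. C * \<phi> w)" by (intro sum_mono mu_le_phi v(1))
  finally show "\<rho>max ^ n \<le> C * (\<Sum>w\<in>words N n. \<phi> w)" by (simp add: sum_distrib_left)
  have "(\<Sum>w\<in>words N n. \<phi> w) \<le> (\<Sum>w\<in>words N n. C * (\<Sum>v\<in>V. \<rho> v ^ n * mass N (\<mu> v) w))"
    by (intro sum_mono phi_le_mu)
  also have "\<dots> = C * (\<Sum>v\<in>V. \<Sum>w\<in>words N n. \<rho> v ^ n * mass N (\<mu> v) w)"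
    unfolding sum_distrib_left[symmetric, where r = C] by (subst sum.swap) simp
  also have "\<dots> = C * (\<Sum>v\<in>V. \<rho> v ^ n)"
    by (intro arg_cong[of _ _ "(*) C"] sum.cong refl) (simp add: sum_distrib_left[symmetric] sum_mu)
  also have "\<dots> \<le> C * (\<Sum>v\<in>V. \<rho>max ^ n)"
    using C_pos rho_le rho_pos by (intro mult_left_mono sum_mono power_mono) (auto intro: less_imp_le)
  finally show "(\<Sum>w\<in>words N n. \<phi> w) \<le> C * real (card V) * \<rho>max ^ n" by simp
qed

lemma ln_partition_bounds:
  "real n * ln \<rho>max - ln C \<le> ln (\<Sum>w\<in>words N n. \<phi> w)"
  "ln (\<Sum>w\<in>words N n. \<phi> w) \<le> real n * ln \<rho>max + ln (C * real (card V))"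
proof -
  define Z where "Z = (\<Sum>w\<in>words N n. \<phi> w)"
  have "0 < \<rho>max ^ n" using rhomax_pos by simp
  then have Z: "0 < Z" using partition_bounds(1)[of n] C_pos unfolding Z_def[symmetric]
    by (metis less_le_trans mult_less_cancel_left_pos mult_zero_right)
  have "ln (\<rho>max ^ n) \<le> ln (C * Z)"
    using partition_bounds(1)[of n] rhomax_pos C_pos Z unfolding Z_def[symmetric] by (subst ln_le_cancel_iff) auto
  then show "real n * ln \<rho>max - ln C \<le> ln (\<Sum>w\<in>words N n. \<phi> w)"
    using rhomax_pos C_pos Z unfolding Z_def[symmetric] by (simp add: ln_mult ln_realpow)
  have "ln Z \<le> ln (C * real (card V) * \<rho>max ^ n)"
    using partition_bounds(2)[of n] rhomax_pos C_pos Z card_V unfolding Z_def[symmetric] by (subst ln_le_cancel_iff) auto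
  also have "\<dots> = real n * ln \<rho>max + ln (C * real (card V))"
    using rhomax_pos C_pos card_V by (subst ln_mult) (simp_all add: ln_realpow)
  finally show "ln (\<Sum>w\<in>words N n. \<phi> w) \<le> real n * ln \<rho>max + ln (C * real (card V))"
    unfolding Z_def .
qed

lemma pressure_limit: "(\<lambda>n. 1 / real n * ln (\<Sum>w\<in>words N n. \<phi> w)) \<longlonglongrightarrow> ln \<rho>max"
proof (rule lim_div_bounded_diff)
  show "(\<lambda>n. 1 / real n * (real n * ln \<rho>max)) \<longlonglongrightarrow> ln \<rho>max" by (rule lim_div_linear)
  show "\<bar>ln (\<Sum>w\<in>words N n. \<phi> w) - real n * ln \<rho>max\<bar> \<le> \<bar>ln C\<bar> + \<bar>ln (C * real (card V))\<bar>" for n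
    using ln_partition_bounds[of n] by linarith
qed

abbreviation block_lyap :: "(nat \<Rightarrow> nat) measure \<Rightarrow> nat \<Rightarrow> real" where
  "block_lyap \<nu> n \<equiv> (\<Sum>w\<in>words N n. mass N \<nu> w * ln (\<phi> w))"

lemma lyap_limit:
  assumes "invariant_measure \<nu> N"
  shows "(\<lambda>n. 1 / real n * block_lyap \<nu> n) \<longlonglongrightarrow> lyap \<nu>" "real n * lyap \<nu> \<le> block_lyap \<nu> n + ln K"
proof -
  interpret invariant_measure \<nu> N by fact
  define p where "p w = mass N \<nu> w" for w
  have p0: "0 \<le> p w" for w by (simp add: p_def)
  define a where "a n = block_lyap \<nu> n + ln K" for n
  have sub: "a (n + m) \<le> a n + a m" for n m
  proof -
    have "block_lyap \<nu> (n + m) = (\<Sum>u\<in>words N n. \<Sum>w\<in>words N m. p (u @ w) * ln (\<phi> (u @ w)))"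
      by (simp add: sum_words_add p_def)
    also have "\<dots> \<le> (\<Sum>u\<in>words N n. \<Sum>w\<in>words N m. p (u @ w) * (ln K + ln (\<phi> u) + ln (\<phi> w)))"
    proof (intro sum_mono mult_left_mono p0)
      fix u w assume uw: "u \<in> words N n" "w \<in> words N m"
      have pos: "0 < \<phi> u" "0 < \<phi> w" "0 < \<phi> (u @ w)" "0 < K"
        using phi_pos uw append_words[OF uw] K_ge by auto
      then have "ln (\<phi> (u @ w)) \<le> ln (K * (\<phi> u * \<phi> w))"
        using phi_submult[OF uw] by (subst ln_le_cancel_iff) auto
      also have "\<dots> = ln K + ln (\<phi> u) + ln (\<phi> w)" using pos by (simp add: ln_mult)
      finally show "ln (\<phi> (u @ w)) \<le> ln K + ln (\<phi> u) + ln (\<phi> w)" .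
    qed
    also have "\<dots> = (\<Sum>u\<in>words N n. \<Sum>w\<in>words N m. p (u @ w) * ln K)
        + (\<Sum>u\<in>words N n. \<Sum>w\<in>words N m. p (u @ w) * ln (\<phi> u))
        + (\<Sum>u\<in>words N n. \<Sum>w\<in>words N m. p (u @ w) * ln (\<phi> w))"
      by (simp add: algebra_simps sum.distrib)
    also have "(\<Sum>u\<in>words N n. \<Sum>w\<in>words N m. p (u @ w) * ln K) = ln K"
    proof -
      have "(\<Sum>u\<in>words N n. \<Sum>w\<in>words N m. p (u @ w) * ln K) = (\<Sum>v\<in>words N (n + m). p v) * ln K"
        by (simp add: sum_words_add sum_distrib_right)
      then show ?thesis unfolding p_def sum_measure_cylinder by simp
    qed
    also have "(\<Sum>u\<in>words N n. \<Sum>w\<in>words N m. p (u @ w) * ln (\<phi> u)) = block_lyap \<nu> n"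
      unfolding sum_distrib_right[symmetric]
      by (intro sum.cong refl) (simp add: p_def sum_measure_cylinder_append)
    also have "(\<Sum>u\<in>words N n. \<Sum>w\<in>words N m. p (u @ w) * ln (\<phi> w)) = block_lyap \<nu> m"
      by (subst sum.swap, unfold sum_distrib_right[symmetric], intro sum.cong refl)
         (simp add: p_def sum_measure_cylinder_prepend)
    finally show ?thesis by (simp add: a_def)
  qed
  have low: "real n * ln b \<le> a n" for n
  proof -
    have "real n * ln b = (\<Sum>w\<in>words N n. p w * (real n * ln b))"
      unfolding sum_distrib_right[symmetric] p_def sum_measure_cylinder by simp
    also have "\<dots> \<le> block_lyap \<nu> n"
      unfolding p_def[symmetric]
    proof (intro sum_mono mult_left_mono p0)
      fix w assume w: "w \<in> words N n"
      have "real n * ln b = ln (b ^ n)" using b_pos by (simp add: ln_realpow)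
      also have "\<dots> \<le> ln (\<phi> w)" using phi_ge[OF w] phi_pos[OF w] b_pos by (subst ln_le_cancel_iff) auto
      finally show "real n * ln b \<le> ln (\<phi> w)" .
    qed
    finally show ?thesis using ln_ge_zero[OF K_ge] by (simp add: a_def)
  qed
  obtain L where L: "(\<lambda>n. 1 / real n * a n) \<longlonglongrightarrow> L" "\<And>n. real n * L \<le> a n"
    using fekete[of a "ln b", OF sub low] by blast
  have "(\<lambda>n. 1 / real n * block_lyap \<nu> n) \<longlonglongrightarrow> L"
    by (rule lim_div_bounded_diff[OF L(1), of _ "\<bar>ln K\<bar>"]) (simp add: a_def)
  moreover from this have "lyap \<nu> = L" unfolding lyap_def by (rule limI)
  ultimately show "(\<lambda>n. 1 / real n * block_lyap \<nu> n) \<longlonglongrightarrow> lyap \<nu>" "real n * lyap \<nu> \<le> block_lyap \<nu> n + ln K"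
    using L(2)[of n] by (simp_all add: a_def)
qed

lemma is_equilibrium_iff:
  "is_equilibrium \<nu> \<longleftrightarrow> invariant_measure \<nu> N \<and> ln \<rho>max = entropy_rate N \<nu> + lyap \<nu>"
  unfolding is_equilibrium_def using limI[OF pressure_limit] by simp

lemma free_energy_eq:
  "(\<Sum>w\<in>words N n. - mass N \<nu> w * ln (mass N \<nu> w)) + block_lyap \<nu> n
    = (\<Sum>w\<in>words N n. mass N \<nu> w * (ln (\<phi> w) - ln (mass N \<nu> w)))"
  by (simp add: sum.distrib[symmetric] algebra_simps)

text \<open>
  The free energy of \<open>\<nu>\<close> at length \<open>n\<close> is at most the logarithm of the partition sum, by the Gibbs
  inequality against the normalised potential.
\<close>
lemma variational_inequality:
  assumes "invariant_measure \<nu> N"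
  shows "entropy_rate N \<nu> + lyap \<nu> \<le> ln \<rho>max"
proof -
  interpret invariant_measure \<nu> N by fact
  have le: "block_entropy n + block_lyap \<nu> n \<le> ln (\<Sum>w\<in>words N n. \<phi> w)" for n
  proof -
    define Z where "Z = (\<Sum>w\<in>words N n. \<phi> w)"
    define p where "p w = mass N \<nu> w" for w
    have sum_p: "(\<Sum>w\<in>words N n. p w) = 1" unfolding p_def by (rule sum_measure_cylinder)
    have "words N n \<noteq> {}" using sum_p by auto
    then have Z: "0 < Z" unfolding Z_def using phi_pos by (intro sum_pos) auto
    have "(\<Sum>w\<in>words N n. p w * (ln (\<phi> w / Z) - ln (p w))) \<le> (\<Sum>w\<in>words N n. \<phi> w / Z - p w)"
    proof (intro sum_mono gibbs_inequality_pointwise)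
      fix w assume w: "w \<in> words N n"
      show "0 \<le> p w" by (simp add: p_def)
      show "0 \<le> \<phi> w / Z" using phi_pos[OF w] Z by simp
      show "p w = 0" if "\<phi> w / Z = 0" using that phi_pos[OF w] Z by simp
    qed
    also have "\<dots> = 0" using Z sum_p by (simp add: sum_subtractf sum_divide_distrib[symmetric] Z_def[symmetric])
    also have "(\<Sum>w\<in>words N n. p w * (ln (\<phi> w / Z) - ln (p w)))
        = (\<Sum>w\<in>words N n. p w * (ln (\<phi> w) - ln (p w)) - p w * ln Z)"
    proof (rule sum.cong[OF refl])
      fix w assume "w \<in> words N n"
      then have "0 < \<phi> w" by (rule phi_pos)
      then have "ln (\<phi> w / Z) = ln (\<phi> w) - ln Z" using Z by (simp add: ln_div)
      then show "p w * (ln (\<phi> w / Z) - ln (p w)) = p w * (ln (\<phi> w) - ln (p w)) - p w * ln Z"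
        by (simp only:) (simp only: right_diff_distrib)
    qed
    also have "\<dots> = (\<Sum>w\<in>words N n. p w * (ln (\<phi> w) - ln (p w))) - ln Z"
      using sum_p by (simp add: sum_subtractf sum_distrib_right[symmetric])
    finally show ?thesis unfolding free_energy_eq p_def Z_def by simp
  qed
  have "(\<lambda>n. 1 / real n * block_entropy n + 1 / real n * block_lyap \<nu> n) \<longlonglongrightarrow> entropy_rate N \<nu> + lyap \<nu>"
    by (intro tendsto_add entropy_rate_limit lyap_limit assms)
  then show ?thesis
  proof (rule LIMSEQ_le[OF _ pressure_limit], intro exI[of _ 0] allI impI)
    fix n :: nat
    have "1 / real n * (block_entropy n + block_lyap \<nu> n) \<le> 1 / real n * ln (\<Sum>w\<in>words N n. \<phi> w)"
      using le by (intro mult_left_mono) auto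
    then show "1 / real n * block_entropy n + 1 / real n * block_lyap \<nu> n \<le> 1 / real n * ln (\<Sum>w\<in>words N n. \<phi> w)"
      by (simp only: distrib_left)
  qed
qed

text \<open>
  If \<open>\<rho> v = \<rho>max\<close>, the lower bound on the potential makes the free energy of \<open>\<mu> v\<close> at length \<open>n\<close> at
  least \<open>n * ln \<rho>max\<close> up to a constant.
\<close>
lemma equilibrium_mu:
  assumes v: "v \<in> Vmax"
  shows "is_equilibrium (\<mu> v)"
proof -
  have vV: "v \<in> V" and \<rho>v: "\<rho> v = \<rho>max" using v by (auto simp: Vmax_def)
  interpret invariant_measure "\<mu> v" N by (rule inv_mu[OF vV])
  have ge: "real n * ln \<rho>max - ln C \<le> block_entropy n + block_lyap (\<mu> v) n" for n
  proof -
    define p where "p w = mass N (\<mu> v) w" for w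
    have sum_p: "(\<Sum>w\<in>words N n. p w) = 1" unfolding p_def by (rule sum_measure_cylinder)
    have "real n * ln \<rho>max - ln C = (\<Sum>w\<in>words N n. p w * (real n * ln \<rho>max - ln C))"
      unfolding sum_distrib_right[symmetric] sum_p by simp
    also have "\<dots> \<le> (\<Sum>w\<in>words N n. p w * (ln (\<phi> w) - ln (p w)))"
    proof (rule sum_mono)
      fix w assume w: "w \<in> words N n"
      show "p w * (real n * ln \<rho>max - ln C) \<le> p w * (ln (\<phi> w) - ln (p w))"
      proof (cases "p w = 0")
        case False
        then have p: "0 < p w" using measure_nonneg[of "\<mu> v" "cylinder N w"] by (simp add: p_def less_le)
        have "ln (\<rho>max ^ n * p w) \<le> ln (C * \<phi> w)"
          using mu_le_phi[OF w vV] \<rho>v rhomax_pos p C_pos phi_pos[OF w]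
          by (subst ln_le_cancel_iff) (simp_all add: p_def)
        then have "real n * ln \<rho>max + ln (p w) \<le> ln C + ln (\<phi> w)"
          using rhomax_pos p C_pos phi_pos[OF w] by (simp add: ln_mult ln_realpow)
        then show ?thesis using p by (intro mult_left_mono) auto
      qed simp
    qed
    finally show ?thesis unfolding free_energy_eq p_def by simp
  qed
  have "(\<lambda>n. 1 / real n * (real n * ln \<rho>max - ln C)) \<longlonglongrightarrow> ln \<rho>max"
    by (rule lim_div_bounded_diff[OF lim_div_linear, where D = "\<bar>ln C\<bar>"]) simp
  moreover have "(\<lambda>n. 1 / real n * block_entropy n + 1 / real n * block_lyap (\<mu> v) n) \<longlonglongrightarrow> entropy_rate N (\<mu> v) + lyap (\<mu> v)"
    by (intro tendsto_add entropy_rate_limit lyap_limit invariant_measure_axioms)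
  ultimately have "ln \<rho>max \<le> entropy_rate N (\<mu> v) + lyap (\<mu> v)"
  proof (rule LIMSEQ_le, intro exI[of _ 0] allI impI)
    fix n :: nat
    have "1 / real n * (real n * ln \<rho>max - ln C) \<le> 1 / real n * (block_entropy n + block_lyap (\<mu> v) n)"
      using ge by (intro mult_left_mono) auto
    then show "1 / real n * (real n * ln \<rho>max - ln C) \<le> 1 / real n * block_entropy n + 1 / real n * block_lyap (\<mu> v) n"
      by (simp only: distrib_left)
  qed
  then show ?thesis
    unfolding is_equilibrium_iff using variational_inequality invariant_measure_axioms by force
qed

text \<open>
  For an equilibrium state the free energy at every length \<open>n\<close> is at least \<open>n * ln \<rho>max\<close> up to a
  constant, since block entropies and Lyapunov sums lie above their limits. Subtracting the
  potential bounds the relative entropy of \<open>\<nu>\<close> with respect to \<open>\<Sum>v. (\<rho> v / \<rho>max) ^ n * \<mu> v\<close>. A set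
  that carries only the mass \<open>t\<close> of the latter contributes at least \<open>ln (1 / t)\<close> times its \<open>\<nu>\<close>-mass, up to a
  constant, so it cannot have much mass for \<open>\<nu>\<close>.
\<close>
lemma equilibrium_entropy_bound:
  assumes eq: "is_equilibrium \<nu>" and t: "0 < t" "t \<le> 1" and U: "U \<subseteq> words N n"
    and small: "(\<Sum>w\<in>U. \<Sum>v\<in>V. (\<rho> v / \<rho>max) ^ n * mass N (\<mu> v) w) \<le> t"
  shows "(\<Sum>w\<in>U. mass N \<nu> w) * ln (1 / t) \<le> ln K + ln C + 1 + real (card V)"
proof -
  have inv: "invariant_measure \<nu> N" and P: "ln \<rho>max = entropy_rate N \<nu> + lyap \<nu>"
    using eq by (simp_all add: is_equilibrium_iff)
  interpret invariant_measure \<nu> N by fact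
  define p where "p w = mass N \<nu> w" for w
  have p0: "0 \<le> p w" for w by (simp add: p_def)
  have sum_p: "(\<Sum>w\<in>words N n. p w) = 1" unfolding p_def by (rule sum_measure_cylinder)
  define q where "q w = (\<Sum>v\<in>V. (\<rho> v / \<rho>max) ^ n * mass N (\<mu> v) w)" for w
  have phi_q: "\<phi> w \<le> C * \<rho>max ^ n * q w" if "w \<in> words N n" for w
    using phi_le_mu[OF that] rhomax_pos by (simp add: q_def sum_distrib_left power_divide)
  have q_pos: "0 < q w" if "w \<in> words N n" for w
  proof -
    have "0 < (C * \<rho>max ^ n) * q w" using phi_q[OF that] phi_pos[OF that] by linarith
    moreover have "0 < C * \<rho>max ^ n" using C_pos rhomax_pos by simp
    ultimately show ?thesis by (rule zero_less_mult_pos)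
  qed
  have sum_q: "(\<Sum>w\<in>words N n. q w) \<le> real (card V)"
  proof -
    have "(\<Sum>w\<in>words N n. q w) = (\<Sum>v\<in>V. (\<rho> v / \<rho>max) ^ n * (\<Sum>w\<in>words N n. mass N (\<mu> v) w))"
      unfolding q_def sum_distrib_left by (rule sum.swap)
    also have "\<dots> = (\<Sum>v\<in>V. (\<rho> v / \<rho>max) ^ n)" by (intro sum.cong refl) (simp add: sum_mu)
    also have "\<dots> \<le> (\<Sum>v\<in>V. 1)"
      using rho_le rho_pos rhomax_pos by (intro sum_mono power_le_one) (auto intro: less_imp_le divide_nonneg_pos)
    finally show ?thesis by simp
  qed
  have "real n * ln \<rho>max - ln K \<le> (\<Sum>w\<in>words N n. p w * (ln (\<phi> w) - ln (p w)))"
    using entropy_rate_limit(2)[of n] lyap_limit(2)[OF inv, of n] free_energy_eq[of \<nu> n]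
    unfolding p_def P by (simp add: algebra_simps)
  also have "\<dots> \<le> (\<Sum>w\<in>words N n. p w * (ln C + real n * ln \<rho>max) + p w * (ln (q w) - ln (p w)))"
  proof (rule sum_mono)
    fix w assume w: "w \<in> words N n"
    have "ln (\<phi> w) \<le> ln (C * \<rho>max ^ n * q w)"
      using phi_q[OF w] phi_pos[OF w] q_pos[OF w] C_pos rhomax_pos by (subst ln_le_cancel_iff) auto
    also have "\<dots> = ln C + real n * ln \<rho>max + ln (q w)"
      using q_pos[OF w] C_pos rhomax_pos by (simp add: ln_mult ln_realpow)
    finally have "p w * (ln (\<phi> w) - ln (p w)) \<le> p w * (ln C + real n * ln \<rho>max + (ln (q w) - ln (p w)))"
      using p0 by (intro mult_left_mono) auto
    then show "p w * (ln (\<phi> w) - ln (p w)) \<le> p w * (ln C + real n * ln \<rho>max) + p w * (ln (q w) - ln (p w))"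
      by (simp only: distrib_left)
  qed
  also have "\<dots> = ln C + real n * ln \<rho>max + (\<Sum>w\<in>words N n. p w * (ln (q w) - ln (p w)))"
    by (simp add: sum.distrib sum_distrib_right[symmetric] sum_p)
  finally have "- ln K - ln C \<le> (\<Sum>w\<in>words N n. p w * (ln (q w) - ln (p w)))" by simp
  also have "\<dots> = (\<Sum>w\<in>words N n - U. p w * (ln (q w) - ln (p w))) + (\<Sum>w\<in>U. p w * (ln (q w) - ln (p w)))"
    by (rule sum.subset_diff[OF U]) simp
  also have "(\<Sum>w\<in>words N n - U. p w * (ln (q w) - ln (p w))) \<le> real (card V)"
  proof -
    have "(\<Sum>w\<in>words N n - U. p w * (ln (q w) - ln (p w))) \<le> (\<Sum>w\<in>words N n - U. q w)"
    proof (rule sum_mono)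
      fix w assume "w \<in> words N n - U"
      then have "p w * (ln (q w) - ln (p w)) \<le> q w - p w"
        using q_pos[of w] p0 by (intro gibbs_inequality_pointwise) auto
      then show "p w * (ln (q w) - ln (p w)) \<le> q w" using p0[of w] by linarith
    qed
    also have "\<dots> \<le> (\<Sum>w\<in>words N n. q w)" using q_pos by (intro sum_mono2) (auto intro: less_imp_le)
    finally show ?thesis using sum_q by linarith
  qed
  also have "(\<Sum>w\<in>U. p w * (ln (q w) - ln (p w))) \<le> (\<Sum>w\<in>U. q w / t - p w * ln (1 / t))"
  proof (rule sum_mono)
    fix w assume "w \<in> U"
    then have w: "w \<in> words N n" using U by blast
    have "p w * (ln (q w / t) - ln (p w)) \<le> q w / t - p w"
      using q_pos[OF w] p0 t by (intro gibbs_inequality_pointwise) auto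
    moreover have "ln (q w / t) = ln (q w) + ln (1 / t)" using q_pos[OF w] t by (simp add: ln_div)
    ultimately show "p w * (ln (q w) - ln (p w)) \<le> q w / t - p w * ln (1 / t)"
      using p0[of w] by (simp add: algebra_simps)
  qed
  also have "\<dots> = (\<Sum>w\<in>U. q w) / t - (\<Sum>w\<in>U. p w) * ln (1 / t)"
    by (simp add: sum_subtractf sum_divide_distrib sum_distrib_right)
  also have "(\<Sum>w\<in>U. q w) / t \<le> 1" using small t by (simp add: q_def)
  finally show ?thesis unfolding p_def by simp
qed

text \<open>
  Suppose that \<open>B\<close> has mass \<open>\<delta> > 0\<close> for \<open>\<nu>\<close> but is null for the measures with maximal \<open>\<rho>\<close>.
  Approximate \<open>B\<close> by a union of cylinders, and rewrite that union at a length \<open>n\<close> so large that the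
  measures with smaller \<open>\<rho>\<close> are damped as well. This contradicts the entropy bound when \<open>t\<close> is small.
\<close>
lemma equilibrium_dominated:
  assumes eq: "is_equilibrium \<nu>"
  shows "dominated_measure N Vmax \<mu> \<nu>"
proof (rule dominated_measure.intro)
  show "finite Vmax" using finite_V by (simp add: Vmax_def)
  show "Vmax \<noteq> {}" by (rule Vmax_nonempty)
  show "invariant_measure (\<mu> v) N" if "v \<in> Vmax" for v using that inv_mu by (simp add: Vmax_def)
  show inv: "invariant_measure \<nu> N" using eq by (simp add: is_equilibrium_iff)
  interpret invariant_measure \<nu> N by (rule inv)
  define c where "c = ln K + ln C + 1 + real (card V)"
  fix B assume B: "B \<in> sigma_sets (full_shift N) (cyls N)"
    and null: "\<And>v. v \<in> Vmax \<Longrightarrow> measure (\<mu> v) B = 0"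
  show "measure \<nu> B = 0"
  proof (rule ccontr)
    assume "measure \<nu> B \<noteq> 0"
    define \<delta> where "\<delta> = measure \<nu> B"
    have \<delta>: "0 < \<delta>" using \<open>measure \<nu> B \<noteq> 0\<close> measure_nonneg[of \<nu> B] unfolding \<delta>_def by linarith
    \<comment> \<open>With this \<open>t\<close>, a set of \<open>\<nu>\<close>-mass at least \<open>\<delta> / 2\<close> contributes at least \<open>\<bar>c\<bar> + 1 > c\<close>.\<close>
    define t where "t = exp (- (2 * (\<bar>c\<bar> + 1) / \<delta>))"
    have t: "0 < t" "t \<le> 1" "ln (1 / t) = 2 * (\<bar>c\<bar> + 1) / \<delta>"
      using \<delta> by (simp_all add: t_def ln_div)
    \<comment> \<open>Each of the \<open>card V\<close> terms may contribute \<open>s\<close>.\<close>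
    define s where "s = t / real (card V)"
    have s: "0 < s" using t card_V by (simp add: s_def)
    define F where "F = insert \<nu> (\<mu> ` Vmax)"
    have F_inv: "invariant_measure M N" if "M \<in> F" for M
      using that inv inv_mu by (auto simp: F_def Vmax_def)
    have "\<exists>A\<in>cyls N. \<forall>M\<in>F. measure M (sym_diff A B) < min (\<delta> / 2) s"
    proof (rule cylinder_approximation[OF _ _ _ B])
      show "finite F" using finite_V by (simp add: F_def Vmax_def)
      show "0 < min (\<delta> / 2) s" using \<delta> s by simp
      fix M assume "M \<in> F"
      then interpret M: invariant_measure M N by (rule F_inv)
      show "finite_measure M" "sets M = sigma_sets (full_shift N) (cyls N)"
        by (rule M.finite_measure_axioms M.sets_eq)+
    qed
    then obtain A where A: "A \<in> cyls N" "\<And>M. M \<in> F \<Longrightarrow> measure M (sym_diff A B) < min (\<delta> / 2) s"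
      by blast
    have sym: "measure M (sym_diff A B) < min (\<delta> / 2) s \<and> A \<in> sets M \<and> B \<in> sets M \<and> sym_diff A B \<in> sets M"
      if "M \<in> F" for M
    proof -
      interpret M: invariant_measure M N by (rule F_inv[OF that])
      have "A \<in> sets M" "B \<in> sets M" using A(1) B by (auto simp: M.sets_eq)
      then show ?thesis using A(2)[OF that] by blast
    qed
    have \<nu>A: "\<delta> / 2 \<le> measure \<nu> A"
    proof -
      have S: "A \<in> sets \<nu>" "sym_diff A B \<in> sets \<nu>" "measure \<nu> (sym_diff A B) < \<delta> / 2"
        using sym[of \<nu>] by (auto simp: F_def)
      have "\<delta> \<le> measure \<nu> (A \<union> (sym_diff A B))"
        unfolding \<delta>_def by (intro finite_measure_mono sets.Un[OF S(1,2)]) blast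
      also have "\<dots> \<le> measure \<nu> A + measure \<nu> (sym_diff A B)"
        by (rule measure_Un_le[OF S(1,2)])
      finally show ?thesis using S(3) by linarith
    qed
    have \<mu>A: "measure (\<mu> v) A \<le> s" if v: "v \<in> Vmax" for v
    proof -
      have vV: "v \<in> V" using v by (simp add: Vmax_def)
      interpret M: invariant_measure "\<mu> v" N by (rule inv_mu[OF vV])
      have S: "B \<in> sets (\<mu> v)" "sym_diff A B \<in> sets (\<mu> v)" "measure (\<mu> v) (sym_diff A B) < s"
        using sym[of "\<mu> v"] v by (auto simp: F_def)
      have "measure (\<mu> v) A \<le> measure (\<mu> v) (B \<union> (sym_diff A B))"
        by (intro M.finite_measure_mono sets.Un[OF S(1,2)]) blast
      also have "\<dots> \<le> measure (\<mu> v) B + measure (\<mu> v) (sym_diff A B)"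
        by (rule measure_Un_le[OF S(1,2)])
      finally show ?thesis using S(3) null[OF v] by linarith
    qed
    have "\<forall>\<^sub>F n in sequentially. \<forall>v\<in>V - Vmax. (\<rho> v / \<rho>max) ^ n < s"
    proof (rule eventually_ball_finite)
      show "\<forall>v\<in>V - Vmax. \<forall>\<^sub>F n in sequentially. (\<rho> v / \<rho>max) ^ n < s"
      proof
        fix v assume "v \<in> V - Vmax"
        then have "0 < \<rho> v" "\<rho> v < \<rho>max" using rho_pos rho_le by (auto simp: Vmax_def less_le)
        then have "(\<lambda>n. (\<rho> v / \<rho>max) ^ n) \<longlonglongrightarrow> 0" by (intro LIMSEQ_realpow_zero) auto
        then show "\<forall>\<^sub>F n in sequentially. (\<rho> v / \<rho>max) ^ n < s" using s by (rule order_tendstoD(2))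
      qed
    qed (use finite_V in simp)
    then obtain n1 where n1: "\<And>n v. n \<ge> n1 \<Longrightarrow> v \<in> V - Vmax \<Longrightarrow> (\<rho> v / \<rho>max) ^ n < s"
      by (auto simp: eventually_sequentially)
    obtain n0 U0 where "A = cyl N n0 U0" using A(1) by (auto simp: cyls_def)
    then obtain n U where n: "n \<ge> n1" and AU: "A = cyl N n U"
      using cyl_extend[of n0 "max n0 n1" N U0] by (metis max.cobounded1 max.cobounded2)
    have "(\<Sum>w\<in>U \<inter> words N n. \<Sum>v\<in>V. (\<rho> v / \<rho>max) ^ n * mass N (\<mu> v) w)
        = (\<Sum>v\<in>V. (\<rho> v / \<rho>max) ^ n * measure (\<mu> v) A)"
    proof -
      have "(\<Sum>w\<in>U \<inter> words N n. mass N (\<mu> v) w) = measure (\<mu> v) A" if "v \<in> V" for v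
        unfolding AU by (rule full_shift_measure.measure_cyl[OF invariant_measure.axioms(1)[OF inv_mu[OF that]], symmetric])
      then show ?thesis by (subst sum.swap) (simp add: sum_distrib_left[symmetric])
    qed
    also have "\<dots> \<le> (\<Sum>v\<in>V. s)"
    proof (rule sum_mono)
      fix v assume v: "v \<in> V"
      interpret M: invariant_measure "\<mu> v" N by (rule inv_mu[OF v])
      have ratio: "0 \<le> \<rho> v / \<rho>max" "\<rho> v / \<rho>max \<le> 1"
        using rho_pos[OF v] rho_le[OF v] rhomax_pos by auto
      show "(\<rho> v / \<rho>max) ^ n * measure (\<mu> v) A \<le> s"
      proof (cases "v \<in> Vmax")
        case True
        have "(\<rho> v / \<rho>max) ^ n * measure (\<mu> v) A \<le> 1 * measure (\<mu> v) A"
          using ratio by (intro mult_right_mono power_le_one) auto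
        then show ?thesis using \<mu>A[OF True] by simp
      next
        case False
        have "(\<rho> v / \<rho>max) ^ n * measure (\<mu> v) A \<le> (\<rho> v / \<rho>max) ^ n * 1"
          using ratio M.prob_le_1 by (intro mult_left_mono) auto
        then show ?thesis using n1[OF n, of v] v False by simp
      qed
    qed
    also have "\<dots> = t" using card_V by (simp add: s_def)
    finally have "(\<Sum>w\<in>U \<inter> words N n. mass N \<nu> w) * ln (1 / t) \<le> c"
      unfolding c_def using t by (intro equilibrium_entropy_bound[OF eq]) auto
    then have "measure \<nu> A * (2 * (\<bar>c\<bar> + 1) / \<delta>) \<le> c" unfolding AU measure_cyl t(3) .
    moreover have "\<delta> / 2 * (2 * (\<bar>c\<bar> + 1) / \<delta>) \<le> measure \<nu> A * (2 * (\<bar>c\<bar> + 1) / \<delta>)"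
      using \<nu>A \<delta> by (intro mult_right_mono) auto
    moreover have "\<delta> / 2 * (2 * (\<bar>c\<bar> + 1) / \<delta>) = \<bar>c\<bar> + 1" using \<delta> by simp
    ultimately show False by linarith
  qed
qed

lemma equilibrium_decomposition:
  assumes "is_equilibrium \<nu>"
  obtains c v0 where "\<And>v. v \<in> Vmax \<Longrightarrow> 0 \<le> c v" "v0 \<in> Vmax" "0 < c v0"
    "\<And>B. B \<in> sigma_sets (full_shift N) (cyls N) \<Longrightarrow> measure \<nu> B = (\<Sum>v\<in>Vmax. c v * measure (\<mu> v) B)"
proof -
  interpret dominated_measure N Vmax \<mu> \<nu> by (rule equilibrium_dominated[OF assms])
  obtain c where c: "\<And>v. v \<in> Vmax \<Longrightarrow> 0 \<le> c v"
    "\<And>B. B \<in> sets \<nu> \<Longrightarrow> measure \<nu> B = (\<Sum>v\<in>Vmax. c v * measure (\<mu> v) B)"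
    using decomposition erg_mu by (auto simp: Vmax_def)
  have "\<exists>v\<in>Vmax. 0 < c v"
  proof (rule ccontr)
    assume "\<not> ?thesis"
    then have "c v = 0" if "v \<in> Vmax" for v using c(1)[OF that] that by force
    then have "measure \<nu> (space \<nu>) = 0" using c(2)[of "space \<nu>"] by simp
    then show False using nu.prob_space by simp
  qed
  then show ?thesis using that c unfolding nu.sets_eq by blast
qed

lemma equilibrium_fully_supported:
  assumes "is_equilibrium \<nu>"
    and pos: "\<And>v n w. v \<in> V \<Longrightarrow> w \<in> words N n \<Longrightarrow> 0 < mass N (\<mu> v) w"
  shows "fully_supported N \<nu>"
  unfolding fully_supported_def
proof (intro allI ballI)
  fix n w assume w: "w \<in> words N n"
  obtain c v0 where c: "\<And>v. v \<in> Vmax \<Longrightarrow> 0 \<le> c v" "v0 \<in> Vmax" "0 < c v0"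
    and dec: "\<And>B. B \<in> sigma_sets (full_shift N) (cyls N) \<Longrightarrow> measure \<nu> B = (\<Sum>v\<in>Vmax. c v * measure (\<mu> v) B)"
    using equilibrium_decomposition[OF assms(1)] by blast
  have "0 < c v0 * mass N (\<mu> v0) w" using c pos[OF _ w] by (simp add: Vmax_def)
  also have "\<dots> \<le> (\<Sum>v\<in>Vmax. c v * mass N (\<mu> v) w)"
    using c finite_V by (intro member_le_sum) (auto simp: Vmax_def)
  also have "\<dots> = mass N \<nu> w"
  proof (rule dec[symmetric])
    show "cylinder N w \<in> sigma_sets (full_shift N) (cyls N)"
      unfolding cylinder_eq_cyl[OF w] by (auto simp: cyls_def)
  qed
  finally show "0 < mass N \<nu> w" .
qed

text \<open>
  In the decomposition of an ergodic equilibrium state \<open>\<nu>\<close>, every \<open>\<mu> v0\<close> with a positive coefficient is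
  dominated by \<open>\<nu>\<close>. Decomposing \<open>\<mu> v0\<close> along the single ergodic measure \<open>\<nu>\<close> yields equality.
\<close>
lemma ergodic_equilibrium_iff: "is_equilibrium \<nu> \<and> ergodic \<nu> \<longleftrightarrow> \<nu> \<in> \<mu> ` Vmax"
proof
  assume "\<nu> \<in> \<mu> ` Vmax"
  then show "is_equilibrium \<nu> \<and> ergodic \<nu>" using equilibrium_mu erg_mu by (auto simp: Vmax_def)
next
  assume \<nu>: "is_equilibrium \<nu> \<and> ergodic \<nu>"
  then interpret nu: invariant_measure \<nu> N by (simp add: is_equilibrium_iff)
  obtain c v0 where c: "\<And>v. v \<in> Vmax \<Longrightarrow> 0 \<le> c v" "v0 \<in> Vmax" "0 < c v0"
    and dec: "\<And>B. B \<in> sigma_sets (full_shift N) (cyls N) \<Longrightarrow> measure \<nu> B = (\<Sum>v\<in>Vmax. c v * measure (\<mu> v) B)"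
    using equilibrium_decomposition \<nu> by blast
  have v0: "v0 \<in> V" using c(2) by (simp add: Vmax_def)
  interpret M: invariant_measure "\<mu> v0" N by (rule inv_mu[OF v0])
  interpret D: dominated_measure N "{()}" "\<lambda>_. \<nu>" "\<mu> v0"
  proof (rule dominated_measure.intro)
    fix B assume B: "B \<in> sigma_sets (full_shift N) (cyls N)" and "\<And>u. u \<in> {()} \<Longrightarrow> measure \<nu> B = 0"
    then have "(\<Sum>v\<in>Vmax. c v * measure (\<mu> v) B) = 0" using dec[OF B] by simp
    moreover have "c v0 * measure (\<mu> v0) B \<le> (\<Sum>v\<in>Vmax. c v * measure (\<mu> v) B)"
      using c finite_V by (intro member_le_sum) (auto simp: Vmax_def)
    ultimately have "c v0 * measure (\<mu> v0) B \<le> 0" by simp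
    then show "measure (\<mu> v0) B = 0" using c(3) measure_nonneg[of "\<mu> v0" B] by (simp add: mult_le_0_iff)
  qed (simp_all add: nu.invariant_measure_axioms M.invariant_measure_axioms)
  obtain e where e: "\<And>B. B \<in> sets (\<mu> v0) \<Longrightarrow> measure (\<mu> v0) B = (\<Sum>u\<in>{()}. e u * measure \<nu> B)"
    using D.decomposition \<nu> by metis
  have "measure (\<mu> v0) (space (\<mu> v0)) = e () * measure \<nu> (space \<nu>)"
    using e[OF sets.top] unfolding M.space_eq nu.space_eq by simp
  then have "e () = 1" unfolding M.prob_space nu.prob_space by simp
  then have "measure (\<mu> v0) B = measure \<nu> B" if "B \<in> sets (\<mu> v0)" for B using e[OF that] by simp
  then have "\<mu> v0 = \<nu>"
    by (intro measure_eqI) (simp_all add: M.sets_eq nu.sets_eq M.emeasure_eq_measure nu.emeasure_eq_measure)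
  then show "\<nu> \<in> \<mu> ` Vmax" using c(2) by blast
qed

end

text \<open>
  The measures are indexed by points and not by orbits, so several points of an orbit may carry the
  same measure. This is harmless for an upper bound, and it avoids choosing representatives.
\<close>
lemma (in letter_system) exists_gibbs_family:
  fixes \<phi> :: "nat list \<Rightarrow> real"
  assumes cocycle_le: "\<And>n w v. w \<in> words N n \<Longrightarrow> v \<in> V \<Longrightarrow> cocycle p W w v \<le> \<phi> w"
    and le_sum: "\<And>n w. w \<in> words N n \<Longrightarrow> \<phi> w \<le> (\<Sum>v\<in>V. cocycle p W w v)"
  obtains \<rho> \<mu> b C K where "gibbs_family N V \<rho> \<mu> \<phi> b C K"
    "\<And>v n w. v \<in> V \<Longrightarrow> w \<in> words N n \<Longrightarrow> 0 < mass N (\<mu> v) w"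
    "\<And>v a. v \<in> V \<Longrightarrow> (\<And>b. b \<in> {1..N} \<Longrightarrow> p b v = v) \<Longrightarrow> a \<in> {1..N} \<Longrightarrow>
      \<rho> v = (\<Sum>a\<in>{1..N}. W a v) \<and> mass N (\<mu> v) [a] = W a v / \<rho> v"
proof -
  define good where "good v r m c \<longleftrightarrow> 0 < r \<and> 0 < c \<and> invariant_measure m N \<and> ergodic m \<and>
    (\<forall>n. \<forall>w\<in>words N n. \<forall>u\<in>orbit v. cocycle p W w u \<le> c * (r ^ n * mass N m w)) \<and>
    (\<forall>n. \<forall>w\<in>words N n. r ^ n * mass N m w \<le> c * (\<Sum>u\<in>orbit v. cocycle p W w u)) \<and>
    (orbit v = {v} \<longrightarrow> (\<forall>a\<in>{1..N}. r = (\<Sum>a\<in>{1..N}. W a v) \<and> mass N m [a] = W a v / r))"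
    for v and r c :: real and m :: "(nat \<Rightarrow> nat) measure"
  have "\<exists>r m c. good v r m c" if v: "v \<in> V" for v
  proof -
    interpret O: transitive_letter_system N "orbit v" p W by (rule transitive_orbit[OF v])
    show ?thesis
    proof (rule O.gibbs_measure_properties, goal_cases)
      case (1 r m c)
      then have "good v r m c" unfolding good_def by (intro conjI ballI allI impI) (simp_all only:)
      then show ?case by blast
    qed
  qed
  then obtain \<rho> \<mu> c where good: "\<And>v. v \<in> V \<Longrightarrow> good v (\<rho> v) (\<mu> v) (c v)" by metis
  define C where "C = (\<Sum>v\<in>V. c v) * real (card V)"
  have card: "1 \<le> real (card V)" using finite_V V_nonempty by (simp add: Suc_le_eq card_gt_0_iff)
  have c_pos: "0 < c v" if "v \<in> V" for v using good[OF that] by (simp add: good_def)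
  have sum_c: "0 < (\<Sum>v\<in>V. c v)" using c_pos finite_V V_nonempty by (intro sum_pos) auto
  have c_sum: "c v \<le> (\<Sum>v\<in>V. c v)" if "v \<in> V" for v
    using that c_pos finite_V by (intro member_le_sum) (auto intro: less_imp_le)
  have c_le: "c v \<le> C" "c v * real (card V) \<le> C" if "v \<in> V" for v
  proof -
    show "c v * real (card V) \<le> C" unfolding C_def using c_sum[OF that] by (rule mult_right_mono) simp
    moreover have "c v * 1 \<le> c v * real (card V)" using card c_pos[OF that] by (intro mult_left_mono) auto
    ultimately show "c v \<le> C" by simp
  qed
  have C_pos: "0 < C" using sum_c card by (simp add: C_def)
  define b where "b = Min ((\<lambda>(a, v). W a v) ` ({1..N} \<times> V))"
  have fin: "finite ((\<lambda>(a, v). W a v) ` ({1..N} \<times> V))" using finite_V by simp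
  have "{1..N} \<times> V \<noteq> {}" using letters V_nonempty by auto
  then have b_pos: "0 < b" unfolding b_def using W_pos by (subst Min_gr_iff[OF fin]) auto
  have b_le: "b \<le> W a v" if "a \<in> {1..N}" "v \<in> V" for a v
    unfolding b_def using that by (intro Min_le[OF fin] image_eqI[of _ _ "(a, v)"]) auto
  have cocycle_ge: "b ^ length w \<le> cocycle p W w v" if "w \<in> words N n" and v: "v \<in> V" for w n v
    using that(1)
  proof (induction w rule: words_induct)
    case (Cons a w n)
    have "b * b ^ length w \<le> W a (act p w v) * cocycle p W w v"
      using b_le[OF Cons(1) act_in[OF Cons(2) v]] Cons.IH b_pos by (intro mult_mono) auto
    then show ?case by simp
  qed simp
  have gibbs: "gibbs_family N V \<rho> \<mu> \<phi> b C (real (card V))"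
  proof (rule gibbs_family.intro)
    fix v assume v: "v \<in> V"
    show "0 < \<rho> v" "invariant_measure (\<mu> v) N" "ergodic (\<mu> v)" using good[OF v] by (simp_all add: good_def)
  next
    fix w n assume w: "w \<in> words N n"
    obtain v where v: "v \<in> V" using V_nonempty by blast
    show "b ^ n \<le> \<phi> w"
      using cocycle_ge[OF w v] cocycle_le[OF w v] length_words[OF w] by simp
    have pos: "0 \<le> \<phi> w" using cocycle_pos[OF w v] cocycle_le[OF w v] by linarith
    have M0: "0 \<le> \<rho> v ^ n * mass N (\<mu> v) w" if "v \<in> V" for v
      using good[OF that] by (simp add: good_def)
    show "\<rho> v ^ n * mass N (\<mu> v) w \<le> C * \<phi> w" if v: "v \<in> V" for v
    proof -
      have "\<rho> v ^ n * mass N (\<mu> v) w \<le> c v * (\<Sum>u\<in>orbit v. cocycle p W w u)"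
        using good[OF v] w by (simp add: good_def)
      also have "\<dots> \<le> c v * (\<Sum>u\<in>V. \<phi> w)"
      proof (intro mult_left_mono)
        have "(\<Sum>u\<in>orbit v. cocycle p W w u) \<le> (\<Sum>u\<in>V. cocycle p W w u)"
          using finite_V orbit_subset[OF v] cocycle_pos[OF w] by (intro sum_mono2) (auto intro: less_imp_le)
        also have "\<dots> \<le> (\<Sum>u\<in>V. \<phi> w)" by (intro sum_mono cocycle_le[OF w])
        finally show "(\<Sum>u\<in>orbit v. cocycle p W w u) \<le> (\<Sum>u\<in>V. \<phi> w)" .
      qed (use c_pos[OF v] in simp)
      also have "\<dots> = c v * real (card V) * \<phi> w" by simp
      also have "\<dots> \<le> C * \<phi> w" using c_le(2)[OF v] pos by (rule mult_right_mono)
      finally show ?thesis .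
    qed
    show "\<phi> w \<le> C * (\<Sum>v\<in>V. \<rho> v ^ n * mass N (\<mu> v) w)"
    proof -
      have "\<phi> w \<le> (\<Sum>v\<in>V. cocycle p W w v)" by (rule le_sum[OF w])
      also have "\<dots> \<le> (\<Sum>v\<in>V. C * (\<rho> v ^ n * mass N (\<mu> v) w))"
      proof (rule sum_mono)
        fix v assume v: "v \<in> V"
        have "cocycle p W w v \<le> c v * (\<rho> v ^ n * mass N (\<mu> v) w)"
          using good[OF v] w self_in_orbit[of v] by (simp add: good_def)
        also have "\<dots> \<le> C * (\<rho> v ^ n * mass N (\<mu> v) w)"
          using c_le(1)[OF v] M0[OF v] by (rule mult_right_mono)
        finally show "cocycle p W w v \<le> C * (\<rho> v ^ n * mass N (\<mu> v) w)" .
      qed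
      finally show ?thesis by (simp add: sum_distrib_left)
    qed
  next
    fix u w n m assume u: "u \<in> words N n" and w: "w \<in> words N m"
    have "\<phi> (u @ w) \<le> (\<Sum>v\<in>V. cocycle p W (u @ w) v)" by (rule le_sum[OF append_words[OF u w]])
    also have "\<dots> \<le> (\<Sum>v\<in>V. \<phi> u * \<phi> w)"
      unfolding cocycle_append
    proof (intro sum_mono mult_mono)
      fix v assume v: "v \<in> V"
      show "cocycle p W u (act p w v) \<le> \<phi> u" by (rule cocycle_le[OF u act_in[OF w v]])
      then show "0 \<le> \<phi> u" using cocycle_pos[OF u act_in[OF w v]] by linarith
      show "cocycle p W w v \<le> \<phi> w" "0 \<le> cocycle p W w v"
        using cocycle_le[OF w v] cocycle_pos[OF w v] by simp_all
    qed
    finally show "\<phi> (u @ w) \<le> real (card V) * (\<phi> u * \<phi> w)" by simp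
  qed (use finite_V V_nonempty C_pos b_pos card in simp_all)
  moreover have "0 < mass N (\<mu> v) w" if v: "v \<in> V" and w: "w \<in> words N n" for v w n
  proof -
    have "cocycle p W w v \<le> c v * (\<rho> v ^ n * mass N (\<mu> v) w)"
      using good[OF v] w self_in_orbit[of v] by (simp add: good_def)
    then have "mass N (\<mu> v) w \<noteq> 0" using cocycle_pos[OF w v] by auto
    then show ?thesis using measure_nonneg[of "\<mu> v" "cylinder N w"] by linarith
  qed
  moreover have "\<rho> v = (\<Sum>a\<in>{1..N}. W a v) \<and> mass N (\<mu> v) [a] = W a v / \<rho> v"
    if v: "v \<in> V" and fixed: "\<And>b. b \<in> {1..N} \<Longrightarrow> p b v = v" and a: "a \<in> {1..N}" for v a
  proof -
    have "act p w v = v" if "w \<in> words N n" for w n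
      using that by (induction w rule: words_induct) (use fixed in \<open>simp_all del: atLeastAtMost_iff\<close>)
    then have "orbit v \<subseteq> {v}" by (auto simp: orbit_def)
    then have "orbit v = {v}" using self_in_orbit[of v] by blast
    then show ?thesis using good[OF v] a unfolding good_def by blast
  qed
  ultimately show ?thesis by (rule that)
qed

section \<open>Generalised permutation matrices\<close>

text \<open>
  Only the absolute values of the entries matter, since singular values do not see signs.
\<close>
definition monomial_mat :: "nat \<Rightarrow> (nat \<Rightarrow> nat) \<Rightarrow> (nat \<Rightarrow> real) \<Rightarrow> real mat \<Rightarrow> bool" where
  "monomial_mat d \<pi> c A \<longleftrightarrow> A \<in> carrier_mat d d \<and> bij_betw \<pi> {..<d} {..<d} \<and> (\<forall>j<d. 0 < c j) \<and>
     (\<forall>i<d. \<forall>j<d. \<bar>A $$ (i, j)\<bar> = (if i = \<pi> j then c j else 0))"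

lemma gen_perm_mats_imp_monomial:
  assumes A: "A \<in> gen_perm_mats d"
  obtains \<pi> c where "monomial_mat d \<pi> c A"
proof -
  have rows: "\<exists>!j. j < d \<and> A $$ (i, j) \<noteq> 0" if "i < d" for i using A that by (simp add: gen_perm_mats_def)
  have cols: "\<exists>!i. i < d \<and> A $$ (i, j) \<noteq> 0" if "j < d" for j using A that by (simp add: gen_perm_mats_def)
  define \<pi> where "\<pi> j = (THE i. i < d \<and> A $$ (i, j) \<noteq> 0)" for j
  have \<pi>: "\<pi> j < d" "A $$ (\<pi> j, j) \<noteq> 0" if "j < d" for j
    using theI'[OF cols[OF that]] unfolding \<pi>_def by blast+
  have \<pi>_unique: "i = \<pi> j" if "i < d" "j < d" "A $$ (i, j) \<noteq> 0" for i j
    using cols[OF that(2)] \<pi>[OF that(2)] that by blast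
  have carrier: "A \<in> carrier_mat d d" using A by (simp add: gen_perm_mats_def)
  have \<pi>_pos: "0 < \<bar>A $$ (\<pi> j, j)\<bar>" if "j < d" for j using \<pi>(2)[OF that] by simp
  have "inj_on \<pi> {..<d}"
  proof (rule inj_onI)
    fix j j' assume j: "j \<in> {..<d}" "j' \<in> {..<d}" "\<pi> j = \<pi> j'"
    then have "j < d" "j' < d" by simp_all
    moreover have "A $$ (\<pi> j, j) \<noteq> 0" "A $$ (\<pi> j, j') \<noteq> 0" using \<pi>[of j] \<pi>[of j'] j by simp_all
    ultimately show "j = j'" using rows[OF \<pi>(1)[of j]] by blast
  qed
  moreover have "\<pi> ` {..<d} \<subseteq> {..<d}" using \<pi> by auto
  ultimately have "bij_betw \<pi> {..<d} {..<d}" by (simp add: bij_betw_def endo_inj_surj)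
  moreover have "\<bar>A $$ (i, j)\<bar> = (if i = \<pi> j then \<bar>A $$ (\<pi> j, j)\<bar> else 0)" if "i < d" "j < d" for i j
    using \<pi>_unique[OF that] by auto
  ultimately have "monomial_mat d \<pi> (\<lambda>j. \<bar>A $$ (\<pi> j, j)\<bar>) A"
    using carrier \<pi>_pos unfolding monomial_mat_def by blast
  then show ?thesis by (rule that)
qed

lemma monomial_imp_gen_perm_mats:
  assumes "monomial_mat d \<pi> c A"
  shows "A \<in> gen_perm_mats d"
proof -
  have A: "A \<in> carrier_mat d d" and bij: "bij_betw \<pi> {..<d} {..<d}" and c: "\<And>j. j < d \<Longrightarrow> 0 < c j"
    and ent: "\<And>i j. i < d \<Longrightarrow> j < d \<Longrightarrow> \<bar>A $$ (i, j)\<bar> = (if i = \<pi> j then c j else 0)"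
    using assms by (simp_all add: monomial_mat_def)
  have nz: "A $$ (i, j) \<noteq> 0 \<longleftrightarrow> i = \<pi> j" if "i < d" "j < d" for i j
    using ent[OF that] c[OF that(2)] by (auto split: if_splits)
  have \<pi>: "\<pi> j < d" if "j < d" for j using bij_betwE[OF bij] that by auto
  have "\<exists>!j. j < d \<and> A $$ (i, j) \<noteq> 0" if i: "i < d" for i
  proof -
    have "i \<in> \<pi> ` {..<d}" using bij i by (simp add: bij_betw_def)
    then obtain j where j: "i = \<pi> j" "j \<in> {..<d}" by (rule imageE)
    show ?thesis
    proof (rule ex1I[of _ j])
      show "j < d \<and> A $$ (i, j) \<noteq> 0" using nz[OF i] j by simp
      fix j' assume j': "j' < d \<and> A $$ (i, j') \<noteq> 0"
      then have "i = \<pi> j'" using nz[OF i, of j'] by blast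
      then have "\<pi> j' = \<pi> j" using j(1) by (rule subst)
      then show "j' = j"
        by (rule inj_onD[OF bij_betw_imp_inj_on[OF bij]]) (simp add: j', rule j(2))
    qed
  qed
  moreover have "\<exists>!i. i < d \<and> A $$ (i, j) \<noteq> 0" if j: "j < d" for j
    using nz[OF _ j] \<pi>[OF j] by (intro ex1I[of _ "\<pi> j"]) auto
  ultimately show ?thesis using A by (simp add: gen_perm_mats_def)
qed

lemma monomial_mat_mult:
  assumes A: "monomial_mat d \<pi> c A" and B: "monomial_mat d \<pi>' c' B"
  shows "monomial_mat d (\<lambda>j. \<pi> (\<pi>' j)) (\<lambda>j. c (\<pi>' j) * c' j) (A * B)"
proof -
  have cA: "A \<in> carrier_mat d d" and cB: "B \<in> carrier_mat d d"
    and bA: "bij_betw \<pi> {..<d} {..<d}" and bB: "bij_betw \<pi>' {..<d} {..<d}"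
    using A B by (simp_all add: monomial_mat_def)
  have \<pi>': "\<pi>' j < d" if "j < d" for j using bij_betwE[OF bB] that by auto
  have "\<bar>(A * B) $$ (i, j)\<bar> = (if i = \<pi> (\<pi>' j) then c (\<pi>' j) * c' j else 0)" if ij: "i < d" "j < d" for i j
  proof -
    have "(A * B) $$ (i, j) = (\<Sum>k\<in>{0..<d}. A $$ (i, k) * B $$ (k, j))"
      using cA cB ij by (simp add: scalar_prod_def)
    also have "\<dots> = (\<Sum>k\<in>{0..<d}. if k = \<pi>' j then A $$ (i, \<pi>' j) * B $$ (\<pi>' j, j) else 0)"
    proof (rule sum.cong[OF refl])
      fix k assume k: "k \<in> {0..<d}"
      show "A $$ (i, k) * B $$ (k, j) = (if k = \<pi>' j then A $$ (i, \<pi>' j) * B $$ (\<pi>' j, j) else 0)"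
      proof (cases "k = \<pi>' j")
        case False
        then have "\<bar>B $$ (k, j)\<bar> = 0" using B k ij by (simp add: monomial_mat_def)
        then show ?thesis using False by simp
      qed simp
    qed
    also have "\<dots> = A $$ (i, \<pi>' j) * B $$ (\<pi>' j, j)" using \<pi>'[OF ij(2)] by simp
    finally show ?thesis
      using A B ij \<pi>'[OF ij(2)] by (simp add: monomial_mat_def abs_mult)
  qed
  moreover have "bij_betw (\<lambda>j. \<pi> (\<pi>' j)) {..<d} {..<d}"
    using bij_betw_trans[OF bB bA] by (simp add: comp_def)
  ultimately show ?thesis
    using A B \<pi>' mult_carrier_mat[OF cA cB] by (simp add: monomial_mat_def)
qed

lemma monomial_mat_one: "monomial_mat d (\<lambda>j. j) (\<lambda>j. 1) (1\<^sub>m d)"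
  by (auto simp: monomial_mat_def bij_betw_def)

lemma monomial_word_mat:
  assumes "\<And>a. a \<in> {1..N} \<Longrightarrow> monomial_mat d (\<pi> a) (c a) (A a)" and "w \<in> words N n"
  shows "monomial_mat d (act \<pi> w) (cocycle \<pi> c w) (word_mat d A w)"
  using assms(2)
proof (induction w rule: words_induct)
  case Nil
  have "act \<pi> [] = (\<lambda>j. j)" "cocycle \<pi> c [] = (\<lambda>j. 1)" by auto
  then show ?case using monomial_mat_one by (simp add: word_mat_def)
next
  case (Cons a w n)
  have "act \<pi> (a # w) = (\<lambda>j. \<pi> a (act \<pi> w j))"
    "cocycle \<pi> c (a # w) = (\<lambda>j. c a (act \<pi> w j) * cocycle \<pi> c w j)"
    "word_mat d A (a # w) = A a * word_mat d A w"
    by (auto simp: word_mat_def)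
  then show ?case using monomial_mat_mult[OF assms(1)[OF Cons(1)] Cons.IH] by simp
qed


section \<open>The singular value function of a monomial matrix\<close>

text \<open>
  The columns are orthogonal, so \<open>A\<^sup>T A\<close> is diagonal with the squares of the column weights.
\<close>
lemma singular_values_monomial:
  assumes "monomial_mat d \<pi> c A"
  shows "singular_values A = rev (sort (map c [0..<d]))"
proof -
  have A: "A \<in> carrier_mat d d" and bij: "bij_betw \<pi> {..<d} {..<d}" and c: "\<And>j. j < d \<Longrightarrow> 0 < c j"
    and ent: "\<And>i j. i < d \<Longrightarrow> j < d \<Longrightarrow> \<bar>A $$ (i, j)\<bar> = (if i = \<pi> j then c j else 0)"
    using assms by (simp_all add: monomial_mat_def)
  have \<pi>: "\<pi> j < d" if "j < d" for j using bij_betwE[OF bij] that by auto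
  define G where "G = transpose_mat A * A"
  have G: "G \<in> carrier_mat d d" using A by (simp add: G_def)
  have G_ent: "G $$ (i, j) = (if i = j then (c j)\<^sup>2 else 0)" if ij: "i < d" "j < d" for i j
  proof -
    have zero: "A $$ (k, j) = 0" if "k < d" "k \<noteq> \<pi> j" for k using ent[OF that(1) ij(2)] that(2) by simp
    have zero': "A $$ (k, i) = 0" if "k < d" "k \<noteq> \<pi> i" for k using ent[OF that(1) ij(1)] that(2) by simp
    have "G $$ (i, j) = (\<Sum>k\<in>{0..<d}. A $$ (k, i) * A $$ (k, j))"
      using A ij by (simp add: G_def scalar_prod_def)
    also have "\<dots> = (\<Sum>k\<in>{0..<d}. if k = \<pi> j then A $$ (\<pi> j, i) * A $$ (\<pi> j, j) else 0)"
      using zero by (intro sum.cong refl) auto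
    also have "\<dots> = A $$ (\<pi> j, i) * A $$ (\<pi> j, j)" using \<pi>[OF ij(2)] by simp
    also have "\<dots> = (if i = j then (c j)\<^sup>2 else 0)"
    proof (cases "i = j")
      case True
      have "A $$ (\<pi> j, j) * A $$ (\<pi> j, j) = \<bar>A $$ (\<pi> j, j)\<bar>\<^sup>2" by (simp add: power2_eq_square)
      then show ?thesis using True ent[OF \<pi>[OF ij(2)] ij(2)] by simp
    next
      case False
      then have "\<pi> j \<noteq> \<pi> i" using inj_onD[OF bij_betw_imp_inj_on[OF bij], of j i] ij by auto
      then show ?thesis using zero'[OF \<pi>[OF ij(2)]] False by simp
    qed
    finally show ?thesis .
  qed
  have "upper_triangular G" using G G_ent by (auto simp: upper_triangular_def)
  then have "char_poly G = (\<Prod>a\<leftarrow>diag_mat G. [:- a, 1:])" by (rule char_poly_upper_triangular[OF G])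
  also have "diag_mat G = map (\<lambda>j. (c j)\<^sup>2) [0..<d]"
    using G G_ent by (auto simp: diag_mat_def)
  finally have "proots (char_poly G) = proots (\<Prod>a\<leftarrow>map (\<lambda>j. (c j)\<^sup>2) [0..<d]. [:- a, 1:])" by simp
  also have "proots (\<Prod>a\<leftarrow>xs. [:- a, 1:]) = mset xs" for xs :: "real list"
  proof (induction xs)
    case (Cons x xs)
    have "(\<Prod>a\<leftarrow>xs. [:- a, 1:]) \<noteq> 0" by (auto simp: prod_list_zero_iff)
    then have "proots ([:- x, 1:] * (\<Prod>a\<leftarrow>xs. [:- a, 1:])) = {#x#} + mset xs"
      using Cons by (subst proots_mult) simp_all
    then show ?case by (simp only: list.map prod_list.Cons mset.simps) simp
  qed simp
  finally have "image_mset sqrt (proots (char_poly G)) = mset (map (\<lambda>j. sqrt ((c j)\<^sup>2)) [0..<d])"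
    by (simp add: mset_map multiset.map_comp comp_def del: real_sqrt_abs)
  also have "map (\<lambda>j. sqrt ((c j)\<^sup>2)) [0..<d] = map c [0..<d]"
    using c by (intro map_cong refl) (simp add: abs_of_pos)
  finally show ?thesis
    unfolding singular_values_def G_def[symmetric] by (simp only: sorted_list_of_multiset_mset)
qed

text \<open>
  Split off the largest index of \<open>T\<close>: it is at least \<open>card T - 1\<close>, so its factor is at most the last
  factor on the right.
\<close>
lemma prod_le_prod_initial:
  fixes \<alpha> :: "nat \<Rightarrow> real"
  assumes pos: "\<And>j. j < d \<Longrightarrow> 0 < \<alpha> j" and dec: "\<And>i j. i \<le> j \<Longrightarrow> j < d \<Longrightarrow> \<alpha> j \<le> \<alpha> i"
    and "T \<subseteq> {..<d}" "card T = k"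
  shows "(\<Prod>j\<in>T. \<alpha> j) \<le> (\<Prod>j<k. \<alpha> j)"
  using assms(3,4)
proof (induction k arbitrary: T)
  case 0
  then have "T = {}" using finite_subset[of T "{..<d}"] by simp
  then show ?case by simp
next
  case (Suc k)
  have fin: "finite T" using Suc.prems(1) by (rule finite_subset) simp
  define m where "m = Max T"
  have "T \<noteq> {}" using Suc.prems(2) by auto
  then have m: "m \<in> T" unfolding m_def using fin by (intro Max_in)
  have "T \<subseteq> {..m}" unfolding m_def using fin by auto
  then have "card T \<le> card {..m}" by (intro card_mono) auto
  then have km: "k \<le> m" using Suc.prems(2) by simp
  have md: "m < d" using m Suc.prems(1) by auto
  have "(\<Prod>j\<in>T. \<alpha> j) = (\<Prod>j\<in>T - {m}. \<alpha> j) * \<alpha> m"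
    using prod.remove[OF fin m, of \<alpha>] by (simp add: mult.commute)
  also have "\<dots> \<le> (\<Prod>j<k. \<alpha> j) * \<alpha> k"
  proof (rule mult_mono)
    show "(\<Prod>j\<in>T - {m}. \<alpha> j) \<le> (\<Prod>j<k. \<alpha> j)"
      using Suc.prems m fin by (intro Suc.IH) auto
    show "\<alpha> m \<le> \<alpha> k" using km md by (rule dec)
    show "0 \<le> (\<Prod>j<k. \<alpha> j)" using pos km md by (intro prod_nonneg) (auto intro!: less_imp_le)
    show "0 \<le> \<alpha> m" using pos[OF md] by simp
  qed
  finally show ?case by (simp add: lessThan_Suc mult.commute)
qed

definition flags :: "nat \<Rightarrow> nat \<Rightarrow> (nat set \<times> nat) set" where
  "flags d k = (SIGMA S:{S. S \<subseteq> {..<d} \<and> card S = k}. {..<d} - S)"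

definition flag_weight :: "real \<Rightarrow> (nat \<Rightarrow> real) \<Rightarrow> nat set \<times> nat \<Rightarrow> real" where
  "flag_weight t c = (\<lambda>(S, l). (\<Prod>j\<in>S. c j) * c l powr t)"

lemma finite_flags: "finite (flags d k)"
  unfolding flags_def by (intro finite_SigmaI) auto

lemma card_flags: "card (flags d k) = (d - k) * (d choose k)"
proof -
  have "card (flags d k) = (\<Sum>S\<in>{S. S \<subseteq> {..<d} \<and> card S = k}. card ({..<d} - S))"
    unfolding flags_def by (intro card_SigmaI) auto
  also have "\<dots> = (\<Sum>S\<in>{S. S \<subseteq> {..<d} \<and> card S = k}. d - k)"
  proof (rule sum.cong[OF refl])
    fix S assume "S \<in> {S. S \<subseteq> {..<d} \<and> card S = k}"
    then show "card ({..<d} - S) = d - k"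
      using finite_subset[of S "{..<d}"] by (simp add: card_Diff_subset)
  qed
  also have "\<dots> = (d - k) * (d choose k)"
    using n_subsets[of "{..<d}" k] by simp
  finally show ?thesis .
qed

lemma flags_nonempty: "k < d \<Longrightarrow> flags d k \<noteq> {}"
proof -
  assume "k < d"
  then have "({..<k}, k) \<in> flags d k" by (auto simp: flags_def)
  then show ?thesis by blast
qed

lemma flag_weight_pos:
  assumes "(S, l) \<in> flags d k" "\<And>j. j < d \<Longrightarrow> 0 < c j"
  shows "0 < flag_weight t c (S, l)"
proof -
  have "S \<subseteq> {..<d}" "l < d" using assms(1) by (auto simp: flags_def)
  then have "0 < (\<Prod>j\<in>S. c j)" "0 < c l powr t"
    using assms(2)[of l] by (auto intro!: prod_pos assms(2))
  then show ?thesis by (simp add: flag_weight_def)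
qed

text \<open>
  The maximum is attained by the flag of the largest weights. That it is an upper bound follows from
  writing \<open>x * y powr t = x powr (1 - t) * (x * y) powr t\<close>: both bases on the right are products over sets of
  fixed size, and \<open>0 < t < 1\<close> makes both exponents positive.
\<close>
lemma sv_function_monomial:
  assumes A: "monomial_mat d \<pi> c A" and k: "k < d" and s: "real k < s" "s < real k + 1"
  shows "\<exists>v\<in>flags d k. sv_function s A = flag_weight (s - real k) c v"
    and "\<And>v. v \<in> flags d k \<Longrightarrow> flag_weight (s - real k) c v \<le> sv_function s A"
proof -
  define t where "t = s - real k"
  have t: "0 < t" "t < 1" using s by (auto simp: t_def)
  have c: "\<And>j. j < d \<Longrightarrow> 0 < c j" using A by (simp add: monomial_mat_def)
  define xs where "xs = rev (sort (map c [0..<d]))"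
  have len: "length xs = d" by (simp add: xs_def)
  have "mset xs = mset (map c [0..<d])" by (simp add: xs_def)
  then obtain \<tau> where \<tau>: "\<tau> permutes {..<d}" "permute_list \<tau> (map c [0..<d]) = xs"
    by (rule mset_eq_permutation) simp
  have \<tau>_in: "\<tau> j < d" if "j < d" for j using permutes_in_image[OF \<tau>(1), of j] that by simp
  have nth: "xs ! j = c (\<tau> j)" if "j < d" for j
    using that \<tau> \<tau>_in[OF that] permute_list_nth[of \<tau> "map c [0..<d]" j] by simp
  have "\<lfloor>s\<rfloor> = int k" using s by linarith
  then have "sv_function s A = (\<Prod>j<k. xs ! j) * (xs ! k) powr t"
    by (simp add: sv_function_def singular_values_monomial[OF A] xs_def t_def)
  also have "\<dots> = (\<Prod>j<k. c (\<tau> j)) * c (\<tau> k) powr t"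
    using nth k by simp
  finally have sv: "sv_function s A = (\<Prod>j<k. c (\<tau> j)) * c (\<tau> k) powr t" .
  have inj: "inj_on \<tau> T" for T using permutes_inj[OF \<tau>(1)] by (rule inj_on_subset) simp
  have "(\<tau> ` {..<k}, \<tau> k) \<in> flags d k"
    using k \<tau>_in inj_onD[OF inj[of UNIV]] by (auto simp: flags_def card_image[OF inj])
  moreover have "sv_function s A = flag_weight t c (\<tau> ` {..<k}, \<tau> k)"
    unfolding sv flag_weight_def by (simp add: prod.reindex[OF inj])
  ultimately show "\<exists>v\<in>flags d k. sv_function s A = flag_weight (s - real k) c v"
    unfolding t_def by blast
  fix v assume "v \<in> flags d k"
  then obtain S l where v: "v = (S, l)" "S \<subseteq> {..<d}" "card S = k" "l < d" "l \<notin> S"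
    by (auto simp: flags_def)
  have fin: "finite S" using v(2) by (rule finite_subset) simp
  define \<alpha> where "\<alpha> = (\<lambda>j. c (\<tau> j))"
  have \<alpha>_pos: "\<And>j. j < d \<Longrightarrow> 0 < \<alpha> j" using c \<tau>_in by (simp add: \<alpha>_def)
  have \<alpha>_dec: "\<alpha> j \<le> \<alpha> i" if "i \<le> j" "j < d" for i j
  proof -
    have "xs ! j \<le> xs ! i" using that len by (intro sorted_rev_nth_mono) (simp_all add: xs_def)
    then show ?thesis using that nth by (simp add: \<alpha>_def)
  qed
  have initial: "(\<Prod>j\<in>T. c j) \<le> (\<Prod>j<card T. \<alpha> j)" if T: "T \<subseteq> {..<d}" for T
  proof -
    have image: "\<tau> ` inv_into UNIV \<tau> ` T = T" using permutes_inverses(1)[OF \<tau>(1)] by (simp add: image_image)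
    have "(\<Prod>j\<in>T. c j) = (\<Prod>j\<in>\<tau> ` inv_into UNIV \<tau> ` T. c j)" by (simp only: image)
    also have "\<dots> = (\<Prod>j\<in>inv_into UNIV \<tau> ` T. \<alpha> j)" by (simp add: prod.reindex[OF inj] \<alpha>_def)
    also have "\<dots> \<le> (\<Prod>j<card T. \<alpha> j)"
    proof (rule prod_le_prod_initial[of d \<alpha>])
      show "inv_into UNIV \<tau> ` T \<subseteq> {..<d}"
        using T permutes_in_image[OF permutes_inv[OF \<tau>(1)]] by auto
      show "card (inv_into UNIV \<tau> ` T) = card T"
        using card_image[OF inj[of "inv_into UNIV \<tau> ` T"]] image by simp
    qed (use \<alpha>_pos \<alpha>_dec in blast)+
    finally show ?thesis .
  qed
  have interpolate: "x * y powr t = x powr (1 - t) * (x * y) powr t" if "0 < x" "0 < y" for x y :: real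
    using that by (simp add: powr_mult powr_diff)
  define x where "x = (\<Prod>j\<in>S. c j)"
  define X where "X = (\<Prod>j<k. \<alpha> j)"
  have x: "0 < x" unfolding x_def using c v(2) by (intro prod_pos) auto
  have X: "0 < X" unfolding X_def using \<alpha>_pos k by (intro prod_pos) auto
  have xX: "x \<le> X" unfolding x_def X_def using initial[OF v(2)] v(3) by simp
  have "x * c l = (\<Prod>j\<in>insert l S. c j)" using fin v(5) by (simp add: x_def mult.commute)
  also have "\<dots> \<le> (\<Prod>j<card (insert l S). \<alpha> j)" using v by (intro initial) auto
  also have "\<dots> = X * \<alpha> k" using fin v(3,5) by (simp add: X_def lessThan_Suc mult.commute)
  finally have xl: "x * c l \<le> X * \<alpha> k" .
  have "flag_weight t c v = x powr (1 - t) * (x * c l) powr t"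
    using interpolate[OF x c[OF v(4)]] by (simp add: flag_weight_def v(1) x_def)
  also have "\<dots> \<le> X powr (1 - t) * (X * \<alpha> k) powr t"
  proof (rule mult_mono)
    show "x powr (1 - t) \<le> X powr (1 - t)" using x xX t by (intro powr_mono2) auto
    show "(x * c l) powr t \<le> (X * \<alpha> k) powr t"
      using x xl t c[OF v(4)] by (intro powr_mono2[OF _ _ xl]) auto
  qed auto
  also have "\<dots> = X * \<alpha> k powr t" using interpolate[OF X \<alpha>_pos[OF k]] by simp
  also have "\<dots> = sv_function s A" unfolding sv by (simp add: X_def \<alpha>_def)
  finally show "flag_weight (s - real k) c v \<le> sv_function s A" unfolding t_def .
qed

section \<open>Equilibrium states of monomial matrices\<close>

definition flag_act :: "(nat \<Rightarrow> nat \<Rightarrow> nat) \<Rightarrow> nat \<Rightarrow> nat set \<times> nat \<Rightarrow> nat set \<times> nat" where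
  "flag_act \<pi> a = (\<lambda>(S, l). (\<pi> a ` S, \<pi> a l))"

lemma act_flag_act: "act (flag_act \<pi>) w (S, l) = (act \<pi> w ` S, act \<pi> w l)"
  by (induction w) (simp_all add: flag_act_def image_image)

locale monomial_matrices =
  fixes N d k :: nat and s :: real and \<pi> :: "nat \<Rightarrow> nat \<Rightarrow> nat" and c :: "nat \<Rightarrow> nat \<Rightarrow> real"
    and A :: "nat \<Rightarrow> real mat"
  assumes letters: "1 \<le> N" and k: "k < d" and s: "real k < s" "s < real k + 1"
    and monomial: "a \<in> {1..N} \<Longrightarrow> monomial_mat d (\<pi> a) (c a) (A a)"
begin

abbreviation weight :: "nat \<Rightarrow> nat set \<times> nat \<Rightarrow> real" where
  "weight a \<equiv> flag_weight (s - real k) (c a)"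

lemma word_monomial: "w \<in> words N n \<Longrightarrow> monomial_mat d (act \<pi> w) (cocycle \<pi> c w) (word_mat d A w)"
  using monomial by (rule monomial_word_mat)

text \<open>
  The weights of flags form the cocycle over the action on flags that is induced by the cocycle of
  column weights.
\<close>
lemma cocycle_flag:
  assumes "w \<in> words N n" and v: "(S, l) \<in> flags d k"
  shows "cocycle (flag_act \<pi>) weight w (S, l) = flag_weight (s - real k) (cocycle \<pi> c w) (S, l)"
  using assms(1)
proof (induction w rule: words_induct)
  case (Cons a w n)
  have S: "S \<subseteq> {..<d}" and l: "l < d" using v by (auto simp: flags_def)
  have m: "monomial_mat d (act \<pi> w) (cocycle \<pi> c w) (word_mat d A w)" by (rule word_monomial[OF Cons(2)])
  have "inj_on (act \<pi> w) {..<d}" using m by (simp add: monomial_mat_def bij_betw_def)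
  then have inj: "inj_on (act \<pi> w) S" using S by (rule inj_on_subset)
  have "act \<pi> w l \<in> {..<d}" using m l by (auto simp: monomial_mat_def dest: bij_betwE)
  then have "0 < c a (act \<pi> w l)" using monomial[OF Cons(1)] by (simp add: monomial_mat_def)
  moreover have "0 < cocycle \<pi> c w l" using m l by (simp add: monomial_mat_def)
  ultimately show ?case
    using Cons.IH by (simp add: act_flag_act flag_weight_def prod.reindex[OF inj] prod.distrib powr_mult mult_ac)
qed (simp add: flag_weight_def)

sublocale letter_system N "flags d k" "flag_act \<pi>" weight
proof
  show "1 \<le> N" by (rule letters)
  show "finite (flags d k)" by (rule finite_flags)
  show "flags d k \<noteq> {}" by (rule flags_nonempty[OF k])
  fix a assume a: "a \<in> {1..N}"
  have bij: "bij_betw (\<pi> a) {..<d} {..<d}" and c: "\<And>j. j < d \<Longrightarrow> 0 < c a j"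
    using monomial[OF a] by (simp_all add: monomial_mat_def)
  have inj: "inj_on (\<pi> a) {..<d}" by (rule bij_betw_imp_inj_on[OF bij])
  have \<pi>: "\<pi> a j < d" if "j < d" for j using bij_betwE[OF bij] that by auto
  show "0 < weight a v" if "v \<in> flags d k" for v
    using that c by (cases v) (auto intro: flag_weight_pos)
  have "flag_act \<pi> a v \<in> flags d k" if v: "v \<in> flags d k" for v
  proof -
    obtain S l where v_eq: "v = (S, l)" by (cases v)
    have S: "S \<subseteq> {..<d}" "card S = k" "l < d" "l \<notin> S" using v by (auto simp: v_eq flags_def)
    have "\<pi> a ` S \<subseteq> {..<d}" using S(1) \<pi> by auto
    moreover have "card (\<pi> a ` S) = k" using card_image[OF inj_on_subset[OF inj S(1)]] S(2) by simp
    moreover have "\<pi> a l \<notin> \<pi> a ` S"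
      using inj_on_image_mem_iff[OF inj _ S(1), of l] S(3,4) by simp
    ultimately show ?thesis using \<pi>[OF S(3)] by (simp add: v_eq flags_def flag_act_def)
  qed
  then have "flag_act \<pi> a ` flags d k \<subseteq> flags d k" by blast
  moreover have "inj_on (flag_act \<pi> a) (flags d k)"
  proof (rule inj_onI)
    fix u v assume uv: "u \<in> flags d k" "v \<in> flags d k" "flag_act \<pi> a u = flag_act \<pi> a v"
    obtain S l S' l' where eq: "u = (S, l)" "v = (S', l')" by (cases u, cases v)
    have sub: "S \<subseteq> {..<d}" "S' \<subseteq> {..<d}" "l \<in> {..<d}" "l' \<in> {..<d}"
      using uv by (auto simp: eq flags_def)
    have im: "\<pi> a ` S = \<pi> a ` S'" "\<pi> a l = \<pi> a l'" using uv(3) by (simp_all add: eq flag_act_def)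
    have "S = S'" using inj_on_image_eq_iff[OF inj sub(1,2)] im(1) by simp
    moreover have "l = l'" by (rule inj_onD[OF inj im(2) sub(3,4)])
    ultimately show "u = v" by (simp add: eq)
  qed
  ultimately show "bij_betw (flag_act \<pi> a) (flags d k) (flags d k)"
    by (simp add: bij_betw_def endo_inj_surj finite_flags)
qed

lemma cocycle_le_sv_function:
  assumes w: "w \<in> words N n" and v: "v \<in> flags d k"
  shows "cocycle (flag_act \<pi>) weight w v \<le> sv_function s (word_mat d A w)"
proof -
  obtain S l where eq: "v = (S, l)" by (cases v)
  show ?thesis
    using sv_function_monomial(2)[OF word_monomial[OF w] k s v] cocycle_flag[OF w] v by (simp add: eq)
qed

lemma sv_function_le_sum_cocycle:
  assumes w: "w \<in> words N n"
  shows "sv_function s (word_mat d A w) \<le> (\<Sum>v\<in>flags d k. cocycle (flag_act \<pi>) weight w v)"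
proof -
  obtain v where v: "v \<in> flags d k" "sv_function s (word_mat d A w) = flag_weight (s - real k) (cocycle \<pi> c w) v"
    using sv_function_monomial(1)[OF word_monomial[OF w] k s] by blast
  obtain S l where eq: "v = (S, l)" by (cases v)
  have "sv_function s (word_mat d A w) = cocycle (flag_act \<pi>) weight w v"
    using v cocycle_flag[OF w] by (simp add: eq)
  also have "\<dots> \<le> (\<Sum>v\<in>flags d k. cocycle (flag_act \<pi>) weight w v)"
    using v(1) finite_flags cocycle_pos[OF w] by (intro member_le_sum) (auto intro: less_imp_le)
  finally show ?thesis .
qed

lemma equilibrium_states_structure:
  obtains \<rho> :: "nat set \<times> nat \<Rightarrow> real" and \<mu>
  where "ergodic_equilibrium_states d N A s = \<mu> ` {v \<in> flags d k. \<rho> v = Max (\<rho> ` flags d k)}"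
    "\<And>\<nu>. \<nu> \<in> equilibrium_states d N A s \<Longrightarrow> fully_supported N \<nu>"
    "\<And>v a. v \<in> flags d k \<Longrightarrow> (\<And>b. b \<in> {1..N} \<Longrightarrow> flag_act \<pi> b v = v) \<Longrightarrow> a \<in> {1..N} \<Longrightarrow>
      \<rho> v = (\<Sum>a\<in>{1..N}. weight a v) \<and> mass N (\<mu> v) [a] = weight a v / \<rho> v"
proof -
  obtain \<rho> \<mu> b C K
    where gibbs: "gibbs_family N (flags d k) \<rho> \<mu> (\<lambda>w. sv_function s (word_mat d A w)) b C K"
    and pos: "\<And>v n w. v \<in> flags d k \<Longrightarrow> w \<in> words N n \<Longrightarrow> 0 < mass N (\<mu> v) w"
    and fixed: "\<And>v a. v \<in> flags d k \<Longrightarrow> (\<And>b. b \<in> {1..N} \<Longrightarrow> flag_act \<pi> b v = v) \<Longrightarrow> a \<in> {1..N} \<Longrightarrow>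
      \<rho> v = (\<Sum>a\<in>{1..N}. weight a v) \<and> mass N (\<mu> v) [a] = weight a v / \<rho> v"
    by (rule exists_gibbs_family[of "\<lambda>w. sv_function s (word_mat d A w)"],
        erule (1) cocycle_le_sv_function, erule sv_function_le_sum_cocycle, blast)
  interpret G: gibbs_family N "flags d k" \<rho> \<mu> "\<lambda>w. sv_function s (word_mat d A w)" b C K by (rule gibbs)
  have eq: "\<nu> \<in> equilibrium_states d N A s \<longleftrightarrow> G.is_equilibrium \<nu>" for \<nu>
    by (simp add: equilibrium_states_def G.is_equilibrium_def pressure_def lyapunov_def G.lyap_def invariant_measures_iff)
  show ?thesis
  proof (rule that[of \<mu> \<rho>])
    show "ergodic_equilibrium_states d N A s = \<mu> ` {v \<in> flags d k. \<rho> v = Max (\<rho> ` flags d k)}"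
      using G.ergodic_equilibrium_iff
      by (auto simp: ergodic_equilibrium_states_def eq G.Vmax_def G.\<rho>max_def)
    show "fully_supported N \<nu>" if "\<nu> \<in> equilibrium_states d N A s" for \<nu>
      using that pos by (intro G.equilibrium_fully_supported) (simp_all add: eq)
  qed (rule fixed)
qed

end


section \<open>Sharpness: diagonal matrices\<close>

text \<open>
  Matrix \<open>a\<close> of the example is diagonal with entry 2 at position \<open>a - 1\<close> and 1 elsewhere. The letter
  \<open>d + 1\<close> therefore carries the identity matrix; it is included so that there are at least two letters
  also if \<open>d = 1\<close>.
\<close>
definition bump :: "nat \<Rightarrow> nat \<Rightarrow> real" where
  "bump a j = (if a = Suc j then 2 else 1)"

lemma flag_weight_bump:
  assumes "(S, l) \<in> flags d k" "t \<noteq> 0"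
  shows "flag_weight t (bump a) (S, l) = (if a \<in> Suc ` S then 2 else if a = Suc l then 2 powr t else 1)"
proof -
  have S: "finite S" "l \<notin> S" using assms(1) finite_subset[of S "{..<d}"] by (auto simp: flags_def)
  have "(\<Prod>j\<in>S. bump a j) = (if a \<in> Suc ` S then 2 else 1)"
  proof (cases "a \<in> Suc ` S")
    case True
    then obtain i where i: "a = Suc i" "i \<in> S" by blast
    have "(\<Prod>j\<in>S. bump a j) = bump a i * (\<Prod>j\<in>S - {i}. bump a j)" by (rule prod.remove[OF S(1) i(2)])
    also have "(\<Prod>j\<in>S - {i}. bump a j) = 1" by (rule prod.neutral) (auto simp: bump_def i(1))
    finally show ?thesis using True i(1) by (simp add: bump_def)
  next
    case False
    then show ?thesis by (auto simp: bump_def intro!: prod.neutral)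
  qed
  then show ?thesis using S(2) by (auto simp: flag_weight_def bump_def)
qed

lemma sum_flag_weight_bump:
  assumes v: "(S, l) \<in> flags d k" "t \<noteq> 0"
  shows "(\<Sum>a\<in>{1..Suc d}. flag_weight t (bump a) (S, l)) = 2 * real k + 2 powr t + (real d - real k)"
proof -
  have S: "S \<subseteq> {..<d}" "card S = k" "l < d" "l \<notin> S" and fin: "finite S"
    using v(1) finite_subset[of S "{..<d}"] by (auto simp: flags_def)
  have sub: "insert (Suc l) (Suc ` S) \<subseteq> {1..Suc d}" using S by auto
  have "(\<Sum>a\<in>{1..Suc d}. flag_weight t (bump a) (S, l))
      = (\<Sum>a\<in>{1..Suc d}. 1 + (if a \<in> Suc ` S then 1 else 0) + (if a = Suc l then 2 powr t - 1 else 0))"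
    using S(4) by (intro sum.cong refl) (auto simp: flag_weight_bump[OF v])
  also have "\<dots> = real (Suc d) + real (card ({1..Suc d} \<inter> Suc ` S)) + (2 powr t - 1)"
    using S(3) by (simp add: sum.distrib sum.If_cases Int_def del: sum.cl_ivl_Suc)
  also have "{1..Suc d} \<inter> Suc ` S = Suc ` S" using sub by blast
  also have "card (Suc ` S) = k" using S(2) by (simp add: card_image)
  finally show ?thesis by simp
qed

text \<open>
  All flags are fixed, so their eigenvalues are sums over the letters, and these depend only on \<open>d\<close>, \<open>k\<close>
  and \<open>s\<close>. The letter \<open>j + 1\<close> has weight 2, \<open>2 powr (s - k)\<close> or 1 at the flag \<open>(S, l)\<close> according as
  \<open>j \<in> S\<close>, \<open>j = l\<close> or neither. These three values are distinct since \<open>0 < s - k < 1\<close>, so the flag can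
  be recovered from its measure.
\<close>
lemma sharp_example:
  assumes k: "k < d" and s: "real k < s" "s < real k + 1"
  shows "\<exists>A :: nat \<Rightarrow> real mat. (\<forall>i\<in>{1..Suc d}. A i \<in> gen_perm_mats d) \<and>
    finite (ergodic_equilibrium_states d (Suc d) A s) \<and>
    card (ergodic_equilibrium_states d (Suc d) A s) = (d - k) * (d choose k)"
proof -
  define t where "t = s - real k"
  have t: "0 < t" "t < 1" using s by (auto simp: t_def)
  define A where "A a = mat d d (\<lambda>(i, j). if i = j then bump a j else 0)" for a
  have mono: "monomial_mat d (\<lambda>j. j) (bump a) (A a)" for a
    by (auto simp: monomial_mat_def A_def bump_def bij_betw_def)
  interpret monomial_matrices "Suc d" d k s "\<lambda>_ j. j" bump A
    by unfold_locales (use k s mono in auto)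
  obtain \<rho> :: "nat set \<times> nat \<Rightarrow> real" and \<mu>
    where erg: "ergodic_equilibrium_states d (Suc d) A s = \<mu> ` {v \<in> flags d k. \<rho> v = Max (\<rho> ` flags d k)}"
    and fixed: "\<And>v a. v \<in> flags d k \<Longrightarrow> (\<And>b. b \<in> {1..Suc d} \<Longrightarrow> flag_act (\<lambda>_ j. j) b v = v) \<Longrightarrow> a \<in> {1..Suc d} \<Longrightarrow>
      \<rho> v = (\<Sum>a\<in>{1..Suc d}. weight a v) \<and> measure (\<mu> v) (cylinder (Suc d) [a]) = weight a v / \<rho> v"
    by (rule equilibrium_states_structure) blast
  define R where "R = 2 * real k + 2 powr t + (real d - real k)"
  have R: "0 < R" using k by (simp add: R_def add_nonneg_pos add_pos_nonneg)
  have trivial_act: "flag_act (\<lambda>_ j. j) b v = v" for b v by (cases v) (simp add: flag_act_def)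
  have \<rho>: "\<rho> v = R" if v: "v \<in> flags d k" for v
  proof -
    obtain S l where eq: "v = (S, l)" by (cases v)
    have "\<rho> v = (\<Sum>a\<in>{1..Suc d}. weight a v)" using fixed[OF v trivial_act, of 1] by simp
    then show ?thesis
      using sum_flag_weight_bump[of S l d k t] v t by (simp add: eq R_def t_def)
  qed
  have "\<rho> ` flags d k = {R}" using \<rho> flags_nonempty[OF k] by force
  then have all: "{v \<in> flags d k. \<rho> v = Max (\<rho> ` flags d k)} = flags d k" using \<rho> by auto
  have "inj_on \<mu> (flags d k)"
  proof (rule inj_onI)
    fix u v assume u: "u \<in> flags d k" and v: "v \<in> flags d k" and \<mu>: "\<mu> u = \<mu> v"
    obtain S l S' l' where eq: "u = (S, l)" "v = (S', l')" by (cases u, cases v)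
    have mem: "(S, l) \<in> flags d k" "(S', l') \<in> flags d k" using u v by (simp_all add: eq)
    have w: "flag_weight t (bump a) (S, l) = flag_weight t (bump a) (S', l')" if a: "a \<in> {1..Suc d}" for a
    proof -
      have "weight a u / R = weight a v / R"
        using fixed[OF u trivial_act a] fixed[OF v trivial_act a] \<mu> \<rho>[OF u] \<rho>[OF v] by simp
      then show ?thesis using R by (simp add: eq t_def)
    qed
    have "2 powr 0 < (2 :: real) powr t" using t by (intro powr_less_mono) auto
    then have p1: "(2 :: real) powr t \<noteq> 1" using t by simp
    have "(2 :: real) powr t < 2 powr 1" using t by (intro powr_less_mono) auto
    then have p2: "(2 :: real) powr t \<noteq> 2" by simp
    have t0: "t \<noteq> 0" using t by simp
    note weights = flag_weight_bump[OF mem(1) t0] flag_weight_bump[OF mem(2) t0]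
    have S_iff: "j \<in> S \<longleftrightarrow> j \<in> S'" and l_iff: "j = l \<longleftrightarrow> j = l'" if "j < d" for j
    proof -
      have "Suc j \<in> {1..Suc d}" using that by simp
      then have "(if j \<in> S then 2 else if j = l then 2 powr t else 1 :: real)
          = (if j \<in> S' then 2 else if j = l' then 2 powr t else 1)"
        using w[of "Suc j"] unfolding weights by (simp only: inj_image_mem_iff[OF inj_Suc] nat.inject)
      moreover have "l \<notin> S" "l' \<notin> S'" using mem by (auto simp: flags_def)
      ultimately show "j \<in> S \<longleftrightarrow> j \<in> S'" "j = l \<longleftrightarrow> j = l'"
        using p1 p2 by (auto split: if_splits)
    qed
    have "S \<subseteq> {..<d}" "S' \<subseteq> {..<d}" "l < d" using mem by (auto simp: flags_def)
    then have "S = S'" "l = l'" using S_iff l_iff[of l] by (blast, simp)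
    then show "u = v" by (simp add: eq)
  qed
  then have "card (ergodic_equilibrium_states d (Suc d) A s) = (d - k) * (d choose k)"
    unfolding erg all by (simp add: card_image card_flags)
  moreover have "finite (ergodic_equilibrium_states d (Suc d) A s)"
    unfolding erg all by (simp add: finite_flags)
  moreover have "A i \<in> gen_perm_mats d" for i by (rule monomial_imp_gen_perm_mats[OF mono])
  ultimately show ?thesis by blast
qed

theorem theorem4:
  fixes d k :: nat and s :: real
  assumes "d \<ge> 1" and "k \<in> {0..d - 1}" and "real k < s" and "s < real k + 1"
  shows "(\<forall>N\<ge>2. \<forall>A :: nat \<Rightarrow> real mat. (\<forall>i\<in>{1..N}. A i \<in> gen_perm_mats d) \<longrightarrow>
            finite (ergodic_equilibrium_states d N A s) \<and>
            card (ergodic_equilibrium_states d N A s) \<le> (d - k) * (d choose k)) \<and>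
         (\<exists>N\<ge>2. \<exists>A :: nat \<Rightarrow> real mat. (\<forall>i\<in>{1..N}. A i \<in> gen_perm_mats d) \<and>
            finite (ergodic_equilibrium_states d N A s) \<and>
            card (ergodic_equilibrium_states d N A s) = (d - k) * (d choose k)) \<and>
         (\<forall>N\<ge>2. \<forall>A :: nat \<Rightarrow> real mat. (\<forall>i\<in>{1..N}. A i \<in> gen_perm_mats d) \<longrightarrow>
            (\<forall>\<mu>\<in>equilibrium_states d N A s. fully_supported N \<mu>))"
proof -
  have k: "k < d" using assms(1,2) by simp
  have general: "(finite (ergodic_equilibrium_states d N A s) \<and>
        card (ergodic_equilibrium_states d N A s) \<le> (d - k) * (d choose k)) \<and>
      (\<forall>\<mu>\<in>equilibrium_states d N A s. fully_supported N \<mu>)"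
    if N: "N \<ge> 2" and A: "\<forall>i\<in>{1..N}. A i \<in> gen_perm_mats d" for N and A :: "nat \<Rightarrow> real mat"
  proof -
    have "\<forall>a\<in>{1..N}. \<exists>\<pi> c. monomial_mat d \<pi> c (A a)"
      using A gen_perm_mats_imp_monomial by metis
    then obtain \<pi> c where mono: "\<And>a. a \<in> {1..N} \<Longrightarrow> monomial_mat d (\<pi> a) (c a) (A a)" by metis
    interpret monomial_matrices N d k s \<pi> c A
      by (rule monomial_matrices.intro) (use N k assms(3,4) mono in simp_all)
    obtain \<rho> :: "nat set \<times> nat \<Rightarrow> real" and \<mu>
      where erg: "ergodic_equilibrium_states d N A s = \<mu> ` {v \<in> flags d k. \<rho> v = Max (\<rho> ` flags d k)}"
      and supp: "\<And>\<nu>. \<nu> \<in> equilibrium_states d N A s \<Longrightarrow> fully_supported N \<nu>"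
      by (rule equilibrium_states_structure) blast
    have sub: "{v \<in> flags d k. \<rho> v = Max (\<rho> ` flags d k)} \<subseteq> flags d k" by blast
    have fin: "finite {v \<in> flags d k. \<rho> v = Max (\<rho> ` flags d k)}"
      using sub finite_flags by (rule finite_subset)
    have "card (ergodic_equilibrium_states d N A s) \<le> card {v \<in> flags d k. \<rho> v = Max (\<rho> ` flags d k)}"
      unfolding erg by (rule card_image_le[OF fin])
    also have "\<dots> \<le> card (flags d k)" by (rule card_mono[OF finite_flags sub])
    finally show ?thesis using fin supp by (simp add: card_flags erg)
  qed
  have "Suc d \<ge> 2" using assms(1) by simp
  then have sharp: "\<exists>N\<ge>2. \<exists>A :: nat \<Rightarrow> real mat. (\<forall>i\<in>{1..N}. A i \<in> gen_perm_mats d) \<and>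
      finite (ergodic_equilibrium_states d N A s) \<and>
      card (ergodic_equilibrium_states d N A s) = (d - k) * (d choose k)"
    using sharp_example[OF k assms(3,4)] by blast
  show ?thesis
    by (intro conjI allI impI sharp) (use general in blast)+
qed

end
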